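(* For every $\varepsilon>0$ there exists $\ell_0=\ell_0(\varepsilon)$ such that for all integers $\ell\ge \ell_0$, every oriented cycle $C_\ell$ on $\ell$ vertices, and every integer $m\ge 1$, the following holds: every oriented graph $G$ on $\ell m$ vertices with minimum semi-degree $\delta^0(G)\ge (3/8+\varepsilon)m\ell$ contains a $C_\ell$-factor.
   Context: An oriented graph is a digraph with no loops, no multiple edges and at most one edge between any pair of vertices (i.e. an orientation of a simple graph). An oriented cycle $C_\ell$ on $\ell$ vertices is any orientation of the (undirected) cycle on $\ell$ vertices; edges need not all point the same way. For a digraph $G$, $d^+(v)$ and $d^-(v)$ denote the out-degree and in-degree of $v$, and the minimum semi-degree is $\delta^0(G)=\min\{d^+(v),d^-(v): v\in V(G)\}$. A $C_\ell$-factor in $G$ is a collection of vertex-disjoint copies of $C_\ell$ in $G$ covering all vertices of $G$. *)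

theory Defs
  imports Complex_Main
begin

definition oriented_graph :: "'a set \<Rightarrow> ('a \<Rightarrow> 'a \<Rightarrow> bool) \<Rightarrow> bool" where
  "oriented_graph V E \<longleftrightarrow> finite V \<and>
     (\<forall>u v. E u v \<longrightarrow> u \<in> V \<and> v \<in> V) \<and>
     (\<forall>u. \<not> E u u) \<and>
     (\<forall>u v. E u v \<longrightarrow> \<not> E v u)"

definition out_degree :: "'a set \<Rightarrow> ('a \<Rightarrow> 'a \<Rightarrow> bool) \<Rightarrow> 'a \<Rightarrow> nat" where
  "out_degree V E v = card {u \<in> V. E v u}"

definition in_degree :: "'a set \<Rightarrow> ('a \<Rightarrow> 'a \<Rightarrow> bool) \<Rightarrow> 'a \<Rightarrow> nat" where
  "in_degree V E v = card {u \<in> V. E u v}"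

text \<open>Minimum semi-degree (for nonempty V).\<close>
definition min_semidegree :: "'a set \<Rightarrow> ('a \<Rightarrow> 'a \<Rightarrow> bool) \<Rightarrow> nat" where
  "min_semidegree V E = Min ((\<lambda>v. min (out_degree V E v) (in_degree V E v)) ` V)"

text \<open>An oriented cycle on l vertices (l \<ge> 3) is encoded by its vertex set
  {0..<l}, cyclically ordered, together with a direction pattern
  dir :: nat \<Rightarrow> bool: for i < l, the edge between i and (i+1) mod l points
  from i to (i+1) mod l iff dir i. Every orientation of the undirected cycle
  arises this way.\<close>
definition cycle_edge :: "nat \<Rightarrow> (nat \<Rightarrow> bool) \<Rightarrow> nat \<Rightarrow> nat \<Rightarrow> bool" where
  "cycle_edge l dir i j \<longleftrightarrow>
     (\<exists>k<l. (dir k \<and> i = k \<and> j = (k + 1) mod l) \<or> (\<not> dir k \<and> i = (k + 1) mod l \<and> j = k))"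

definition is_cycle_copy ::
  "nat \<Rightarrow> (nat \<Rightarrow> bool) \<Rightarrow> 'a set \<Rightarrow> ('a \<Rightarrow> 'a \<Rightarrow> bool) \<Rightarrow> (nat \<Rightarrow> 'a) \<Rightarrow> bool" where
  "is_cycle_copy l dir V E f \<longleftrightarrow>
     inj_on f {0..<l} \<and> f ` {0..<l} \<subseteq> V \<and>
     (\<forall>i j. cycle_edge l dir i j \<longrightarrow> E (f i) (f j))"

definition has_cycle_factor ::
  "nat \<Rightarrow> (nat \<Rightarrow> bool) \<Rightarrow> 'a set \<Rightarrow> ('a \<Rightarrow> 'a \<Rightarrow> bool) \<Rightarrow> bool" where
  "has_cycle_factor l dir V E \<longleftrightarrow>
     (\<exists>F :: (nat \<Rightarrow> 'a) set.
        (\<forall>f\<in>F. is_cycle_copy l dir V E f) \<and>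
        (\<forall>f\<in>F. \<forall>g\<in>F. f \<noteq> g \<longrightarrow> f ` {0..<l} \<inter> g ` {0..<l} = {}) \<and>
        (\<Union>f\<in>F. f ` {0..<l}) = V)"

end

(*
Proof idea. All m cycles are embedded together, with an absorbing structure that needs neither
regularity nor a blow-up lemma. The degree bound makes every vertex set of size at least 3n/8
expand robustly along arcs and along reversed arcs, so any two vertices are joined by a path with
any prescribed word of bounded length, even after forbidding a small set. A gadget consists of
equally labelled strands whose interiors can be rearranged so that one additional vertex v fits in;
its ends contain two bounded almost dominating sets, so almost every v is accepted. A small
proportion of each cycle carries z gadgets. The remaining positions are covered by long pieces,
which come from near-perfect matchings between the parts of an even random-like partition inside a
spanning regular subgraph (repeated use of Hall's theorem), and by short connecting paths in a
reserved part. Exactly z vertices remain, and Hall's theorem assigns them to the gadgets.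
*)
theory Submission
  imports Defs "HOL-Library.Multiset"
begin

subsection \<open>Hall's theorem\<close>

text \<open>The difficulty is that every orientation of the cycle must be handled, with
  \<open>l\<close> bounded below in terms of \<open>e\<close> alone and \<open>m\<close> arbitrary.
  Words of bounded length come in boundedly many types: a pigeonhole choice gives all strands one
  common label, and the long pieces fall into at most \<open>2 ^ q\<close> classes. A vertex cannot
  simply be inserted into a path, since all later letters would shift; a gadget is therefore kept
  one vertex short, and moving its strands by one place opens the gap exactly where the vertex fits.
  The \<open>z\<close> absorbed vertices also pay for what is inexact elsewhere: the slack of the
  parts and the reserve together need at most \<open>z\<close> vertices, which is why
  \<open>z\<close> is linear in \<open>card V\<close>. The constant 3/8 is what an arc count between
  the four sets cut out by a set and its robust neighbourhood needs
  (\<open>expansion_arith\<close>). The regular subgraph is there because matchings between parts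
  are nearly perfect only if the degrees seen from both sides almost agree. No probability is used:
  the random-like partition comes from an exponential potential, the dominating sets from weighted
  averaging.\<close>

lemma hall:
  assumes "finite I" "\<And>i. i \<in> I \<Longrightarrow> finite (A i)"
    and "\<And>J. J \<subseteq> I \<Longrightarrow> card J \<le> card (\<Union>i\<in>J. A i)"
  shows "\<exists>f. inj_on f I \<and> (\<forall>i\<in>I. f i \<in> A i)"
  using assms
proof (induction "card I" arbitrary: I A rule: less_induct)
  case less
  note fin = less.prems(1) and finA = less.prems(2) and H = less.prems(3)
  have finU: "finite (\<Union>i\<in>J. A i)" if "J \<subseteq> I" for J
    using that fin finA by (meson finite_UN finite_subset subsetD)
  show ?case
  proof (cases "I = {}")
    case True
    then show ?thesis by auto
  next
    case False
    show ?thesis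
    \<comment> \<open>Hall's dichotomy: a tight proper subfamily is matched first and its elements
      are withdrawn from the other indices; without one, every nonempty proper subfamily has an
      element to spare, so the choice for one index is free.\<close>
    proof (cases "\<exists>J. J \<noteq> {} \<and> J \<subset> I \<and> card (\<Union>i\<in>J. A i) = card J")
      case True
      then obtain J where J: "J \<noteq> {}" "J \<subset> I" "card (\<Union>i\<in>J. A i) = card J" by blast
      let ?X = "\<Union>i\<in>J. A i"
      have JI: "card J < card I" using J fin by (simp add: psubset_card_mono)
      obtain f where f: "inj_on f J" "\<forall>i\<in>J. f i \<in> A i"
        using less.hyps[OF JI, of A] fin finA H J by (metis finite_subset psubsetE subset_trans subsetD)
      have "card (I - J) < card I" using J fin by (intro psubset_card_mono) auto
      moreover have "card J' \<le> card (\<Union>i\<in>J'. A i - ?X)" if J': "J' \<subseteq> I - J" for J'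
      proof -
        have "card (J \<union> J') \<le> card (\<Union>i\<in>J \<union> J'. A i)" using J' J by (intro H) auto
        also have "(\<Union>i\<in>J \<union> J'. A i) = ?X \<union> (\<Union>i\<in>J'. A i - ?X)" by auto
        also have "card \<dots> \<le> card ?X + card (\<Union>i\<in>J'. A i - ?X)" by (rule card_Un_le)
        also have "card (J \<union> J') = card J + card J'"
          using J' J fin by (intro card_Un_disjoint) (auto intro: finite_subset)
        finally show ?thesis using J by simp
      qed
      ultimately obtain g where g: "inj_on g (I - J)" "\<forall>i\<in>I - J. g i \<in> A i - ?X"
        using less.hyps[of "I - J" "\<lambda>i. A i - ?X"] fin finA by (metis (no_types, lifting) DiffD1 finite_Diff)
      have "inj_on (\<lambda>i. if i \<in> J then f i else g i) I"
      proof (rule inj_onI)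
        fix a b assume ab: "a \<in> I" "b \<in> I" "(if a \<in> J then f a else g a) = (if b \<in> J then f b else g b)"
        have fX: "f i \<in> ?X" if "i \<in> J" for i using f(2) that by blast
        have gX: "g i \<notin> ?X" if "i \<in> I" "i \<notin> J" for i using g(2) that by blast
        consider "a \<in> J" "b \<in> J" | "a \<in> J" "b \<notin> J" | "a \<notin> J" "b \<in> J" | "a \<notin> J" "b \<notin> J" by blast
        then show "a = b"
        proof cases
          case 1 then show ?thesis using ab f(1) by (simp add: inj_onD)
        next
          case 2 then show ?thesis using ab fX[of a] gX[of b] by simp
        next
          case 3 then show ?thesis using ab fX[of b] gX[of a] by simp
        next
          case 4 then show ?thesis using ab g(1) by (simp add: inj_on_def)
        qed
      qed
      moreover have "\<forall>i\<in>I. (if i \<in> J then f i else g i) \<in> A i" using f g by auto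
      ultimately show ?thesis by blast
    next
      case no: False
      obtain i where i: "i \<in> I" using False by blast
      have "card {i} \<le> card (A i)" using H[of "{i}"] i by simp
      then obtain x where x: "x \<in> A i" using finA[OF i] by fastforce
      have "card (I - {i}) < card I" using i fin by (intro psubset_card_mono) auto
      moreover have "card J \<le> card (\<Union>j\<in>J. A j - {x})" if J: "J \<subseteq> I - {i}" for J
      proof (cases "J = {}")
        case False
        have "J \<subset> I" using J i by auto
        then have "card J < card (\<Union>j\<in>J. A j)" using no H[of J] False
          by (metis le_neq_implies_less psubsetE)
        moreover have "(\<Union>j\<in>J. A j - {x}) = (\<Union>j\<in>J. A j) - {x}" by auto
        ultimately show ?thesis
          by (cases "x \<in> (\<Union>j\<in>J. A j)") auto
      qed simp
      ultimately obtain g where g: "inj_on g (I - {i})" "\<forall>j\<in>I - {i}. g j \<in> A j - {x}"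
        using less.hyps[of "I - {i}" "\<lambda>j. A j - {x}"] fin finA by (metis (no_types, lifting) DiffD1 finite_Diff)
      have "inj_on (g(i := x)) I" using g unfolding inj_on_def by auto
      moreover have "\<forall>j\<in>I. (g(i := x)) j \<in> A j" using g x by auto
      ultimately show ?thesis by blast
    qed
  qed
qed

text \<open>Offering \<open>k\<close> dummy elements to every index restores Hall's condition; by
  injectivity at most \<open>k\<close> indices take a dummy, and these are dropped.\<close>

lemma hall_defect:
  assumes fin: "finite I" and finA: "\<And>i. i \<in> I \<Longrightarrow> finite (A i)"
    and H: "\<And>J. J \<subseteq> I \<Longrightarrow> card J \<le> card (\<Union>i\<in>J. A i) + k"
  shows "\<exists>I' f. I' \<subseteq> I \<and> card I \<le> card I' + k \<and> inj_on f I' \<and> (\<forall>i\<in>I'. f i \<in> A i)"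
proof -
  define B where "B = (\<lambda>i. (Inl ` A i \<union> Inr ` {..<k}) :: ('b + nat) set)"
  have "card J \<le> card (\<Union>i\<in>J. B i)" if J: "J \<subseteq> I" for J
  proof (cases "J = {}")
    case False
    have "(\<Union>i\<in>J. B i) = Inl ` (\<Union>i\<in>J. A i) \<union> Inr ` {..<k}" using False by (auto simp: B_def)
    moreover have "finite (\<Union>i\<in>J. A i)" using J fin finA by (meson finite_UN finite_subset subsetD)
    ultimately have "card (\<Union>i\<in>J. B i) = card (\<Union>i\<in>J. A i) + k"
      by (simp only:) (subst card_Un_disjoint, auto simp: card_image)
    then show ?thesis using H[OF J] by simp
  qed simp
  moreover have "finite (B i)" if "i \<in> I" for i using finA that by (simp add: B_def)
  ultimately obtain f where f: "inj_on f I" "\<forall>i\<in>I. f i \<in> B i"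
    using hall[OF fin, of B] by blast
  define I' where "I' = {i \<in> I. isl (f i)}"
  have "f ` (I - I') \<subseteq> Inr ` {..<k}" using f(2) by (fastforce simp: I'_def B_def)
  then have "card (I - I') \<le> card (Inr ` {..<k} :: ('b + nat) set)"
    using f(1) by (metis Diff_subset card_image card_mono finite_imageI finite_lessThan inj_on_subset)
  then have "card (I - I') \<le> k" by (simp add: card_image)
  moreover have "card I = card I' + card (I - I')"
    using fin by (subst card_Un_disjoint[symmetric]) (auto simp: I'_def intro!: arg_cong[where f=card])
  moreover have "inj_on (\<lambda>i. projl (f i)) I'"
    using f unfolding inj_on_def I'_def by (metis (mono_tags, lifting) mem_Collect_eq sum.collapse(1))
  moreover have "\<forall>i\<in>I'. projl (f i) \<in> A i" using f(2) by (fastforce simp: I'_def B_def)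
  moreover have "I' \<subseteq> I" by (auto simp: I'_def)
  ultimately show ?thesis by (intro exI[of _ I'] exI[of _ "\<lambda>i. projl (f i)"]) auto
qed

subsection \<open>Arcs and words\<close>

text \<open>The letter \<open>s\<close> tells whether a step follows its arc or runs against it, so
  one predicate covers all orientations, and \<open>\<not> s\<close> is the same step read
  backwards.\<close>

definition arc :: "('a \<Rightarrow> 'a \<Rightarrow> bool) \<Rightarrow> bool \<Rightarrow> 'a \<Rightarrow> 'a \<Rightarrow> bool" where
  "arc E s u v \<longleftrightarrow> (if s then E u v else E v u)"

lemma arc_not: "arc E (\<not> s) u v \<longleftrightarrow> arc E s v u"
  by (simp add: arc_def)

definition nbrs :: "('a \<Rightarrow> 'a \<Rightarrow> bool) \<Rightarrow> bool \<Rightarrow> 'a \<Rightarrow> 'a set \<Rightarrow> 'a set" where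
  "nbrs E s v U = {u \<in> U. arc E s v u}"

lemma finite_nbrs [simp]: "finite U \<Longrightarrow> finite (nbrs E s v U)"
  by (simp add: nbrs_def)

definition wpath :: "('a \<Rightarrow> 'a \<Rightarrow> bool) \<Rightarrow> bool list \<Rightarrow> 'a list \<Rightarrow> bool" where
  "wpath E ws xs \<longleftrightarrow> length xs = Suc (length ws) \<and>
     (\<forall>i<length ws. arc E (ws ! i) (xs ! i) (xs ! Suc i))"

lemma wpath_Nil [simp]: "wpath E [] [x]"
  by (simp add: wpath_def)

lemma wpath_Cons: "wpath E (s # ws) (x # y # xs) \<longleftrightarrow> arc E s x y \<and> wpath E ws (y # xs)"
  by (auto simp: wpath_def less_Suc_eq_0_disj)

lemma wpath_append:
  "length us = length ws \<Longrightarrow>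
   wpath E (ws @ ws') (us @ x # vs) \<longleftrightarrow> wpath E ws (us @ [x]) \<and> wpath E ws' (x # vs)"
proof (induction us arbitrary: ws)
  case Nil
  then show ?case by (simp add: wpath_def)
next
  case (Cons u us)
  then obtain s ws1 where ws: "ws = s # ws1" "length us = length ws1" by (cases ws) auto
  show ?case
    using Cons.IH[OF ws(2)] ws by (cases us) (auto simp: wpath_Cons)
qed

lemma wpath_mono: "wpath H ws xs \<Longrightarrow> (\<And>u v. H u v \<Longrightarrow> E u v) \<Longrightarrow> wpath E ws xs"
  by (auto simp: wpath_def arc_def split: if_splits)

subsection \<open>Expansion\<close>

text \<open>Ordered pairs are counted, so \<open>X\<close> and \<open>Y\<close> may overlap, and
  splitting or swapping them becomes rewriting of sums.\<close>

definition ec :: "('a \<Rightarrow> 'a \<Rightarrow> bool) \<Rightarrow> 'a set \<Rightarrow> 'a set \<Rightarrow> real" where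
  "ec E X Y = (\<Sum>x\<in>X. \<Sum>y\<in>Y. of_bool (E x y))"

lemma sum_of_bool_card: "finite Y \<Longrightarrow> (\<Sum>y\<in>Y. of_bool (Q y)) = real (card {y \<in> Y. Q y})"
  by (simp add: Collect_conj_eq)

lemma ec_lower:
  assumes "finite Y" "\<And>x. x \<in> X \<Longrightarrow> k \<le> real (card {y \<in> Y. E x y})"
  shows "real (card X) * k \<le> ec E X Y"
  unfolding ec_def using assms by (intro sum_bounded_below) (simp only: sum_of_bool_card)

lemma ec_upper:
  assumes "finite Y" "\<And>x. x \<in> X \<Longrightarrow> real (card {y \<in> Y. E x y}) \<le> k"
  shows "ec E X Y \<le> real (card X) * k"
  unfolding ec_def using assms by (intro sum_bounded_above) (simp only: sum_of_bool_card)

lemma ec_swap: "ec E X Y = ec (\<lambda>x y. E y x) Y X"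
  unfolding ec_def by (rule sum.swap)

lemma ec_lower':
  assumes "finite X" "\<And>y. y \<in> Y \<Longrightarrow> k \<le> real (card {x \<in> X. E x y})"
  shows "real (card Y) * k \<le> ec E X Y"
  using ec_lower[of X Y k "\<lambda>x y. E y x"] assms by (simp add: ec_swap[of E])

lemma ec_upper':
  assumes "finite X" "\<And>y. y \<in> Y \<Longrightarrow> real (card {x \<in> X. E x y}) \<le> k"
  shows "ec E X Y \<le> real (card Y) * k"
  using ec_upper[of X Y "\<lambda>x y. E y x" k] assms by (simp add: ec_swap[of E])

lemma ec_union:
  assumes "finite Y" "finite Z" "Y \<inter> Z = {}"
  shows "ec E X (Y \<union> Z) = ec E X Y + ec E X Z"
  unfolding ec_def using assms by (simp only: sum.union_disjoint sum.distrib)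

lemma ec_union':
  assumes "finite Y" "finite Z" "Y \<inter> Z = {}"
  shows "ec E (Y \<union> Z) X = ec E Y X + ec E Z X"
  unfolding ec_def using assms by (simp only: sum.union_disjoint)

lemma ec_pair_le:
  assumes "asymp E"
  shows "ec E X Y + ec E Y X \<le> real (card X) * real (card Y)"
proof -
  have "ec E Y X = (\<Sum>x\<in>X. \<Sum>y\<in>Y. of_bool (E y x))"
    unfolding ec_def by (rule sum.swap)
  then have "ec E X Y + ec E Y X = (\<Sum>x\<in>X. \<Sum>y\<in>Y. of_bool (E x y) + of_bool (E y x))"
    by (simp only: ec_def[of E X Y] sum.distrib)
  also have "\<dots> \<le> (\<Sum>x\<in>X. \<Sum>y\<in>Y. 1)"
  proof (intro sum_mono)
    fix x y
    show "of_bool (E x y) + of_bool (E y x) \<le> (1::real)"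
      using asympD[OF assms, of x y] by (cases "E x y"; cases "E y x") auto
  qed
  finally show ?thesis by simp
qed

lemma ec_le: "ec E X Y \<le> real (card X) * real (card Y)"
proof -
  have "ec E X Y \<le> (\<Sum>x\<in>X. \<Sum>y\<in>Y. 1)" unfolding ec_def by (intro sum_mono) auto
  then show ?thesis by simp
qed

lemma nu_bounds:
  fixes e nu :: real
  assumes "0 < e" "e \<le> 1/8" "nu = e^2/4"
  shows "nu \<le> e/32" "0 < nu"
proof -
  have "e * e \<le> e * (1/8)" using assms by (intro mult_left_mono) auto
  then show "nu \<le> e/32" using assms(3) by (simp add: power2_eq_square)
  show "0 < nu" unfolding assms(3) using assms(1) by simp
qed

text \<open>Here \<open>a\<close>, \<open>b\<close>, \<open>c\<close>, \<open>d\<close> are the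
  densities of \<open>S \<inter> P\<close>, \<open>S - P\<close>, the vertices outside both, and
  \<open>P - S\<close>. Up to errors of order \<open>nu\<close>, A and C say
  \<open>3/8 \<le> a/2 + d\<close> and \<open>3/8 \<le> c/2 + d\<close>, and B says
  \<open>b \<le> 1/4\<close>. Adding the first two and inserting \<open>d < b + nu\<close> and the
  total 1 gives \<open>b \<ge> 1/4\<close>; the surplus \<open>e\<close> makes this
  contradictory.\<close>

lemma expansion_arith:
  fixes a b c d e nu :: real
  assumes "0 \<le> a" "0 \<le> b" "0 \<le> c" "0 \<le> d" "a + b + c + d = 1" "0 < e" "e \<le> 1/8"
    and nu: "nu = e^2/4" and S: "3/8 + e \<le> a + b" "a + b \<le> 5/8" and d: "d < b + nu"
    and A: "(3/8 + e) * a \<le> a * a / 2 + a * d + nu"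
    and C: "(3/8 + e) * c \<le> c * c / 2 + c * d + nu * c"
    and B: "2 * (3/8 + e) * b \<le> (a + c + d) * b + nu + nu * b"
    and B': "b > 0 \<Longrightarrow> 3/8 + e \<le> c + d + nu"
  shows False
proof -
  have nu1: "nu \<le> e/32" "0 < nu" using nu_bounds[OF assms(6,7) nu] by auto
  have nu2: "nu = e * (e/4)" using nu by (simp add: power2_eq_square)
  show False
  proof (cases "b < e")
    \<comment> \<open>For tiny \<open>b\<close>, dividing B by \<open>b\<close> would blow up the
      error. But then \<open>d\<close> is tiny too, and A fails because
      \<open>a/2 \<le> 5/16\<close>.\<close>
    case True
    then have a: "3/8 \<le> a" using S by simp
    have "nu \<le> a * (3 * nu)" using mult_right_mono[OF a, of "3 * nu"] nu1 by simp
    then have "a * (3/8 + e) \<le> a * (a/2 + d + 3 * nu)" using A by (simp add: algebra_simps)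
    then have "3/8 + e \<le> a/2 + d + 3 * nu" using a by (simp add: mult_le_cancel_left)
    then show False using True d nu1 S assms by simp
  next
    case False
    then have b: "e \<le> b" "b > 0" using assms by auto
    have "e * (e/4) \<le> b * (e/4)" using b assms by (intro mult_right_mono) auto
    then have "nu \<le> b * (e/4)" using nu2 by simp
    then have "b * (2 * (3/8 + e)) \<le> b * (a + c + d + e/4 + nu)" using B by (simp add: algebra_simps)
    then have "2 * (3/8 + e) \<le> a + c + d + e/4 + nu" using b by (simp add: mult_le_cancel_left)
    then have b2: "b \<le> 1/4 - e" using assms(5) nu1 assms by simp
    have a: "1/8 \<le> a" using b2 S assms by simp
    have "nu \<le> a * (8 * nu)" using mult_right_mono[OF a, of "8 * nu"] nu1 by simp
    then have "a * (3/8 + e) \<le> a * (a/2 + d + 8 * nu)" using A by (simp add: algebra_simps)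
    then have A2: "3/8 + e \<le> a/2 + d + 8 * nu" using a by (simp add: mult_le_cancel_left)
    have c: "c > 0" using B'[OF b(2)] d b2 nu1 assms by simp
    have "c * (3/8 + e) \<le> c * (c/2 + d + nu)" using C by (simp add: algebra_simps)
    then have "3/8 + e \<le> c/2 + d + nu" using c by (simp add: mult_le_cancel_left)
    then show False using A2 assms nu1 b2 by simp
  qed
qed

text \<open>A robust form: only vertices with linearly many in-neighbours in \<open>S\<close> count
  towards \<open>P\<close>. Hence few arcs run from \<open>S\<close> to the complement of
  \<open>P\<close>, and if \<open>P\<close> were too small, the degree sums over the four cells cut
  out by \<open>S\<close> and \<open>P\<close> would contradict
  \<open>expansion_arith\<close>.\<close>

lemma expansion:
  fixes e nu :: real and E :: "'a \<Rightarrow> 'a \<Rightarrow> bool"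
  assumes as: "asymp E" and fin: "finite U" and SU: "S \<subseteq> U" and e: "0 < e" "e \<le> 1/8"
    and nu: "nu = e^2/4"
    and out: "\<And>u. u \<in> U \<Longrightarrow> (3/8 + e) * card U \<le> card {v \<in> U. E u v}"
    and inn: "\<And>u. u \<in> U \<Longrightarrow> (3/8 + e) * card U \<le> card {v \<in> U. E v u}"
    and S: "(3/8 + e) * card U \<le> card S"
    and P: "P = {u \<in> U. nu * card U \<le> card {v \<in> S. E v u}}"
  shows "P = U \<or> card S + nu * card U \<le> card P"
proof (rule ccontr)
  assume neg: "\<not> ?thesis"
  define N where "N = real (card U)"
  have "U \<noteq> {}" using neg P by auto
  then have N: "N > 0" using fin by (simp add: N_def card_gt_0_iff)
  have finS: "finite S" and finP: "finite P" and PU: "P \<subseteq> U"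
    using fin SU P by (auto intro: finite_subset)
  have nu1: "nu \<le> e/32" "0 < nu" using nu_bounds[OF e nu] by auto
  \<comment> \<open>Above 5/8 the set \<open>S\<close> meets every in-neighbourhood in at least
    \<open>e * N\<close> vertices, so \<open>P\<close> would be all of \<open>U\<close>.\<close>
  have S58: "card S \<le> 5/8 * N"
  proof (rule ccontr)
    assume big: "\<not> card S \<le> 5/8 * N"
    have "u \<in> P" if u: "u \<in> U" for u
    proof -
      have "card {v \<in> U. E v u} + card S = card ({v \<in> U. E v u} \<union> S) + card ({v \<in> U. E v u} \<inter> S)"
        using fin finS by (subst card_Un_Int) auto
      moreover have "card ({v \<in> U. E v u} \<union> S) \<le> card U" using SU fin by (intro card_mono) auto
      moreover have "{v \<in> U. E v u} \<inter> S = {v \<in> S. E v u}" using SU by auto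
      ultimately have "real (card {v \<in> U. E v u}) + card S \<le> N + card {v \<in> S. E v u}"
        unfolding N_def by simp
      then have "e * N \<le> card {v \<in> S. E v u}" using inn[OF u] big unfolding N_def
        by (simp add: algebra_simps)
      moreover have "nu * N \<le> e * N" using nu1 N by (intro mult_right_mono) auto
      ultimately show ?thesis using u P by (simp add: N_def)
    qed
    then show False using neg PU by blast
  qed
  define A where "A = S \<inter> P"
  define B where "B = S - P"
  define C where "C = U - (S \<union> P)"
  define D where "D = P - S"
  have fins: "finite A" "finite B" "finite C" "finite D"
    using fin finS finP by (auto simp: A_def B_def C_def D_def)
  have disj: "A \<inter> B = {}" "A \<inter> C = {}" "A \<inter> D = {}" "B \<inter> C = {}" "B \<inter> D = {}" "C \<inter> D = {}"
    by (auto simp: A_def B_def C_def D_def)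
  have SAB: "S = A \<union> B" and PAD: "P = A \<union> D" and UABCD: "U = (A \<union> B) \<union> (C \<union> D)"
    using SU PU by (auto simp: A_def B_def C_def D_def)
  define a where "a = real (card A)" define b where "b = real (card B)"
  define c where "c = real (card C)" define d where "d = real (card D)"
  have cS: "real (card S) = a + b" unfolding SAB a_def b_def using fins disj by (simp add: card_Un_disjoint)
  have cP: "real (card P) = a + d" unfolding PAD a_def d_def using fins disj by (simp add: card_Un_disjoint)
  have cU: "N = a + b + c + d" unfolding N_def a_def b_def c_def d_def
    by (subst UABCD, subst card_Un_disjoint) (use fins disj in \<open>auto simp: card_Un_disjoint\<close>)
  have ecU: "ec E X U = ec E X A + ec E X B + ec E X C + ec E X D" for X
    by (subst UABCD, subst ec_union) (use fins disj in \<open>auto simp: ec_union\<close>)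
  have ecU': "ec E U X = ec E A X + ec E B X + ec E C X + ec E D X" for X
    by (subst UABCD, subst ec_union') (use fins disj in \<open>auto simp: ec_union'\<close>)
  have lo: "real (card X) * ((3/8 + e) * N) \<le> ec E X U" if "X \<subseteq> U" for X
    unfolding N_def using fin out that by (intro ec_lower) auto
  have lo': "real (card X) * ((3/8 + e) * N) \<le> ec E U X" if "X \<subseteq> U" for X
    unfolding N_def using fin inn that by (intro ec_lower') auto
  have toT: "ec E A X + ec E B X \<le> real (card X) * (nu * N)" if "X \<subseteq> U - P" for X
  proof -
    have "ec E S X \<le> real (card X) * (nu * N)"
      using that finS by (intro ec_upper') (auto simp: P N_def)
    then show ?thesis unfolding SAB using fins disj by (simp add: ec_union')
  qed
  have nonneg: "0 \<le> ec E X Y" for X Y unfolding ec_def by (intro sum_nonneg) auto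
  have BC: "B \<subseteq> U - P" "C \<subseteq> U - P" "A \<subseteq> U" "B \<subseteq> U" "C \<subseteq> U" using SU PU by (auto simp: A_def B_def C_def)
  have bc: "b + c \<le> N" using cU by (simp add: a_def d_def)
  have tT: "ec E A B + ec E A C + ec E B B + ec E B C \<le> nu * N * N"
  proof -
    have "ec E A B + ec E B B + (ec E A C + ec E B C) \<le> b * (nu * N) + c * (nu * N)"
      using toT[OF BC(1)] toT[OF BC(2)] by (simp add: b_def c_def)
    also have "\<dots> = (b + c) * (nu * N)" by (simp add: algebra_simps)
    also have "\<dots> \<le> N * (nu * N)" using bc N nu1 by (intro mult_right_mono) auto
    finally show ?thesis by (simp add: algebra_simps)
  qed
  have half: "ec E X X \<le> real (card X) * real (card X) / 2" for X
    using ec_pair_le[OF as, of X X] by simp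
  have iA: "a * ((3/8 + e) * N) \<le> a * a / 2 + a * d + nu * N * N"
    using lo[OF BC(3)] ecU[of A] half[of A] ec_le[of E A D] tT nonneg[of B B] nonneg[of B C]
    by (simp add: a_def d_def)
  have iC: "c * ((3/8 + e) * N) \<le> c * c / 2 + c * d + c * (nu * N)"
    using lo'[OF BC(5)] ecU'[of C] half[of C] ec_le[of E D C] toT[OF BC(2)]
    by (simp add: c_def d_def mult.commute)
  \<comment> \<open>Each pair between \<open>B\<close> and \<open>D\<close> carries at most one arc,
    which serves both degree sums. Arcs from \<open>B\<close> to \<open>A\<close> and from
    \<open>C\<close> to \<open>B\<close> are bounded trivially; all other arcs at \<open>B\<close>
    start in \<open>S\<close> and end outside \<open>P\<close>, hence are few.\<close>
  have iB: "2 * (b * ((3/8 + e) * N)) \<le> (a + c + d) * b + nu * N * N + b * (nu * N)"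
    using lo[OF BC(4)] lo'[OF BC(4)] ecU[of B] ecU'[of B] ec_pair_le[OF as, of B D] ec_le[of E B A]
      ec_le[of E C B] toT[OF BC(1)] tT nonneg[of A B] nonneg[of A C]
    by (simp add: a_def b_def c_def d_def algebra_simps)
  have iB': "(3/8 + e) * N \<le> c + d + nu * N" if "b > 0"
  proof -
    have "B \<noteq> {}" using that by (auto simp: b_def)
    then obtain u where u: "u \<in> B" by blast
    then have uU: "u \<in> U" "u \<notin> P" using BC by auto
    have "{v \<in> U. E v u} \<subseteq> {v \<in> S. E v u} \<union> (C \<union> D)" using SU by (auto simp: C_def D_def)
    then have "card {v \<in> U. E v u} \<le> card ({v \<in> S. E v u} \<union> (C \<union> D))"
      using finS fins by (intro card_mono) auto
    also have "\<dots> \<le> card {v \<in> S. E v u} + card (C \<union> D)" by (rule card_Un_le)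
    also have "card (C \<union> D) \<le> card C + card D" by (rule card_Un_le)
    finally have "real (card {v \<in> U. E v u}) \<le> card {v \<in> S. E v u} + c + d" by (simp add: c_def d_def)
    moreover have "card {v \<in> S. E v u} < nu * N" using uU P by (auto simp: N_def)
    ultimately show ?thesis using inn[OF uU(1)] by (simp add: N_def)
  qed
  have dlt: "d < b + nu * N" using neg cS cP by (simp add: N_def)
  have NN: "N * N > 0" using N by simp
  show False
  proof (rule expansion_arith[of "a/N" "b/N" "c/N" "d/N" e nu])
    show "a/N + b/N + c/N + d/N = 1" using cU N by (simp add: add_divide_distrib[symmetric])
    show "3/8 + e \<le> a/N + b/N" using S cS N by (simp add: add_divide_distrib[symmetric] le_divide_eq N_def)
    show "a/N + b/N \<le> 5/8" using S58 cS N by (simp add: add_divide_distrib[symmetric] divide_le_eq)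
    show "d/N < b/N + nu" using dlt N by (simp add: divide_simps algebra_simps)
    show "(3/8 + e) * (a/N) \<le> (a/N) * (a/N) / 2 + (a/N) * (d/N) + nu"
      using divide_right_mono[OF iA, of "N * N"] N by (simp add: add_divide_distrib mult.commute)
    show "(3/8 + e) * (c/N) \<le> (c/N) * (c/N) / 2 + (c/N) * (d/N) + nu * (c/N)"
      using divide_right_mono[OF iC, of "N * N"] N by (simp add: add_divide_distrib mult.commute)
    show "2 * (3/8 + e) * (b/N) \<le> (a/N + c/N + d/N) * (b/N) + nu + nu * (b/N)"
      using divide_right_mono[OF iB, of "N * N"] N by (simp add: add_divide_distrib ring_distribs mult.commute)
    show "3/8 + e \<le> c/N + d/N + nu" if "b/N > 0"
      using divide_right_mono[OF iB', of N] that N by (simp add: add_divide_distrib zero_less_divide_iff)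
  qed (use e nu N in \<open>auto simp: a_def b_def c_def d_def\<close>)
qed

subsection \<open>Connecting\<close>

text \<open>Degrees are measured into \<open>U\<close> but demanded of all of \<open>V\<close>,
  because paths running through \<open>U\<close> may have their ends outside it.\<close>

definition rich :: "('a \<Rightarrow> 'a \<Rightarrow> bool) \<Rightarrow> real \<Rightarrow> 'a set \<Rightarrow> 'a set \<Rightarrow> bool" where
  "rich E e V U \<longleftrightarrow> (\<forall>v\<in>V. \<forall>s. (3/8 + e) * card U \<le> card (nbrs E s v U))"

lemma rich_Diff:
  fixes e :: real
  assumes r: "rich E e V U" and fin: "finite U" and e: "0 \<le> e" and Z: "card (Z \<inter> U) \<le> e/2 * card U"
  shows "rich E (e/2) V (U - Z)"
  unfolding rich_def
proof (intro ballI allI)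
  fix v s assume v: "v \<in> V"
  have "nbrs E s v U \<subseteq> nbrs E s v (U - Z) \<union> (Z \<inter> U)" by (auto simp: nbrs_def)
  then have "card (nbrs E s v U) \<le> card (nbrs E s v (U - Z) \<union> (Z \<inter> U))"
    using fin by (intro card_mono) auto
  also have "\<dots> \<le> card (nbrs E s v (U - Z)) + card (Z \<inter> U)" by (rule card_Un_le)
  finally have "real (card (nbrs E s v U)) \<le> card (nbrs E s v (U - Z)) + card (Z \<inter> U)" by simp
  moreover have "(3/8 + e) * card U \<le> card (nbrs E s v U)" using r v unfolding rich_def by blast
  ultimately have "(3/8 + e) * card U - e/2 * card U \<le> card (nbrs E s v (U - Z))" using Z by linarith
  then have "(3/8 + e/2) * card U \<le> card (nbrs E s v (U - Z))"
    by (simp only: left_diff_distrib[symmetric]) (simp add: add.commute)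
  moreover have "(3/8 + e/2) * card (U - Z) \<le> (3/8 + e/2) * card U"
    using e fin by (intro mult_left_mono) (auto intro: card_mono)
  ultimately show "(3/8 + e/2) * card (U - Z) \<le> card (nbrs E s v (U - Z))" by linarith
qed

lemma asymp_arc: "asymp E \<Longrightarrow> asymp (arc E s)"
  by (auto simp: asymp_on_def arc_def)

lemma expansion_arc:
  fixes e nu :: real
  assumes "asymp E" "finite U" "S \<subseteq> U" "0 < e" "e \<le> 1/8" "nu = e^2/4" "rich E e U U"
    and "(3/8 + e) * card U \<le> card S"
    and P: "P = {u \<in> U. nu * card U \<le> card (nbrs E (\<not> s) u S)}"
  shows "P = U \<or> card S + nu * card U \<le> card P"
proof (rule expansion[where E = "arc E s" and U = U and S = S and P = P and e = e])
  show "P = {u \<in> U. nu * card U \<le> card {v \<in> S. arc E s v u}}"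
    unfolding P nbrs_def by (simp add: arc_not)
  show "(3/8 + e) * card U \<le> card {v \<in> U. arc E s v u}" if "u \<in> U" for u
  proof -
    have "(3/8 + e) * card U \<le> card (nbrs E (\<not> s) u U)" using assms(7) that unfolding rich_def by blast
    then show ?thesis unfolding nbrs_def by (simp add: arc_not)
  qed
  show "(3/8 + e) * card U \<le> card {v \<in> U. arc E s u v}" if "u \<in> U" for u
    using assms(7) that unfolding rich_def nbrs_def by blast
qed (use assms asymp_arc in auto)

text \<open>By expansion the set of possible ends grows by \<open>nu * card U\<close> with each
  letter until it is all of \<open>U\<close>. The set \<open>S\<close> is fixed before
  \<open>Z\<close>, because paths are built backwards: a vertex of the next set has so many
  predecessors in \<open>S\<close> that one of them avoids \<open>Z\<close>, and the induction
  hypothesis is then used with the vertex itself added to \<open>Z\<close>.\<close>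

lemma reach:
  fixes e nu :: real
  assumes "asymp E" and fin: "finite U" and UV: "U \<subseteq> V" and r: "rich E e V U" and e: "0 < e" "e \<le> 1/8"
    and nu: "nu = e^2/4" and x: "x \<in> V" and ws: "ws \<noteq> []"
  shows "\<exists>S\<subseteq>U. (S = U \<or> (3/8 + e + nu * (real (length ws) - 1)) * card U \<le> card S) \<and>
     (\<forall>u\<in>S. \<forall>Z. finite Z \<longrightarrow> card Z + length ws \<le> nu * card U \<longrightarrow>
       (\<exists>us. length us = length ws - 1 \<and> distinct us \<and> set us \<subseteq> U - Z - {u} \<and> wpath E ws (x # us @ [u])))"
  using ws
proof (induction ws rule: rev_nonempty_induct)
  case (single s)
  have "wpath E [s] [x, u]" if "u \<in> nbrs E s x U" for u
    using that by (simp add: nbrs_def wpath_Cons)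
  then have "\<exists>us. length us = length [s] - 1 \<and> distinct us \<and> set us \<subseteq> U - Z - {u} \<and> wpath E [s] (x # us @ [u])"
    if "u \<in> nbrs E s x U" for u Z
    using that by (intro exI[of _ "[]"]) simp
  moreover have "(3/8 + e) * card U \<le> card (nbrs E s x U)" using r x unfolding rich_def by blast
  moreover have "nbrs E s x U \<subseteq> U" by (auto simp: nbrs_def)
  ultimately show ?case by (intro exI[of _ "nbrs E s x U"]) simp
next
  case (snoc s xs)
  from snoc.IH obtain S where S: "S \<subseteq> U"
    "S = U \<or> (3/8 + e + nu * (real (length xs) - 1)) * card U \<le> card S"
    and paths: "\<forall>u\<in>S. \<forall>Z. finite Z \<longrightarrow> card Z + length xs \<le> nu * card U \<longrightarrow>
       (\<exists>us. length us = length xs - 1 \<and> distinct us \<and> set us \<subseteq> U - Z - {u} \<and> wpath E xs (x # us @ [u]))"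
    by (elim exE conjE) (rule that)
  have finS: "finite S" using S fin by (auto intro: finite_subset)
  have nu0: "0 < nu" using nu_bounds[OF e nu] by simp
  define P where "P = {u \<in> U. nu * card U \<le> card (nbrs E (\<not> s) u S)}"
  have big: "(3/8 + e) * card U \<le> card S"
  proof (cases "S = U")
    case True then show ?thesis using e by (simp add: mult_left_le_one_le)
  next
    case False
    have "real (length xs) \<ge> 1" using snoc.hyps by (cases xs) auto
    then have "(3/8 + e) * card U \<le> (3/8 + e + nu * (real (length xs) - 1)) * card U"
      using nu0 by (intro mult_right_mono) auto
    then show ?thesis using S(2) False by auto
  qed
  have "P = U \<or> card S + nu * card U \<le> card P"
    using expansion_arc[OF assms(1) fin S(1) e nu _ big P_def] r UV unfolding rich_def by blast
  then have sz: "P = U \<or> (3/8 + e + nu * (real (length (xs @ [s])) - 1)) * card U \<le> card P"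
  proof
    assume a: "card S + nu * card U \<le> card P"
    show ?thesis
    \<comment> \<open>A set that is already \<open>U\<close> can grow further only if
      \<open>U\<close> is empty.\<close>
    proof (cases "S = U")
      case True
      have "card P \<le> card U" unfolding P_def using fin by (intro card_mono) auto
      then have "nu * card U \<le> 0" using a True by simp
      then have "card U = 0" using nu0 by (simp add: mult_le_0_iff)
      then show ?thesis using fin by (auto simp: P_def)
    next
      case False then show ?thesis using S(2) a by (simp add: algebra_simps)
    qed
  qed simp
  have "\<exists>us. length us = length (xs @ [s]) - 1 \<and> distinct us \<and> set us \<subseteq> U - Z - {u} \<and> wpath E (xs @ [s]) (x # us @ [u])"
    if u: "u \<in> P" and Z: "finite Z" "card Z + length (xs @ [s]) \<le> nu * card U" for u Z
  proof -
    have cZ: "card (insert u Z) \<le> Suc (card Z)" by (rule card_insert_le_m1) auto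
    have "real (card (insert u Z)) < card (nbrs E (\<not> s) u S)"
      using cZ Z(2) u snoc.hyps unfolding P_def by (cases xs) auto
    then have "\<not> nbrs E (\<not> s) u S \<subseteq> insert u Z" using Z(1) card_mono[of "insert u Z" "nbrs E (\<not> s) u S"] by auto
    then obtain u' where u': "u' \<in> nbrs E (\<not> s) u S" "u' \<notin> insert u Z" by blast
    have "card (insert u Z) + length xs \<le> nu * card U" using cZ Z(2) by simp
    then obtain us where us: "length us = length xs - 1" "distinct us" "set us \<subseteq> U - insert u Z - {u'}"
      "wpath E xs (x # us @ [u'])" using paths[rule_format, of u' "insert u Z"] u' Z(1) by (auto simp: nbrs_def)
    have "length (x # us) = length xs" using us(1) snoc.hyps by (cases xs) auto
    then have "wpath E (xs @ [s]) ((x # us) @ u' # [u])"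
      using us(4) u'(1) by (subst wpath_append) (auto simp: wpath_Cons nbrs_def arc_not)
    moreover have "length (us @ [u']) = length (xs @ [s]) - 1" using us(1) snoc.hyps by (cases xs) auto
    ultimately show ?thesis using us u' S(1) by (intro exI[of _ "us @ [u']"]) (auto simp: nbrs_def)
  qed
  then show ?case using sz by (intro exI[of _ P]) (auto simp: P_def)
qed

text \<open>Deleting \<open>Z\<close> leaves richness \<open>e/2\<close>, hence growth by a share
  \<open>e^2/16\<close> per letter: \<open>16 / e^2\<close> letters after the first reach every
  vertex, and the last letter leads to \<open>y\<close>. Only the interior is claimed to avoid
  \<open>Z\<close>; whoever needs \<open>x\<close> and \<open>y\<close> off the interior puts them
  into \<open>Z\<close> or takes them outside \<open>U\<close>.\<close>

lemma connect:
  fixes e :: real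
  assumes as: "asymp E" and fin: "finite U" and UV: "U \<subseteq> V" and r: "rich E e V U" and e: "0 < e" "e \<le> 1/8"
    and x: "x \<in> V" and y: "y \<in> V" and K: "16 / e^2 + 2 \<le> length ws"
    and Z: "card (Z \<inter> U) \<le> e/2 * card U" and n: "length ws \<le> e^2/32 * card U"
  shows "\<exists>us. length us = length ws - 1 \<and> distinct us \<and> set us \<subseteq> U - Z \<and> wpath E ws (x # us @ [y])"
proof -
  define U' where "U' = U - Z"
  define nu where "nu = (e/2)^2/4"
  have nu: "nu = e^2/16" by (simp add: nu_def power2_eq_square)
  have e2: "0 < e/2" "e/2 \<le> 1/8" using e by auto
  have nu0: "nu > 0" "nu \<le> 1/8" using nu_bounds[OF e2 nu_def] e by auto
  have fin': "finite U'" using fin by (simp add: U'_def)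
  have cU: "card U = card U' + card (Z \<inter> U)"
    unfolding U'_def using fin by (subst card_Un_disjoint[symmetric]) (auto intro!: arg_cong[where f=card])
  have cU': "card U / 2 \<le> card U'"
  proof -
    have "e/2 * card U \<le> 1/2 * card U" using e by (intro mult_right_mono) auto
    then show ?thesis using cU Z by simp
  qed
  have r': "rich E (e/2) V U'"
    unfolding U'_def using rich_Diff[OF r fin _ Z] e by simp
  have "16 / e^2 > 0" using e by simp
  then have "real (length ws) > 0" using K by linarith
  then have "ws \<noteq> []" by auto
  then obtain ws' s where ws: "ws = ws' @ [s]" by (metis rev_exhaust)
  have "real (length ws) = real (length ws') + 1" using ws by simp
  then have "real (length ws') > 0" using \<open>16 / e^2 > 0\<close> K by linarith
  then have wsne: "ws' \<noteq> []" by auto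
  have "length ws > 0" using ws by simp
  then have "0 < e^2/32 * card U" using n by linarith
  then have "real (card U) > 0" using e by (simp add: zero_less_mult_iff)
  then have U'pos: "real (card U') > 0" using cU' by simp
  have "U' \<subseteq> V" using UV by (auto simp: U'_def)
  from reach[OF as fin' this r' e2 nu_def x wsne] obtain S where S: "S \<subseteq> U'"
    "S = U' \<or> (3/8 + e/2 + nu * (real (length ws') - 1)) * card U' \<le> card S"
    and paths: "\<forall>u\<in>S. \<forall>Z. finite Z \<longrightarrow> card Z + length ws' \<le> nu * card U' \<longrightarrow>
       (\<exists>us. length us = length ws' - 1 \<and> distinct us \<and> set us \<subseteq> U' - Z - {u} \<and> wpath E ws' (x # us @ [u]))"
    by (elim exE conjE) (rule that)
  have "16 / e^2 \<le> real (length ws') - 1" using K ws by simp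
  then have "nu * (16 / e^2) \<le> nu * (real (length ws') - 1)" using nu0 by (intro mult_left_mono) auto
  moreover have "nu * (16 / e^2) = 1" using e nu by simp
  ultimately have "1 \<le> nu * (real (length ws') - 1)" by (simp only:)
  then have g1: "1 < 3/8 + e/2 + nu * (real (length ws') - 1)" using e by linarith
  have SU: "S = U'"
  proof (rule ccontr)
    assume "S \<noteq> U'"
    then have "(3/8 + e/2 + nu * (real (length ws') - 1)) * card U' \<le> card S" using S by simp
    moreover have "card S \<le> card U'" using S fin' by (intro card_mono) auto
    moreover have "1 * real (card U') < (3/8 + e/2 + nu * (real (length ws') - 1)) * card U'"
      using g1 U'pos by (intro mult_strict_right_mono) auto
    ultimately show False by simp
  qed
  have "(3/8 + e/2) * card U' \<le> card (nbrs E (\<not> s) y U')" using r' y unfolding rich_def by blast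
  moreover have "(3/8 + e/2) * card U' > 0" using U'pos e by simp
  ultimately have "nbrs E (\<not> s) y U' \<noteq> {}" by auto
  then obtain u where u: "u \<in> nbrs E (\<not> s) y U'" by blast
  have "e^2/32 * card U \<le> nu * card U'"
  proof -
    have "e^2/32 * card U = nu * (card U / 2)" unfolding nu by simp
    then show ?thesis using mult_left_mono[OF cU' less_imp_le[OF nu0(1)]] by (simp only:)
  qed
  then obtain us where us: "length us = length ws' - 1" "distinct us" "set us \<subseteq> U' - {} - {u}"
    "wpath E ws' (x # us @ [u])" using paths[rule_format, of u "{}"] u n ws SU by (auto simp: nbrs_def)
  have "length (x # us) = length ws'" using us(1) wsne by (cases ws') auto
  then have "wpath E (ws' @ [s]) ((x # us) @ u # [y])"
    using us(4) u by (subst wpath_append) (auto simp: wpath_Cons nbrs_def arc_not)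
  moreover have "length (us @ [u]) = length ws - 1" using us(1) wsne ws by (cases ws') auto
  ultimately show ?thesis using us u ws by (intro exI[of _ "us @ [u]"]) (auto simp: nbrs_def U'_def)
qed

subsection \<open>Regular spanning subgraphs\<close>

text \<open>Hall's condition for out-neighbourhoods: a set smaller than a single out-neighbourhood
  is harmless, and a larger one is large enough to expand. An injection of \<open>V\<close> into
  itself is a permutation, so all in-degrees and out-degrees of the chosen arcs are one.\<close>

lemma one_factor:
  fixes e :: real
  assumes as: "asymp E" and fin: "finite V" and r: "rich E e V V" and e: "0 < e" "e \<le> 1/8"
  shows "\<exists>f. bij_betw f V V \<and> (\<forall>v\<in>V. E v (f v))"
proof -
  define A where "A = (\<lambda>v. nbrs E True v V)"
  have "card J \<le> card (\<Union>v\<in>J. A v)" if J: "J \<subseteq> V" for J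
  proof (cases "J = {}")
    case False
    then obtain j where j: "j \<in> J" by blast
    have finA: "finite (\<Union>v\<in>J. A v)" using finite_subset[OF J fin] fin by (auto simp: A_def)
    have Vpos: "0 < card V" using False J fin by (auto simp: card_gt_0_iff)
    show ?thesis
    proof (cases "(3/8 + e) * card V \<le> card J")
      case True
      define P where "P = {u \<in> V. e^2/4 * card V \<le> card (nbrs E (\<not> True) u J)}"
      have "P \<subseteq> (\<Union>v\<in>J. A v)"
      proof
        fix u assume u: "u \<in> P"
        have "0 < e^2/4 * card V" using e Vpos by simp
        then have "0 < card (nbrs E (\<not> True) u J)" using u unfolding P_def by (simp del: of_nat_0_less_iff add: of_nat_0_less_iff[where 'a = real, symmetric])
        then obtain v where "v \<in> nbrs E (\<not> True) u J" by fastforce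
        then show "u \<in> (\<Union>v\<in>J. A v)" using u by (auto simp: P_def A_def nbrs_def arc_def)
      qed
      then have "card P \<le> card (\<Union>v\<in>J. A v)" using finA by (intro card_mono)
      moreover have "P = V \<or> card J + e^2/4 * card V \<le> card P"
        using expansion_arc[OF as fin J e refl _ True P_def] r by blast
      moreover have "card J \<le> card V" using J fin by (intro card_mono)
      moreover have "real (card J) \<le> real (card J) + e^2/4 * card V" by simp
      ultimately have "card J \<le> card P" by (metis of_nat_le_iff order_trans)
      then show ?thesis using \<open>card P \<le> _\<close> by simp
    next
      case False
      have "(3/8 + e) * card V \<le> card (A j)" using r j J unfolding rich_def A_def by blast
      moreover have "card (A j) \<le> card (\<Union>v\<in>J. A v)" using j finA by (intro card_mono) auto
      ultimately show ?thesis using False by linarith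
    qed
  qed simp
  then obtain f where f: "inj_on f V" "\<forall>v\<in>V. f v \<in> A v"
    using hall[OF fin, of A] fin by (auto simp: A_def)
  have "f ` V \<subseteq> V" using f by (auto simp: A_def nbrs_def)
  then have "f ` V = V" using f fin by (metis card_image card_subset_eq)
  then show ?thesis using f by (intro exI[of _ f]) (auto simp: bij_betw_def A_def nbrs_def arc_def)
qed

text \<open>Taking out arc-disjoint one-factors costs each degree at most
  \<open>e/2 * card V\<close>, so the remaining arcs stay rich with \<open>e/2\<close> and supply
  the next factor.\<close>

lemma regular_subgraph:
  fixes e :: real
  assumes as: "asymp E" and fin: "finite V" and r: "rich E e V V" and e: "0 < e" "e \<le> 1/8"
    and d: "d \<le> e/2 * card V"
  shows "\<exists>H. (\<forall>u v. H u v \<longrightarrow> E u v) \<and> (\<forall>v\<in>V. \<forall>s. card (nbrs H s v V) = d)"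
  using d
proof (induction d)
  case 0
  then show ?case by (intro exI[of _ "\<lambda>_ _. False"]) (auto simp: nbrs_def arc_def)
next
  case (Suc d)
  then have "real d \<le> e/2 * card V" by simp
  then obtain H where H: "\<And>u v. H u v \<Longrightarrow> E u v" "\<And>v s. v \<in> V \<Longrightarrow> card (nbrs H s v V) = d"
    using Suc.IH by blast
  define F where "F = (\<lambda>u v. E u v \<and> \<not> H u v)"
  have "asymp F" using as by (auto simp: asymp_on_def F_def)
  moreover have "rich F (e/2) V V"
    unfolding rich_def
  proof (intro ballI allI)
    fix v s assume v: "v \<in> V"
    have "nbrs E s v V \<subseteq> nbrs F s v V \<union> nbrs H s v V" by (auto simp: nbrs_def F_def arc_def)
    then have "card (nbrs E s v V) \<le> card (nbrs F s v V \<union> nbrs H s v V)" using fin by (intro card_mono) auto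
    also have "\<dots> \<le> card (nbrs F s v V) + card (nbrs H s v V)" by (rule card_Un_le)
    finally have "real (card (nbrs E s v V)) \<le> card (nbrs F s v V) + d" using H(2)[OF v] by simp
    moreover have "(3/8 + e) * card V \<le> card (nbrs E s v V)" using r v unfolding rich_def by blast
    ultimately show "(3/8 + e/2) * card V \<le> card (nbrs F s v V)" using Suc.prems by (simp add: algebra_simps)
  qed
  ultimately obtain f where f: "bij_betw f V V" "\<forall>v\<in>V. F v (f v)"
    using one_factor[of F V "e/2"] fin e by auto
  define H' where "H' = (\<lambda>u v. H u v \<or> (u \<in> V \<and> v = f u))"
  have "card (nbrs H' s v V) = Suc d" if v: "v \<in> V" for v s
  proof (cases s)
    case True
    have "nbrs H' s v V = insert (f v) (nbrs H s v V)"
      using True v f by (auto simp: nbrs_def H'_def arc_def bij_betw_def)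
    moreover have "f v \<notin> nbrs H s v V" using f v True by (auto simp: nbrs_def arc_def F_def)
    ultimately show ?thesis using fin H(2)[OF v] by simp
  next
    case False
    obtain u where u: "u \<in> V" "f u = v" using f v by (metis bij_betw_imp_surj_on imageE)
    have "nbrs H' s v V = insert u (nbrs H s v V)"
      using False u f by (auto simp: nbrs_def H'_def arc_def bij_betw_def inj_on_def)
    moreover have "u \<notin> nbrs H s v V" using f u False by (auto simp: nbrs_def arc_def F_def)
    ultimately show ?thesis using fin H(2)[OF v] by simp
  qed
  moreover have "H' u v \<Longrightarrow> E u v" for u v using H f by (auto simp: H'_def F_def)
  ultimately show ?case by (intro exI[of _ H']) auto
qed

subsection \<open>Discrepancy\<close>

lemma exp_le_quadratic:
  fixes x :: real
  assumes "\<bar>x\<bar> \<le> 1"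
  shows "exp x \<le> 1 + x + x^2"
proof (cases "0 \<le> x")
  case True
  then show ?thesis using exp_bound assms by auto
next
  case False
  define y where "y = - x"
  have y: "0 < y" using False by (simp add: y_def)
  \<comment> \<open>The product equals \<open>1 + y^3\<close>.\<close>
  have "1 \<le> (1 + y) * (1 - y + y^2)"
    using y by (simp add: algebra_simps power2_eq_square)
  also have "\<dots> \<le> exp y * (1 - y + y^2)"
  proof (rule mult_right_mono)
    show "1 + y \<le> exp y" by (rule exp_ge_add_one_self)
    show "0 \<le> 1 - y + y^2" using assms False by (simp add: y_def)
  qed
  finally have "exp (-y) * 1 \<le> exp (-y) * (exp y * (1 - y + y^2))" by (intro mult_left_mono) auto
  also have "\<dots> = 1 - y + y^2" by (simp add: exp_minus)
  finally show ?thesis by (simp add: y_def)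
qed

text \<open>Moment generating function of a centred Bernoulli variable: the linear terms cancel and
  the variance is at most 1.\<close>

lemma bernoulli_mgf:
  fixes p a :: real
  assumes "0 \<le> p" "p \<le> 1" "\<bar>a\<bar> \<le> 1"
  shows "p * exp (a * (1 - p)) + (1 - p) * exp (a * (0 - p)) \<le> 1 + a^2"
proof -
  have "\<bar>a * (1 - p)\<bar> \<le> 1" "\<bar>a * (0 - p)\<bar> \<le> 1"
    using assms mult_mono[of "\<bar>a\<bar>" 1 "1 - p" 1] mult_mono[of "\<bar>a\<bar>" 1 p 1] by (auto simp: abs_mult)
  then have "p * exp (a * (1 - p)) + (1 - p) * exp (a * (0 - p))
      \<le> p * (1 + a * (1 - p) + (a * (1 - p))^2) + (1 - p) * (1 + a * (0 - p) + (a * (0 - p))^2)"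
    using assms by (intro add_mono mult_left_mono exp_le_quadratic) auto
  also have "\<dots> = 1 + a^2 * (p * (1 - p))" by (simp add: power2_eq_square algebra_simps)
  also have "\<dots> \<le> 1 + a^2 * 1"
    using assms mult_mono[of p 1 "1 - p" 1] by (intro add_left_mono mult_left_mono) auto
  finally show ?thesis by simp
qed

text \<open>Signed excess of class \<open>i\<close> inside \<open>A\<close> over its mean, as if
  every vertex chose its class independently with probabilities \<open>p\<close>.\<close>

definition dev :: "('i \<Rightarrow> real) \<Rightarrow> 'a set \<Rightarrow> ('a \<Rightarrow> 'i) \<Rightarrow> 'a set \<Rightarrow> 'i \<Rightarrow> real" where
  "dev p V f A i = (\<Sum>v\<in>V \<inter> A. of_bool (f v = i) - p i)"

lemma dev_insert:
  assumes "finite V" "v \<notin> V"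
  shows "dev p (insert v V) (f(v := j)) A i =
    dev p V f A i + (if v \<in> A then of_bool (j = i) - p i else 0)"
proof -
  have "dev p V (f(v := j)) A i = dev p V f A i"
    unfolding dev_def using assms(2) by (intro sum.cong) auto
  then show ?thesis
    using assms by (auto simp: dev_def)
qed

lemma avg_exists:
  fixes p g :: "'i \<Rightarrow> real"
  assumes "finite I" "\<And>i. i \<in> I \<Longrightarrow> 0 \<le> p i" "sum p I = 1" "(\<Sum>i\<in>I. p i * g i) \<le> c"
  shows "\<exists>i\<in>I. g i \<le> c"
proof (rule ccontr)
  assume "\<not> ?thesis"
  then have g: "\<And>i. i \<in> I \<Longrightarrow> c < g i" by force
  obtain i where i: "i \<in> I" "p i \<noteq> 0" using assms(3) by (metis sum.neutral zero_neq_one)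
  have "(\<Sum>i\<in>I. p i * c) < (\<Sum>i\<in>I. p i * g i)"
  proof (rule sum_strict_mono_ex1[OF assms(1)])
    show "\<forall>i\<in>I. p i * c \<le> p i * g i" using g assms(2) by (meson less_imp_le mult_left_mono)
    show "\<exists>i\<in>I. p i * c < p i * g i" using i g[OF i(1)] assms(2)[OF i(1)] by (intro bexI[of _ i]) auto
  qed
  then show False using assms by (simp add: sum_distrib_right[symmetric])
qed

text \<open>The assignment is built vertex by vertex; averaging over \<^term>\<open>p\<close> shows that some choice
  multiplies the exponential potential by at most \<^term>\<open>1 + l^2\<close>.\<close>

lemma potential:
  fixes p :: "'i \<Rightarrow> real" and A :: "'k \<Rightarrow> 'a set" and l :: real
  assumes V: "finite V" and I: "finite I" and p: "\<And>i. i \<in> I \<Longrightarrow> 0 \<le> p i" "sum p I = 1"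
    and T: "finite T" and l: "0 < l" "l \<le> 1"
  shows "\<exists>f. (\<forall>v\<in>V. f v \<in> I) \<and>
    (\<Sum>k\<in>T. \<Sum>i\<in>I. exp (l * dev p V f (A k) i) + exp (- l * dev p V f (A k) i))
      \<le> 2 * card T * card I * (1 + l^2) ^ card V"
  using V
proof induction
  case empty
  have "(\<Sum>k\<in>T. \<Sum>i\<in>I. exp (l * dev p {} f (A k) i) + exp (- l * dev p {} f (A k) i))
      = 2 * card T * card I" for f :: "'a \<Rightarrow> 'i" by (simp add: dev_def)
  then show ?case by simp
next
  case (insert v V)
  let ?g = "\<lambda>f a k i. exp (a * dev p V f (A k) i)"
  let ?h = "\<lambda>f j a k i. exp (a * dev p (insert v V) (f(v := j)) (A k) i)"
  from insert obtain f where f: "\<forall>v\<in>V. f v \<in> I"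
    "(\<Sum>k\<in>T. \<Sum>i\<in>I. ?g f l k i + ?g f (-l) k i) \<le> 2 * card T * card I * (1 + l^2) ^ card V" by auto
  have p1: "p i \<le> 1" if "i \<in> I" for i
    using member_le_sum[OF that, of p] p I by auto
  have one: "(\<Sum>j\<in>I. p j * ?h f j a k i) \<le> (1 + l^2) * ?g f a k i"
    if i: "i \<in> I" and a: "a = l \<or> a = - l" for a k i
  proof (cases "v \<in> A k")
    case True
    have a1: "\<bar>a\<bar> \<le> 1" "a^2 = l^2" using a l by auto
    have h: "?h f j a k i = ?g f a k i * exp (a * (of_bool (j = i) - p i))" for j
      using True insert.hyps by (simp add: dev_insert distrib_left exp_add)
    have "(\<Sum>j\<in>I. p j * ?h f j a k i)
        = p i * ?h f i a k i + (\<Sum>j\<in>I - {i}. p j * ?h f j a k i)"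
      using I i by (rule sum.remove)
    also have "(\<Sum>j\<in>I - {i}. p j * ?h f j a k i) = (\<Sum>j\<in>I - {i}. p j * (?g f a k i * exp (a * (0 - p i))))"
      unfolding h by (intro sum.cong) auto
    also have "\<dots> = sum p (I - {i}) * (?g f a k i * exp (a * (0 - p i)))"
      by (simp add: sum_distrib_right)
    also have "sum p (I - {i}) = 1 - p i" using p(2) I i by (simp add: sum_diff1)
    also have "p i * ?h f i a k i + (1 - p i) * (?g f a k i * exp (a * (0 - p i)))
        = ?g f a k i * (p i * exp (a * (1 - p i)) + (1 - p i) * exp (a * (0 - p i)))"
      unfolding h by (simp add: algebra_simps)
    also have "\<dots> \<le> ?g f a k i * (1 + a^2)"
      using bernoulli_mgf[of "p i" a] p(1)[OF i] p1[OF i] a1 by (intro mult_left_mono) auto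
    finally show ?thesis by (simp only: a1(2) mult.commute)
  next
    case False
    then have "(\<Sum>j\<in>I. p j * ?h f j a k i) = (\<Sum>j\<in>I. p j) * ?g f a k i"
      using insert.hyps by (simp add: dev_insert sum_distrib_right)
    also have "\<dots> \<le> (1 + l^2) * ?g f a k i" using p(2) by (intro mult_right_mono) auto
    finally show ?thesis .
  qed
  have "(\<Sum>j\<in>I. p j * (\<Sum>k\<in>T. \<Sum>i\<in>I. ?h f j l k i + ?h f j (-l) k i))
      = (\<Sum>k\<in>T. \<Sum>i\<in>I. (\<Sum>j\<in>I. p j * ?h f j l k i) + (\<Sum>j\<in>I. p j * ?h f j (-l) k i))"
  proof -
    have "(\<Sum>j\<in>I. p j * (\<Sum>k\<in>T. \<Sum>i\<in>I. ?h f j l k i + ?h f j (-l) k i))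
        = (\<Sum>j\<in>I. \<Sum>k\<in>T. \<Sum>i\<in>I. p j * ?h f j l k i + p j * ?h f j (-l) k i)"
      by (simp only: sum_distrib_left distrib_left)
    also have "\<dots> = (\<Sum>k\<in>T. \<Sum>j\<in>I. \<Sum>i\<in>I. p j * ?h f j l k i + p j * ?h f j (-l) k i)"
      by (rule sum.swap)
    also have "\<dots> = (\<Sum>k\<in>T. \<Sum>i\<in>I. \<Sum>j\<in>I. p j * ?h f j l k i + p j * ?h f j (-l) k i)"
      by (rule sum.cong[OF refl], rule sum.swap)
    also have "\<dots> = (\<Sum>k\<in>T. \<Sum>i\<in>I. (\<Sum>j\<in>I. p j * ?h f j l k i) + (\<Sum>j\<in>I. p j * ?h f j (-l) k i))"
      by (simp only: sum.distrib)
    finally show ?thesis .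
  qed
  also have "\<dots> \<le> (\<Sum>k\<in>T. \<Sum>i\<in>I. (1 + l^2) * ?g f l k i + (1 + l^2) * ?g f (-l) k i)"
    by (intro sum_mono add_mono one) auto
  also have "\<dots> = (1 + l^2) * (\<Sum>k\<in>T. \<Sum>i\<in>I. ?g f l k i + ?g f (-l) k i)"
    by (simp only: sum_distrib_left distrib_left)
  also have "\<dots> \<le> (1 + l^2) * (2 * card T * card I * (1 + l^2) ^ card V)"
    using f(2) by (intro mult_left_mono) auto
  finally have "\<exists>j\<in>I. (\<Sum>k\<in>T. \<Sum>i\<in>I. ?h f j l k i + ?h f j (-l) k i)
      \<le> (1 + l^2) * (2 * card T * card I * (1 + l^2) ^ card V)"
    by (intro avg_exists[OF I p])
  then obtain j where j: "j \<in> I"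
    "(\<Sum>k\<in>T. \<Sum>i\<in>I. ?h f j l k i + ?h f j (-l) k i) \<le> (1 + l^2) * (2 * card T * card I * (1 + l^2) ^ card V)"
    by blast
  have "card (insert v V) = Suc (card V)" using insert.hyps by simp
  then show ?case using f(1) insert.hyps j by (intro exI[of _ "f(v := j)"]) (simp only: power_Suc mult_ac, auto)
qed

text \<open>A deterministic Chernoff and union bound: each summand of the potential is at most the
  whole sum, the number of summands is absorbed through \<open>big\<close>, and taking logarithms
  bounds both signs of the deviation.\<close>

lemma split_evenly:
  fixes p :: "'i \<Rightarrow> real" and A :: "'k \<Rightarrow> 'a set" and l :: real
  assumes V: "finite V" and I: "finite I" and p: "\<And>i. i \<in> I \<Longrightarrow> 0 \<le> p i" "sum p I = 1"
    and T: "finite T" and l: "0 < l" "l \<le> 1"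
    and big: "ln (2 * card T * card I) \<le> l^2 * card V"
  shows "\<exists>f. (\<forall>v\<in>V. f v \<in> I) \<and>
    (\<forall>k\<in>T. \<forall>i\<in>I. \<bar>real (card {v \<in> V \<inter> A k. f v = i}) - p i * card (V \<inter> A k)\<bar> \<le> 2 * l * card V)"
proof -
  obtain f where f: "\<forall>v\<in>V. f v \<in> I"
    "(\<Sum>k\<in>T. \<Sum>i\<in>I. exp (l * dev p V f (A k) i) + exp (- l * dev p V f (A k) i))
      \<le> 2 * card T * card I * (1 + l^2) ^ card V"
    using potential[OF V I p T l] by blast
  have "\<bar>real (card {v \<in> V \<inter> A k. f v = i}) - p i * card (V \<inter> A k)\<bar> \<le> 2 * l * card V"
    if k: "k \<in> T" and i: "i \<in> I" for k i
  proof -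
    let ?d = "dev p V f (A k) i"
    have d: "real (card {v \<in> V \<inter> A k. f v = i}) - p i * card (V \<inter> A k) = ?d"
      unfolding dev_def sum_subtractf using V by (subst sum_of_bool_card) auto
    have pos: "0 < 2 * real (card T) * real (card I)" using T I k i card_gt_0_iff[of T] card_gt_0_iff[of I] by (auto intro!: mult_pos_pos)
    have "exp (l * ?d) + exp (- l * ?d) \<le> (\<Sum>i\<in>I. exp (l * dev p V f (A k) i) + exp (- l * dev p V f (A k) i))"
      by (rule member_le_sum[OF i]) (use I in \<open>auto intro: add_nonneg_nonneg\<close>)
    also have "\<dots> \<le> (\<Sum>k\<in>T. \<Sum>i\<in>I. exp (l * dev p V f (A k) i) + exp (- l * dev p V f (A k) i))"
      by (rule member_le_sum[OF k]) (use T in \<open>auto intro!: sum_nonneg add_nonneg_nonneg\<close>)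
    also have "\<dots> \<le> 2 * card T * card I * (1 + l^2) ^ card V" by (rule f(2))
    also have "\<dots> \<le> 2 * card T * card I * exp (l^2) ^ card V"
      by (intro mult_left_mono power_mono exp_ge_add_one_self) auto
    also have "\<dots> = exp (ln (2 * card T * card I) + l^2 * card V)"
      using pos by (simp add: exp_add exp_of_nat_mult[symmetric] mult.commute)
    also have "\<dots> \<le> exp (2 * (l^2 * card V))" using big by (simp add: mult.commute)
    finally have s: "exp (l * ?d) + exp (- l * ?d) \<le> exp (2 * (l^2 * card V))" .
    have "exp (l * ?d) \<le> exp (2 * (l^2 * card V))" "exp (- l * ?d) \<le> exp (2 * (l^2 * card V))"
      using s exp_gt_zero[of "l * ?d"] exp_gt_zero[of "- l * ?d"] by linarith+
    then have "l * ?d \<le> l * (2 * l * card V)" "l * (- ?d) \<le> l * (2 * l * card V)"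
      by (auto simp: power2_eq_square mult_ac)
    then have "?d \<le> 2 * l * card V" "- ?d \<le> 2 * l * card V"
      using l by (simp_all only: mult_le_cancel_left_pos)
    then show ?thesis unfolding d by linarith
  qed
  then show ?thesis using f(1) by blast
qed

subsection \<open>Chains of matchings\<close>

text \<open>Counting arcs between \<open>J\<close> and its neighbourhood shows that the latter has
  at least \<open>card J * D1 / D2\<close> elements, so Hall's condition fails by at most
  \<open>k\<close>.\<close>

lemma near_matching:
  fixes D1 D2 :: real and k :: nat
  assumes fin: "finite X" "finite Y" and D: "0 \<le> D1" "0 < D2"
    and lo: "\<And>x. x \<in> X \<Longrightarrow> D1 \<le> card (nbrs H s x Y)"
    and hi: "\<And>y. y \<in> Y \<Longrightarrow> card (nbrs H (\<not> s) y X) \<le> D2"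
    and k: "(1 - D1 / D2) * card X \<le> k"
  shows "\<exists>X' g. X' \<subseteq> X \<and> card X \<le> card X' + k \<and> inj_on g X' \<and> (\<forall>x\<in>X'. g x \<in> Y \<and> arc H s x (g x))"
proof -
  define A where "A = (\<lambda>x. nbrs H s x Y)"
  have "card J \<le> card (\<Union>x\<in>J. A x) + k" if J: "J \<subseteq> X" for J
  proof -
    let ?M = "\<Union>x\<in>J. A x"
    have finJ: "finite J" using J fin by (auto intro: finite_subset)
    have MY: "?M \<subseteq> Y" by (auto simp: A_def nbrs_def)
    then have finM: "finite ?M" using fin by (auto intro: finite_subset)
    have "real (card J) * D1 \<le> ec (arc H s) J ?M"
    proof (rule ec_lower[OF finM])
      fix x assume x: "x \<in> J"
      then have "A x \<subseteq> {y \<in> ?M. arc H s x y}" by (auto simp: A_def nbrs_def)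
      moreover have "finite {y \<in> ?M. arc H s x y}" using finM by (rule rev_finite_subset) auto
      ultimately have "card (A x) \<le> card {y \<in> ?M. arc H s x y}" by (intro card_mono)
      then show "D1 \<le> card {y \<in> ?M. arc H s x y}" using lo[of x] x J unfolding A_def by force
    qed
    also have "\<dots> \<le> real (card ?M) * D2"
    proof (rule ec_upper'[OF finJ])
      fix y assume y: "y \<in> ?M"
      have "{x \<in> J. arc H s x y} \<subseteq> nbrs H (\<not> s) y X" using J by (auto simp: nbrs_def arc_not)
      then have "card {x \<in> J. arc H s x y} \<le> card (nbrs H (\<not> s) y X)" using fin by (intro card_mono) auto
      then show "card {x \<in> J. arc H s x y} \<le> D2" using hi[of y] y MY by force
    qed
    finally have "real (card J) * (D1 / D2) \<le> card ?M" using D by (simp add: field_simps)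
    moreover have "real (card J) * (1 - D1 / D2) \<le> k"
    proof (cases "D1 \<le> D2")
      case True
      have "card J \<le> card X" using J fin by (intro card_mono)
      then have "real (card J) * (1 - D1 / D2) \<le> card X * (1 - D1 / D2)"
        using True D by (intro mult_right_mono) auto
      then show ?thesis using k by (simp add: mult.commute)
    next
      case False
      then have "1 - D1 / D2 \<le> 0" using D by simp
      then have "real (card J) * (1 - D1 / D2) \<le> 0" by (simp add: mult_nonneg_nonpos)
      then show ?thesis by (metis of_nat_0_le_iff order_trans)
    qed
    ultimately have "real (card J) \<le> card ?M + k" by (simp add: right_diff_distrib)
    then show ?thesis by simp
  qed
  then obtain I' f where "I' \<subseteq> X" "card X \<le> card I' + k" "inj_on f I'" "\<forall>i\<in>I'. f i \<in> A i"
    using hall_defect[OF fin(1), of A k] fin(2) by (auto simp: A_def)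
  then show ?thesis by (intro exI[of _ I'] exI[of _ f]) (auto simp: A_def nbrs_def)
qed

text \<open>Each level matches the current ends of the surviving paths into the next part and loses
  at most \<open>k\<close> of them. \<open>I\<close> indexes the paths that survive all levels, and
  \<open>P j i\<close> is the vertex of path \<open>i\<close> at level \<open>j\<close>.\<close>

lemma matching_chain:
  fixes W :: "nat \<Rightarrow> 'a set" and D1 D2 :: real and k :: nat
  assumes fin: "\<And>j. j \<le> length ws \<Longrightarrow> finite (W j)"
    and D: "0 \<le> D1" "0 < D2"
    and lo: "\<And>j x. j < length ws \<Longrightarrow> x \<in> W j \<Longrightarrow> D1 \<le> card (nbrs H (ws ! j) x (W (Suc j)))"
    and hi: "\<And>j y. j < length ws \<Longrightarrow> y \<in> W (Suc j) \<Longrightarrow> card (nbrs H (\<not> ws ! j) y (W j)) \<le> D2"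
    and k: "\<And>j. j \<le> length ws \<Longrightarrow> (1 - D1 / D2) * card (W j) \<le> k" and D12: "D1 \<le> D2"
  shows "\<exists>I P. I \<subseteq> W 0 \<and> card (W 0) \<le> card I + length ws * k \<and>
     (\<forall>j\<le>length ws. inj_on (P j) I \<and> P j ` I \<subseteq> W j) \<and>
     (\<forall>j<length ws. \<forall>i\<in>I. arc H (ws ! j) (P j i) (P (Suc j) i))"
proof -
  have "\<exists>I P. I \<subseteq> W 0 \<and> card (W 0) \<le> card I + n * k \<and>
     (\<forall>j\<le>n. inj_on (P j) I \<and> P j ` I \<subseteq> W j) \<and>
     (\<forall>j<n. \<forall>i\<in>I. arc H (ws ! j) (P j i) (P (Suc j) i))" if "n \<le> length ws" for n
    using that
  proof (induction n)
    case 0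
    then show ?case by (intro exI[of _ "W 0"] exI[of _ "\<lambda>_ x. x"]) auto
  next
    case (Suc n)
    then have n: "n < length ws" by simp
    from Suc.IH[OF less_imp_le[OF n]] obtain I P where IP1: "I \<subseteq> W 0" "card (W 0) \<le> card I + n * k"
      and IP2: "\<forall>j\<le>n. inj_on (P j) I \<and> P j ` I \<subseteq> W j"
      and IP3: "\<forall>j<n. \<forall>i\<in>I. arc H (ws ! j) (P j i) (P (Suc j) i)"
      by (elim exE conjE) (rule that)
    have IP: "I \<subseteq> W 0" "card (W 0) \<le> card I + n * k"
      "\<And>j. j \<le> n \<Longrightarrow> inj_on (P j) I" "\<And>j. j \<le> n \<Longrightarrow> P j ` I \<subseteq> W j"
      "\<And>j i. j < n \<Longrightarrow> i \<in> I \<Longrightarrow> arc H (ws ! j) (P j i) (P (Suc j) i)"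
      using IP1 IP2 IP3 by auto
    let ?X = "P n ` I"
    have XW: "?X \<subseteq> W n" using IP(4) by simp
    have finX: "finite ?X" using XW fin[of n] n by (auto intro: finite_subset)
    have cX: "card ?X \<le> card (W n)" using XW fin[of n] n by (intro card_mono) auto
    have "\<exists>X' g. X' \<subseteq> ?X \<and> card ?X \<le> card X' + k \<and> inj_on g X' \<and>
      (\<forall>x\<in>X'. g x \<in> W (Suc n) \<and> arc H (ws ! n) x (g x))"
    proof (rule near_matching[OF finX _ D])
      show "finite (W (Suc n))" using fin n by simp
      show "D1 \<le> card (nbrs H (ws ! n) x (W (Suc n)))" if "x \<in> ?X" for x using lo[OF n] XW that by blast
      show "card (nbrs H (\<not> ws ! n) y ?X) \<le> D2" if "y \<in> W (Suc n)" for y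
      proof -
        have "card (nbrs H (\<not> ws ! n) y ?X) \<le> card (nbrs H (\<not> ws ! n) y (W n))"
          using XW fin[of n] n by (intro card_mono) (auto simp: nbrs_def)
        then show ?thesis using hi[OF n that] by simp
      qed
      have "(1 - D1 / D2) * card ?X \<le> (1 - D1 / D2) * card (W n)"
        using cX D D12 by (intro mult_left_mono) auto
      then show "(1 - D1 / D2) * card ?X \<le> k" using k[of n] n by simp
    qed
    then obtain X' g where X': "X' \<subseteq> ?X" "card ?X \<le> card X' + k" "inj_on g X'"
      "\<And>x. x \<in> X' \<Longrightarrow> g x \<in> W (Suc n)" "\<And>x. x \<in> X' \<Longrightarrow> arc H (ws ! n) x (g x)" by blast
    define I' where "I' = {i \<in> I. P n i \<in> X'}"
    have PI': "P n ` I' = X'" using X'(1) by (auto simp: I'_def)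
    have II: "I' \<subseteq> I" by (auto simp: I'_def)
    have inj: "inj_on (P n) I'" using IP(3)[of n] II by (auto intro: inj_on_subset)
    have "card I' = card X'" using card_image[OF inj] PI' by simp
    moreover have "card ?X = card I" using IP(3)[of n] by (simp add: card_image)
    ultimately have c: "card (W 0) \<le> card I' + Suc n * k" using IP(2) X'(2) by simp
    define P' where "P' = P(Suc n := g \<circ> P n)"
    have "inj_on (P' j) I' \<and> P' j ` I' \<subseteq> W j" if "j \<le> Suc n" for j
    proof (cases "j = Suc n")
      case True
      have "inj_on (g \<circ> P n) I'" using inj X'(3) PI' by (intro comp_inj_on) auto
      moreover have "(g \<circ> P n) ` I' \<subseteq> W (Suc n)" using X'(4) PI' by auto
      ultimately show ?thesis using True by (simp add: P'_def)
    next
      case False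
      then have "j \<le> n" using that by simp
      then show ?thesis using False IP(3)[of j] IP(4)[of j] II by (auto simp: P'_def intro: inj_on_subset)
    qed
    moreover have "arc H (ws ! j) (P' j i) (P' (Suc j) i)" if "j < Suc n" "i \<in> I'" for i j
      using that IP(5)[of j i] II X'(5)[of "P n i"] by (cases "j = n") (auto simp: P'_def I'_def)
    ultimately show ?case using c II IP(1) by (intro exI[of _ I'] exI[of _ P']) auto
  qed
  then show ?thesis by blast
qed

lemma richD: "rich E e V U \<Longrightarrow> v \<in> V \<Longrightarrow> (3/8 + e) * card U \<le> card (nbrs E s v U)"
  by (simp add: rich_def)

text \<open>Greedy use of \<open>connect\<close>: the interiors built so far join the forbidden set,
  and the sum of all word lengths bounds their number in advance.\<close>

lemma fill_gaps:
  fixes e :: real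
  assumes as: "asymp E" and fin: "finite U" and UV: "U \<subseteq> V" and r: "rich E e V U" and e: "0 < e" "e \<le> 1/8"
    and J: "finite J" and xy: "\<And>j. j \<in> J \<Longrightarrow> x j \<in> V" "\<And>j. j \<in> J \<Longrightarrow> y j \<in> V"
    and K: "\<And>j. j \<in> J \<Longrightarrow> 16 / e^2 + 2 \<le> length (w j)"
    and n: "\<And>j. j \<in> J \<Longrightarrow> length (w j) \<le> e^2/32 * card U"
    and Z: "card (Z \<inter> U) + (\<Sum>j\<in>J. length (w j)) \<le> e/2 * card U"
  shows "\<exists>g. (\<forall>j\<in>J. length (g j) = length (w j) - 1 \<and> distinct (g j) \<and> set (g j) \<subseteq> U - Z \<and>
      wpath E (w j) (x j # g j @ [y j])) \<and> (\<forall>i\<in>J. \<forall>j\<in>J. i \<noteq> j \<longrightarrow> set (g i) \<inter> set (g j) = {})"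
  using J xy K n Z
proof (induction J)
  case empty
  then show ?case by simp
next
  case (insert k J)
  have le: "real (card (Z \<inter> U) + (\<Sum>j\<in>J. length (w j))) \<le> e/2 * card U"
    using insert.prems(5) insert.hyps by simp
  from insert.IH[OF insert.prems(1) insert.prems(2) insert.prems(3) insert.prems(4) le] obtain g
    where g: "\<forall>j\<in>J. length (g j) = length (w j) - 1 \<and> distinct (g j) \<and> set (g j) \<subseteq> U - Z \<and>
      wpath E (w j) (x j # g j @ [y j])" "\<forall>i\<in>J. \<forall>j\<in>J. i \<noteq> j \<longrightarrow> set (g i) \<inter> set (g j) = {}"
    by auto
  define Z' where "Z' = Z \<union> (\<Union>j\<in>J. set (g j))"
  have "Z' \<inter> U \<subseteq> (Z \<inter> U) \<union> (\<Union>j\<in>J. set (g j))" by (auto simp: Z'_def)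
  then have "card (Z' \<inter> U) \<le> card ((Z \<inter> U) \<union> (\<Union>j\<in>J. set (g j)))"
    using fin insert.hyps by (intro card_mono) auto
  also have "\<dots> \<le> card (Z \<inter> U) + card (\<Union>j\<in>J. set (g j))" by (rule card_Un_le)
  also have "card (\<Union>j\<in>J. set (g j)) \<le> (\<Sum>j\<in>J. card (set (g j)))"
    by (rule card_UN_le[OF insert.hyps(1)])
  also have "\<dots> \<le> (\<Sum>j\<in>J. length (w j))"
  proof (rule sum_mono)
    fix j assume "j \<in> J"
    then have "length (g j) \<le> length (w j)" using g(1) by simp
    then show "card (set (g j)) \<le> length (w j)" using card_length[of "g j"] by linarith
  qed
  finally have "card (Z' \<inter> U) \<le> card (Z \<inter> U) + (\<Sum>j\<in>J. length (w j))" by simp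
  from of_nat_mono[OF this, where 'a = real]
  have cZ: "card (Z' \<inter> U) \<le> e/2 * card U" using le by linarith
  obtain us where us: "length us = length (w k) - 1" "distinct us" "set us \<subseteq> U - Z'"
    "wpath E (w k) (x k # us @ [y k])"
    using connect[OF as fin UV r e insert.prems(1)[of k] insert.prems(2)[of k] insert.prems(3)[of k] cZ
        insert.prems(4)[of k]] by auto
  have "set us \<inter> set (g j) = {}" if "j \<in> J" for j using us(3) that by (auto simp: Z'_def)
  then show ?case using g us insert.hyps
    by (intro exI[of _ "g(k := us)"]) (auto simp: Z'_def)
qed

subsection \<open>Dominating families\<close>

text \<open>Weighted double counting: every vertex of \<open>W\<close> has at least
  \<open>card V / 4\<close>, hence at least \<open>card X / 4\<close>, neighbours in
  \<open>X\<close>, so an average \<open>d\<close> is joined to a quarter of the weight.\<close>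

lemma heavy_vertex:
  fixes \<mu> :: "'a \<Rightarrow> real"
  assumes fin: "finite V" and X: "X \<subseteq> V" "X \<noteq> {}" and W: "W \<subseteq> V"
    and deg: "\<And>v. v \<in> W \<Longrightarrow> card V / 4 \<le> card (nbrs E s v X)" and \<mu>: "\<And>v. v \<in> V \<Longrightarrow> 0 \<le> \<mu> v"
  shows "\<exists>d\<in>X. sum \<mu> W / 4 \<le> sum \<mu> {v \<in> W. arc E s v d}"
proof (rule ccontr)
  assume "\<not> ?thesis"
  then have less: "\<And>d. d \<in> X \<Longrightarrow> sum \<mu> {v \<in> W. arc E s v d} < sum \<mu> W / 4" by force
  have finX: "finite X" and finW: "finite W" using fin X W by (auto intro: finite_subset)
  have "card X / 4 * sum \<mu> W \<le> card V / 4 * sum \<mu> W"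
    using X fin W \<mu> by (intro mult_right_mono sum_nonneg) (auto intro: card_mono)
  also have "\<dots> = (\<Sum>v\<in>W. card V / 4 * \<mu> v)" by (rule sum_distrib_left)
  also have "\<dots> \<le> (\<Sum>v\<in>W. card (nbrs E s v X) * \<mu> v)"
    using deg \<mu> W by (intro sum_mono mult_right_mono) auto
  also have "\<dots> = (\<Sum>v\<in>W. \<Sum>d\<in>X. of_bool (arc E s v d) * \<mu> v)"
    using finX unfolding nbrs_def by (simp only: sum_distrib_right[symmetric] sum_of_bool_card)
  also have "\<dots> = (\<Sum>d\<in>X. \<Sum>v\<in>W. of_bool (arc E s v d) * \<mu> v)" by (rule sum.swap)
  also have "\<dots> = (\<Sum>d\<in>X. sum \<mu> {v \<in> W. arc E s v d})"
  proof (rule sum.cong[OF refl])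
    fix d
    show "(\<Sum>v\<in>W. of_bool (arc E s v d) * \<mu> v) = sum \<mu> {v \<in> W. arc E s v d}"
      using finW by (intro sum.mono_neutral_cong_right) auto
  qed
  also have "\<dots> < (\<Sum>d\<in>X. sum \<mu> W / 4)" using less finX X by (intro sum_strict_mono) auto
  finally show False by simp
qed

lemma rich_quarter:
  fixes e :: real
  assumes fin: "finite V" and r: "rich E e V V" and e: "0 < e" and F: "finite F" "8 * card F \<le> card V" and v: "v \<in> V"
  shows "card V / 4 \<le> card (nbrs E s v (V - F))"
proof -
  have "nbrs E s v V \<subseteq> nbrs E s v (V - F) \<union> F" by (auto simp: nbrs_def)
  then have "card (nbrs E s v V) \<le> card (nbrs E s v (V - F) \<union> F)"
    using fin F by (intro card_mono) auto
  also have "\<dots> \<le> card (nbrs E s v (V - F)) + card F" by (rule card_Un_le)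
  finally have "real (card (nbrs E s v V)) \<le> card (nbrs E s v (V - F)) + card F" by simp
  moreover have "3/8 * card V \<le> (3/8 + e) * card V" using e by (intro mult_right_mono) auto
  then have "3/8 * card V \<le> card (nbrs E s v V)" using richD[OF r v, of s] by (rule order_trans)
  moreover have "8 * real (card F) \<le> card V" using of_nat_mono[OF F(2), where 'a = real] by simp
  ultimately show ?thesis by (simp add: field_simps)
qed

text \<open>Greedy: \<open>Z\<close> and the earlier picks fill at most an eighth of
  \<open>V\<close>, so a quarter of \<open>V\<close> remains available around every vertex, and each
  pick dominates a quarter of the weight still undominated.\<close>

lemma dominate:
  fixes \<mu> :: "'a \<Rightarrow> real" and e :: real
  assumes fin: "finite V" and r: "rich E e V V" and e: "0 < e" and \<mu>: "\<And>v. v \<in> V \<Longrightarrow> 0 \<le> \<mu> v"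
    and Z: "8 * (card (Z \<inter> V) + k) \<le> card V"
  shows "\<exists>D\<subseteq>V - Z. card D = k \<and> sum \<mu> {v \<in> V. nbrs E s v D = {}} \<le> (3/4)^k * sum \<mu> V"
  using Z
proof (induction k)
  case 0
  then show ?case by (intro exI[of _ "{}"]) (simp add: nbrs_def)
next
  case (Suc k)
  then obtain D where D: "D \<subseteq> V - Z" "card D = k"
    "sum \<mu> {v \<in> V. nbrs E s v D = {}} \<le> (3/4)^k * sum \<mu> V" by auto
  let ?W = "{v \<in> V. nbrs E s v D = {}}"
  define X where "X = V - Z - D"
  have finD: "finite D" using D fin by (auto intro: finite_subset)
  have XV: "X \<subseteq> V" by (auto simp: X_def)
  have bad: "card ((Z \<inter> V) \<union> D) \<le> card (Z \<inter> V) + k" using card_Un_le[of "Z \<inter> V" D] D by simp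
  have "8 * card ((Z \<inter> V) \<union> D) \<le> card V" using bad Suc.prems by simp
  moreover have X_eq: "X = V - ((Z \<inter> V) \<union> D)" by (auto simp: X_def)
  ultimately have deg: "card V / 4 \<le> card (nbrs E s v X)" if v: "v \<in> V" for v
    using rich_quarter[OF fin r e _ _ v, of "(Z \<inter> V) \<union> D" s] fin finD
    by (simp add: X_eq)
  have Vne: "V \<noteq> {}" using Suc.prems by auto
  have "X \<noteq> {}"
  proof -
    obtain v where "v \<in> V" using Vne by blast
    moreover have "0 < card V" using Vne fin by (simp add: card_gt_0_iff)
    ultimately have "card (nbrs E s v X) \<noteq> 0" using deg[of v] by auto
    then have "nbrs E s v X \<noteq> {}" by auto
    then show ?thesis by (auto simp: nbrs_def)
  qed
  have "\<exists>d\<in>X. sum \<mu> ?W / 4 \<le> sum \<mu> {v \<in> ?W. arc E s v d}"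
    by (rule heavy_vertex[OF fin XV \<open>X \<noteq> {}\<close>]) (use deg \<mu> in auto)
  then obtain d where d: "d \<in> X" "sum \<mu> ?W / 4 \<le> sum \<mu> {v \<in> ?W. arc E s v d}" ..
  have "{v \<in> V. nbrs E s v (insert d D) = {}} = ?W - {v \<in> ?W. arc E s v d}"
    by (auto simp: nbrs_def)
  then have "sum \<mu> {v \<in> V. nbrs E s v (insert d D) = {}} = sum \<mu> ?W - sum \<mu> {v \<in> ?W. arc E s v d}"
    using fin by (simp only:) (rule sum_diff, auto)
  also have "\<dots> \<le> 3/4 * sum \<mu> ?W" using d by simp
  also have "\<dots> \<le> 3/4 * ((3/4)^k * sum \<mu> V)" using D(3) by (intro mult_left_mono) auto
  finally have "sum \<mu> {v \<in> V. nbrs E s v (insert d D) = {}} \<le> (3/4)^Suc k * sum \<mu> V" by simp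
  moreover have "card (insert d D) = Suc k" using d D finD by (simp add: X_def)
  ultimately show ?case using d D by (intro exI[of _ "insert d D"]) (auto simp: X_def)
qed

text \<open>In a gadget, \<open>D\<close> lies on the left zigzag and \<open>D'\<close> on the right
  one; a vertex enters between a member of \<open>D\<close> and a member of \<open>D'\<close>, so it
  needs a suitable arc to each set.\<close>

definition rejects :: "('a \<Rightarrow> 'a \<Rightarrow> bool) \<Rightarrow> bool \<Rightarrow> bool \<Rightarrow> 'a set \<Rightarrow> 'a set \<Rightarrow> 'a \<Rightarrow> bool" where
  "rejects E s t D D' v \<longleftrightarrow> nbrs E s v D = {} \<or> nbrs E t v D' = {}"

text \<open>A vertex carries weight \<^term>\<open>2 ^ r\<close>, where \<^term>\<open>r\<close> counts the pairs rejecting it so far; each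
  new pair is chosen to reject little of both this weight and the uniform one.\<close>

lemma dominators:
  fixes e c :: real and k :: nat
  defines "c \<equiv> 4 * (3/4)^k"
  assumes fin: "finite V" and r: "rich E e V V" and e: "0 < e"
    and z: "16 * (k * z) \<le> card V" and V: "V \<noteq> {}"
  shows "\<exists>D D'. (\<forall>g<z. D g \<subseteq> V \<and> D' g \<subseteq> V \<and> card (D g) = k \<and> card (D' g) = k \<and> D g \<inter> D' g = {} \<and>
       real (card {v \<in> V. rejects E s t (D g) (D' g) v}) \<le> c * card V) \<and>
     (\<forall>g<z. \<forall>h<z. g \<noteq> h \<longrightarrow> (D g \<union> D' g) \<inter> (D h \<union> D' h) = {}) \<and>
     (\<Sum>v\<in>V. 2 ^ card {g. g < z \<and> rejects E s t (D g) (D' g) v}) \<le> card V * (1 + c) ^ z"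
  using z
proof (induction z)
  case 0
  then show ?case by simp
next
  case (Suc z)
  then have "16 * (k * z) \<le> card V" by simp
  from Suc.IH[OF this] obtain D D' where
    D: "\<forall>g<z. D g \<subseteq> V \<and> D' g \<subseteq> V \<and> card (D g) = k \<and> card (D' g) = k \<and> D g \<inter> D' g = {} \<and>
       real (card {v \<in> V. rejects E s t (D g) (D' g) v}) \<le> c * card V"
    and disj: "\<forall>g<z. \<forall>h<z. g \<noteq> h \<longrightarrow> (D g \<union> D' g) \<inter> (D h \<union> D' h) = {}"
    and pot: "(\<Sum>v\<in>V. 2 ^ card {g. g < z \<and> rejects E s t (D g) (D' g) v}) \<le> card V * (1 + c) ^ z"
    by (elim exE conjE) (rule that)
  define wt :: "'a \<Rightarrow> real" where "wt = (\<lambda>v. 2 ^ card {g. g < z \<and> rejects E s t (D g) (D' g) v})"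
  define W where "W = sum wt V"
  \<comment> \<open>The uniform measure and the weights \<open>wt\<close> are each normalised to
    total 1, so one choice controls both. The total is 2 and two sets must dominate, whence
    \<open>c = 2 * 2 * (3/4)^k\<close>.\<close>
  define \<mu> where "\<mu> = (\<lambda>v. 1 / card V + wt v / W)"
  have nV: "real (card V) > 0" using V fin by (simp add: card_gt_0_iff)
  have wt1: "1 \<le> wt v" for v unfolding wt_def by simp
  have W0: "W > 0" unfolding W_def using V fin wt1 by (intro sum_pos) (auto intro: less_le_trans[OF zero_less_one])
  have wt0: "0 \<le> wt v" for v using wt1[of v] by simp
  have \<mu>0: "0 \<le> \<mu> v" for v unfolding \<mu>_def using W0 wt0 by (intro add_nonneg_nonneg) auto
  have \<mu>V: "sum \<mu> V = 2" unfolding \<mu>_def sum.distrib using nV W0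
    by (simp add: sum_divide_distrib[symmetric] W_def[symmetric])
  define Z where "Z = (\<Union>g<z. D g \<union> D' g)"
  have "card Z \<le> (\<Sum>g<z. card (D g \<union> D' g))" unfolding Z_def by (rule card_UN_le) simp
  also have "\<dots> \<le> (\<Sum>g<z. 2 * k)"
  proof (rule sum_mono)
    fix g assume "g \<in> {..<z}"
    then show "card (D g \<union> D' g) \<le> 2 * k" using D card_Un_le[of "D g" "D' g"] by simp
  qed
  finally have cZ: "card Z \<le> 2 * k * z" by (simp add: mult.commute)
  have ZV: "Z \<subseteq> V" using D by (auto simp: Z_def)
  have kz: "16 * (k * z) + 16 * k \<le> card V" using Suc.prems by (simp only: mult_Suc_right distrib_left add.commute)
  have cZ': "card Z \<le> 2 * (k * z)" using cZ by (simp only: mult.assoc)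
  have ZV': "Z \<inter> V = Z" using ZV by blast
  have "8 * (card (Z \<inter> V) + k) \<le> card V" unfolding ZV' distrib_left using cZ' kz by linarith
  from dominate[where \<mu> = \<mu> and s = s, OF fin r e \<mu>0 this] obtain A where
    A: "A \<subseteq> V - Z" "card A = k" "sum \<mu> {v \<in> V. nbrs E s v A = {}} \<le> (3/4)^k * sum \<mu> V"
    by (elim exE conjE) (rule that)
  have finZA: "finite (Z \<union> A)" using finite_subset[OF ZV fin] finite_subset[OF A(1)] fin by simp
  have "card ((Z \<union> A) \<inter> V) \<le> card (Z \<union> A)" by (rule card_mono[OF finZA]) simp
  also have "\<dots> \<le> card Z + k" using card_Un_le[of Z A] A(2) by simp
  finally have "card ((Z \<union> A) \<inter> V) \<le> card Z + k" .
  then have "8 * (card ((Z \<union> A) \<inter> V) + k) \<le> card V" unfolding distrib_left using cZ' kz by linarith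
  from dominate[where \<mu> = \<mu> and s = t, OF fin r e \<mu>0 this] obtain B where
    B: "B \<subseteq> V - (Z \<union> A)" "card B = k" "sum \<mu> {v \<in> V. nbrs E t v B = {}} \<le> (3/4)^k * sum \<mu> V"
    by (elim exE conjE) (rule that)
  let ?rej = "{v \<in> V. rejects E s t A B v}"
  have "?rej \<subseteq> {v \<in> V. nbrs E s v A = {}} \<union> {v \<in> V. nbrs E t v B = {}}" by (auto simp: rejects_def)
  then have "sum \<mu> ?rej \<le> sum \<mu> ({v \<in> V. nbrs E s v A = {}} \<union> {v \<in> V. nbrs E t v B = {}})"
    using fin \<mu>0 by (intro sum_mono2) auto
  also have "\<dots> \<le> sum \<mu> {v \<in> V. nbrs E s v A = {}} + sum \<mu> {v \<in> V. nbrs E t v B = {}}"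
    using fin \<mu>0 by (subst sum_Un) (auto intro!: sum_nonneg)
  also have "\<dots> \<le> c" using A(3) B(3) \<mu>V by (simp add: c_def)
  finally have rej: "card ?rej / card V + sum wt ?rej / W \<le> c"
    unfolding \<mu>_def sum.distrib by (simp add: sum_divide_distrib)
  have "0 \<le> sum wt ?rej / W" using W0 wt0 by (intro divide_nonneg_pos sum_nonneg) auto
  then have "card ?rej / card V \<le> c" using rej by linarith
  then have rej1: "card ?rej \<le> c * card V" using nV by (simp add: divide_le_eq)
  have "0 \<le> card ?rej / card V" by simp
  then have "sum wt ?rej / W \<le> c" using rej by linarith
  then have rej2: "sum wt ?rej \<le> c * W" using W0 by (simp add: divide_le_eq)
  define F where "F = D(z := A)"
  define F' where "F' = D'(z := B)"
  have F: "\<forall>g<Suc z. F g \<subseteq> V \<and> F' g \<subseteq> V \<and> card (F g) = k \<and> card (F' g) = k \<and> F g \<inter> F' g = {} \<and>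
       real (card {v \<in> V. rejects E s t (F g) (F' g) v}) \<le> c * card V"
  proof (intro allI impI)
    fix g assume "g < Suc z"
    then consider "g < z" | "g = z" by linarith
    then show "F g \<subseteq> V \<and> F' g \<subseteq> V \<and> card (F g) = k \<and> card (F' g) = k \<and> F g \<inter> F' g = {} \<and>
       real (card {v \<in> V. rejects E s t (F g) (F' g) v}) \<le> c * card V"
    proof cases
      case 1 then show ?thesis using D by (simp add: F_def F'_def)
    next
      case 2 then show ?thesis using A B rej1 by (auto simp: F_def F'_def)
    qed
  qed
  have new: "(A \<union> B) \<inter> (D g \<union> D' g) = {}" if "g < z" for g
    using A(1) B(1) that by (auto simp: Z_def)
  have disjF: "\<forall>g<Suc z. \<forall>h<Suc z. g \<noteq> h \<longrightarrow> (F g \<union> F' g) \<inter> (F h \<union> F' h) = {}"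
  proof (intro allI impI)
    fix g h assume gh: "g < Suc z" "h < Suc z" "g \<noteq> h"
    then consider "g < z" "h < z" | "g = z" "h < z" | "g < z" "h = z" by linarith
    then show "(F g \<union> F' g) \<inter> (F h \<union> F' h) = {}"
    proof cases
      case 1 then show ?thesis using disj gh by (simp add: F_def F'_def)
    next
      case 2 then show ?thesis using new[of h] by (simp add: F_def F'_def)
    next
      case 3 then show ?thesis using new[of g] by (simp add: F_def F'_def Int_commute)
    qed
  qed
  \<comment> \<open>A rejection by the new pair doubles a weight, so the total grows by the weight
    of \<open>?rej\<close>, that is by a factor of at most \<open>1 + c\<close>.\<close>
  have step: "2 ^ card {g. g < Suc z \<and> rejects E s t (F g) (F' g) v} = wt v + of_bool (rejects E s t A B v) * wt v" for v
  proof -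
    have "{g. g < Suc z \<and> rejects E s t (F g) (F' g) v}
        = {g. g < z \<and> rejects E s t (D g) (D' g) v} \<union> (if rejects E s t A B v then {z} else {})"
      by (auto simp: F_def F'_def less_Suc_eq)
    then show ?thesis by (simp add: wt_def)
  qed
  have "(\<Sum>v\<in>V. 2 ^ card {g. g < Suc z \<and> rejects E s t (F g) (F' g) v})
      = W + (\<Sum>v\<in>V. of_bool (rejects E s t A B v) * wt v)"
    unfolding step sum.distrib W_def by simp
  also have "(\<Sum>v\<in>V. of_bool (rejects E s t A B v) * wt v) = sum wt ?rej"
    using fin by (intro sum.mono_neutral_cong_right) auto
  also have "W + sum wt ?rej \<le> (1 + c) * W" using rej2 by (simp add: algebra_simps)
  also have "\<dots> \<le> (1 + c) * (card V * (1 + c) ^ z)"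
    using pot unfolding W_def wt_def c_def by (intro mult_left_mono) auto
  finally have "(\<Sum>v\<in>V. 2 ^ card {g. g < Suc z \<and> rejects E s t (F g) (F' g) v}) \<le> card V * (1 + c) ^ Suc z"
    by (simp add: mult_ac)
  then show ?case using F disjF by (intro exI[of _ F] exI[of _ F'] conjI)
qed

subsection \<open>Gadgets\<close>

lemma asymp_arcD: "asymp E \<Longrightarrow> \<not> arc E s v v"
  by (auto simp: arc_def dest: asympD)

text \<open>On a path with this word every even position has arcs of kind \<open>s\<close> to both
  of its odd neighbours; this is what allows strands to move by one place.\<close>

definition alt :: "bool \<Rightarrow> nat \<Rightarrow> bool list" where
  "alt s n = map (\<lambda>i. if even i then s else \<not> s) [0..<n]"

lemma length_alt [simp]: "length (alt s n) = n"
  by (simp add: alt_def)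

lemma nth_alt [simp]: "i < n \<Longrightarrow> alt s n ! i = (if even i then s else \<not> s)"
  by (simp add: alt_def)

lemma alt_append: "alt s (2 * a) @ alt s b = alt s (2 * a + b)"
  by (rule nth_equalityI) (auto simp: nth_append)

lemma card_Un_set_le: "card (Z \<union> set xs) \<le> card Z + length xs"
  using card_Un_le[of Z "set xs"] card_length[of xs] by linarith

text \<open>Consecutive members of \<open>ds\<close> are joined by connecting paths of
  \<open>2 * K\<close> letters; the even length keeps the alternation in step, so all members stand
  at even positions.\<close>

lemma zigzag:
  fixes e :: real
  assumes as: "asymp E" and fin: "finite V" and r: "rich E e V V" and e: "0 < e" "e \<le> 1/8"
    and K: "16 / e^2 + 2 \<le> real (2 * K)" and n: "real (2 * K) \<le> e^2/32 * card V"
    and ds: "ds \<noteq> []" "distinct ds" "set ds \<subseteq> V" and Z: "finite Z" "card Z + (2 * K + 1) * length ds \<le> e/2 * card V"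
  shows "\<exists>zs. length zs = 2 * K * (length ds - 1) + 1 \<and> distinct zs \<and> hd zs = hd ds \<and>
    set zs \<subseteq> set ds \<union> (V - Z) \<and> wpath E (alt s (2 * K * (length ds - 1))) zs \<and>
    (\<forall>i<length ds. zs ! (2 * (K * i)) = ds ! i)"
  using ds Z
proof (induction ds arbitrary: Z rule: list_nonempty_induct)
  case (single d)
  then show ?case by (intro exI[of _ "[d]"]) (simp add: alt_def)
next
  case (cons d ds)
  have "card (insert d Z) \<le> card Z + 1" by (simp add: card_insert_if cons.prems(3))
  then have "card (insert d Z) + (2 * K + 1) * length ds \<le> card Z + (2 * K + 1) * length (d # ds)" by simp
  then have "real (card (insert d Z) + (2 * K + 1) * length ds) \<le> e/2 * card V"
    using cons.prems(4) by linarith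
  moreover have "distinct ds" "set ds \<subseteq> V" "finite (insert d Z)" using cons.prems by auto
  ultimately obtain zs where zs: "length zs = 2 * K * (length ds - 1) + 1" "distinct zs" "hd zs = hd ds"
    "set zs \<subseteq> set ds \<union> (V - insert d Z)" "wpath E (alt s (2 * K * (length ds - 1))) zs"
    "\<forall>i<length ds. zs ! (2 * (K * i)) = ds ! i"
    using cons.IH[of "insert d Z"] by auto
  obtain y ys where y: "zs = y # ys" using zs(1) by (cases zs) auto
  obtain m where m: "length ds = Suc m" using cons.hyps by (cases ds) auto
  have yV: "y \<in> V" using zs(4) y \<open>set ds \<subseteq> V\<close> by auto
  have "card ((Z \<union> set (d # zs)) \<inter> V) \<le> card (Z \<union> set (d # zs))"
    using cons.prems(3) by (intro card_mono) auto
  also have "\<dots> \<le> card Z + length (d # zs)" by (rule card_Un_set_le)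
  also have "\<dots> \<le> card Z + (2 * K + 1) * length (d # ds)" using zs(1) m by (simp add: algebra_simps)
  finally have "real (card ((Z \<union> set (d # zs)) \<inter> V)) \<le> e/2 * card V" using cons.prems(4) by linarith
  from connect[OF as fin order_refl r e _ yV _ this, of d "alt s (2 * K)"] obtain us where
    us: "length us = 2 * K - 1" "distinct us" "set us \<subseteq> V - (Z \<union> set (d # zs))"
      "wpath E (alt s (2 * K)) (d # us @ [y])"
    using cons.prems K n by auto
  have "16 / e^2 > 0" using e by simp
  then have "0 < real (2 * K)" using K by linarith
  then have Kpos: "0 < 2 * K" by simp
  have lus: "length (d # us) = 2 * K" using us(1) Kpos by simp
  have "wpath E (alt s (2 * K) @ alt s (2 * K * (length ds - 1))) ((d # us) @ y # ys)"
    using us(4) zs(5) lus y by (subst wpath_append) auto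
  moreover have "2 * K + 2 * K * (length ds - 1) = 2 * K * (length (d # ds) - 1)" using m by simp
  ultimately have w: "wpath E (alt s (2 * K * (length (d # ds) - 1))) ((d # us) @ zs)"
    by (simp add: alt_append y del: append_Cons)
  have d: "d \<notin> set zs" using zs(4) cons.prems by auto
  have "((d # us) @ zs) ! (2 * (K * i)) = (d # ds) ! i" if i: "i < length (d # ds)" for i
  proof (cases i)
    case (Suc j)
    have "2 * (K * i) = length (d # us) + 2 * (K * j)" using lus Suc by simp
    then have "((d # us) @ zs) ! (2 * (K * i)) = zs ! (2 * (K * j))" by (simp only: nth_append_length_plus)
    then show ?thesis using zs(6) Suc i by simp
  qed simp
  moreover have "length ((d # us) @ zs) = 2 * K * (length (d # ds) - 1) + 1" using lus zs(1) m by simp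
  moreover have "distinct ((d # us) @ zs)" using us zs(2) d by auto
  moreover have "set ((d # us) @ zs) \<subseteq> set (d # ds) \<union> (V - Z)" using us(3) zs(4) by auto
  ultimately show ?case using w by (intro exI[of _ "(d # us) @ zs"]) auto
qed

text \<open>Applied with uniform weights, \<open>heavy_vertex\<close> keeps a quarter of the current
  common neighbourhood for every further member of \<open>bs\<close>.\<close>

lemma common_nbrs:
  fixes e :: real
  assumes fin: "finite V" and r: "rich E e V V" and e: "0 < e" and Z: "finite Z" "8 * (card Z + R) \<le> card V"
  shows "\<exists>bs. length bs = R \<and> distinct bs \<and> set bs \<subseteq> V - Z \<and>
    card (V - Z) \<le> 4 ^ R * card {y \<in> V - Z. \<forall>b\<in>set bs. arc E s y b}"
  using Z(2)
proof (induction R)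
  case 0
  then show ?case by (intro exI[of _ "[]"]) (auto simp: set_diff_eq)
next
  case (Suc R)
  then obtain bs where bs: "length bs = R" "distinct bs" "set bs \<subseteq> V - Z"
    "card (V - Z) \<le> 4 ^ R * card {y \<in> V - Z. \<forall>b\<in>set bs. arc E s y b}" by auto
  let ?Y = "{y \<in> V - Z. \<forall>b\<in>set bs. arc E s y b}"
  define F where "F = Z \<union> set bs"
  have cF: "card F \<le> card Z + R" using card_Un_set_le[of Z bs] bs by (simp add: F_def)
  have finF: "finite F" using Z by (simp add: F_def)
  have "card F < card V" using cF Suc.prems by simp
  then have "V - F \<noteq> {}" using finF card_mono[of F V] by auto
  moreover have "card V / 4 \<le> card (nbrs E s v (V - F))" if "v \<in> ?Y" for v
    using rich_quarter[OF fin r e finF, of v s] cF Suc.prems that by simp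
  ultimately have "\<exists>d\<in>V - F. sum (\<lambda>_. 1) ?Y / 4 \<le> sum (\<lambda>_. 1 :: real) {v \<in> ?Y. arc E s v d}"
    by (intro heavy_vertex[OF fin]) auto
  then obtain d where d: "d \<in> V - F" "real (card ?Y) / 4 \<le> card {v \<in> ?Y. arc E s v d}" by auto
  have "{v \<in> ?Y. arc E s v d} = {y \<in> V - Z. \<forall>b\<in>set (d # bs). arc E s y b}" by auto
  then have "card ?Y \<le> 4 * card {y \<in> V - Z. \<forall>b\<in>set (d # bs). arc E s y b}" using d(2) by simp
  then have "card (V - Z) \<le> 4 ^ R * (4 * card {y \<in> V - Z. \<forall>b\<in>set (d # bs). arc E s y b})"
    using bs(4) by (meson le_trans mult_le_mono2)
  then have "card (V - Z) \<le> 4 ^ Suc R * card {y \<in> V - Z. \<forall>b\<in>set (d # bs). arc E s y b}" by simp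
  moreover have "length (d # bs) = Suc R" "distinct (d # bs)" "set (d # bs) \<subseteq> V - Z"
    using bs d by (auto simp: F_def)
  ultimately show ?case by blast
qed

lemma pick_distinct:
  assumes "finite F" "\<And>i. i < q \<Longrightarrow> finite (N i) \<and> card F + q \<le> card (N i)"
  shows "\<exists>as. length as = q \<and> distinct as \<and> set as \<inter> F = {} \<and> (\<forall>i<q. as ! i \<in> N i)"
proof -
  have "\<exists>as. length as = m \<and> distinct as \<and> set as \<inter> F = {} \<and> (\<forall>i<m. as ! i \<in> N i)" if "m \<le> q" for m
    using that
  proof (induction m)
    case (Suc m)
    then obtain as where a: "length as = m" "distinct as" "set as \<inter> F = {}" "\<forall>i<m. as ! i \<in> N i" by auto
    have "card (F \<union> set as) \<le> card F + m" using card_Un_set_le[of F as] a by simp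
    then have "card (F \<union> set as) < card (N m)" using assms(2)[of m] Suc.prems by linarith
    then have "\<not> N m \<subseteq> F \<union> set as" using assms(1) card_mono[of "F \<union> set as" "N m"] by auto
    then obtain x where "x \<in> N m" "x \<notin> F" "x \<notin> set as" by auto
    then show ?case using a by (intro exI[of _ "as @ [x]"]) (auto simp: nth_append less_Suc_eq)
  qed simp
  then show ?thesis by blast
qed

section \<open>List bookkeeping for rearranged strands: parity classes, multisets and shifts\<close>

lemma mset_parity:
  "length zs = 2 * q + 1 \<Longrightarrow>
   mset (map (\<lambda>i. zs ! (2 * i)) [0..<q + 1]) + mset (map (\<lambda>i. zs ! (2 * i + 1)) [0..<q]) = mset zs"
proof (induction q arbitrary: zs)
  case 0
  then show ?case by (cases zs) auto
next
  case (Suc q)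
  then obtain a b zs' where zs: "zs = a # b # zs'" "length zs' = 2 * q + 1"
    by (metis Suc_length_conv add_Suc mult_Suc_right numeral_2_eq_2 add_2_eq_Suc add_Suc_right)
  have 1: "map (\<lambda>i. zs ! (2 * i)) [0..<Suc q + 1] = a # map (\<lambda>i. zs' ! (2 * i)) [0..<q + 1]"
  proof (rule nth_equalityI)
    fix i assume "i < length (map (\<lambda>i. zs ! (2 * i)) [0..<Suc q + 1])"
    then show "map (\<lambda>i. zs ! (2 * i)) [0..<Suc q + 1] ! i = (a # map (\<lambda>i. zs' ! (2 * i)) [0..<q + 1]) ! i"
      by (cases i) (auto simp: zs simp del: upt_Suc)
  qed simp
  have 2: "map (\<lambda>i. zs ! (2 * i + 1)) [0..<Suc q] = b # map (\<lambda>i. zs' ! (2 * i + 1)) [0..<q]"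
  proof (rule nth_equalityI)
    fix i assume "i < length (map (\<lambda>i. zs ! (2 * i + 1)) [0..<Suc q])"
    then show "map (\<lambda>i. zs ! (2 * i + 1)) [0..<Suc q] ! i = (b # map (\<lambda>i. zs' ! (2 * i + 1)) [0..<q]) ! i"
      by (cases i) (auto simp: zs simp del: upt_Suc)
  qed simp
  show ?case unfolding 1 2 using Suc.IH[OF zs(2)] by (simp add: zs(1) del: upt_Suc)
qed

lemma mset_concat_strands:
  "mset (concat (map (\<lambda>i. x i # u i @ [y i]) is)) =
   mset (map x is) + mset (concat (map u is)) + mset (map y is)"
  by (induction "is") (auto simp: ac_simps)

lemma map_upt_split: "map f [0..<a] @ map (\<lambda>l. f (a + l)) [0..<b] = map f [0..<a + b]"
  by (rule nth_equalityI) (auto simp: nth_append)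

lemma mset_map2_Cons:
  "length xs = length ys \<Longrightarrow> mset (concat (map2 (#) xs ys)) = mset xs + mset (concat ys)"
  by (induction xs ys rule: list_induct2) (auto simp: ac_simps)

lemma distinct_concat_map:
  "distinct is \<Longrightarrow> (\<And>i. i \<in> set is \<Longrightarrow> distinct (u i)) \<Longrightarrow>
   (\<And>i j. i \<in> set is \<Longrightarrow> j \<in> set is \<Longrightarrow> i \<noteq> j \<Longrightarrow> set (u i) \<inter> set (u j) = {}) \<Longrightarrow>
   distinct (concat (map u is))"
  by (induction "is") fastforce+

text \<open>Since \<open>Q ! i\<close> suits both \<open>as ! i\<close> and
  \<open>as ! Suc i\<close>, the place \<open>j\<close> can be left free for \<open>L\<close>:
  entries before it stay, later ones move on by one.\<close>

lemma shift_match: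
  assumes "length as = Suc (length Q)"
    and "\<And>i. i < length Q \<Longrightarrow> P (as ! i) (Q ! i) \<and> P (as ! Suc i) (Q ! i)"
    and "j < length as" "P (as ! j) L"
  shows "list_all2 P as (take j Q @ [L] @ drop j Q)"
proof -
  have "list_all2 P (take j as @ [as ! j] @ drop (Suc j) as) (take j Q @ [L] @ drop j Q)"
    using assms by (intro list_all2_appendI) (auto simp: list_all2_conv_all_nth)
  then show ?thesis using assms(3) by (simp add: Cons_nth_drop_Suc)
qed

lemma shift_match':
  assumes "length T = Suc (length xs)"
    and "\<And>i. i < length xs \<Longrightarrow> P (xs ! i) (T ! i) \<and> P (xs ! i) (T ! Suc i)" and "l < length T"
  shows "list_all2 P xs (take l T @ drop (Suc l) T)"
  unfolding list_all2_conv_all_nth using assms by (auto simp: nth_append min_def)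

lemma wpath_strand:
  assumes "wpath E (s # p) L" "arc E c a (hd L)" "arc E d (last L) b"
  shows "wpath E (c # s # p @ [d]) (a # L @ [b])"
proof -
  obtain us x where L: "L = us @ [x]" using assms(1) by (cases L rule: rev_cases) (auto simp: wpath_def)
  have "length us = length (s # p)" using assms(1) L by (simp add: wpath_def)
  then have "wpath E ((s # p) @ [d]) (us @ x # [b])"
    using assms(1,3) L by (subst wpath_append) (auto simp: wpath_Cons)
  then show ?thesis using assms(2) L by (cases us) (auto simp: wpath_Cons)
qed

lemma sum_lessThan_split: "(\<Sum>j<a + b. f j) = (\<Sum>j<a. f j) + (\<Sum>j<b. f (a + j))"
  for f :: "nat \<Rightarrow> nat"
  by (induction b) auto

text \<open>The strand ends are fixed but the interiors are pooled: the multiset equation only asks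
  that \<open>F\<close> and \<open>v\<close> together fill all strands. Without \<open>v\<close> the
  gadget is one vertex short.\<close>

definition is_gadget ::
  "('a \<Rightarrow> 'a \<Rightarrow> bool) \<Rightarrow> 'a set \<Rightarrow> bool list \<Rightarrow> nat \<Rightarrow> nat \<Rightarrow> ('a \<Rightarrow> bool) \<Rightarrow> 'a list \<Rightarrow> 'a list \<Rightarrow> 'a list \<Rightarrow> bool" where
  "is_gadget E V om R N acc as bs F \<longleftrightarrow>
     length as = R \<and> length bs = R \<and> distinct (as @ bs @ F) \<and> set (as @ bs @ F) \<subseteq> V \<and> length F = N \<and>
     (\<forall>v\<in>V. acc v \<longrightarrow> (\<exists>Ls. length Ls = R \<and> (\<forall>i<R. wpath E om (as ! i # Ls ! i @ [bs ! i])) \<and>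
        mset (concat Ls) = mset (v # F)))"

text \<open>The gadget has \<^term>\<open>2 * q + 1\<close> strands with word \<^term>\<open>s # t # p @ [d]\<close>. A new vertex enters next to
  any \<^term>\<open>as ! j\<close> and any tail \<^term>\<open>Ts ! l\<close>: the zigzag on the left lets the tails \<^term>\<open>Qs\<close> avoid the strand
  \<^term>\<open>j\<close>, the one on the right lets the other tails avoid \<^term>\<open>Ts ! l\<close>, and all tails fit all right ends.\<close>

lemma gadget:
  fixes e :: real and K k :: nat
  defines "q \<equiv> K * (k - 1)"
  defines "R \<equiv> 2 * q + 1"
  assumes as: "asymp E" and fin: "finite V" and r: "rich E e V V" and e: "0 < e" "e \<le> 1/8"
    and K: "16 / e^2 + 2 \<le> K" and p: "length p = K" and n: "real (2 * K) \<le> e^2/32 * card V"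
    and D: "D \<subseteq> V" "card D = k" "D' \<subseteq> V" "card D' = k" "D \<inter> D' = {}" "1 \<le> k"
    and Z: "Z \<subseteq> V" "Z \<inter> (D \<union> D') = {}" "card Z + R * (2 * K + 8) \<le> e/2 * card V"
    and big: "2 * 4 ^ R * R \<le> card V"
  shows "\<exists>as bs F. is_gadget E V (s # t # p @ [d]) R (R * (K + 2) - 1) (\<lambda>v. \<not> rejects E (\<not> s) t D D' v) as bs F \<and>
    set (as @ bs @ F) \<inter> Z = {}"
proof -
  have K0: "0 < K"
  proof -
    have "16 / e^2 > 0" using e by simp
    then have "0 < real K" using K by linarith
    then show ?thesis by simp
  qed
  have kR: "k \<le> q + 1" using K0 D(6) by (cases k) (auto simp: q_def)
  have R: "R = 2 * q + 1" "q \<le> R" "k \<le> R" using kR by (auto simp: R_def)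
  have finZ: "finite Z" using Z fin by (auto intro: finite_subset)
  have finD: "finite D" "finite D'" using D fin by (auto intro: finite_subset)
  have e2: "e / 2 * card V \<le> 1/16 * card V" using e by (intro mult_right_mono) auto
  have small: "real x \<le> e/2 * card V" if "x \<le> card Z + R * (2 * K + 8)" for x
    using of_nat_mono[OF that, where 'a = real] Z(3) by linarith
  have small16: "16 * x \<le> card V" if "x \<le> card Z + R * (2 * K + 8)" for x
    using small[OF that] e2 by simp
  define Z1 where "Z1 = Z \<union> D \<union> D'"
  have cZ1: "card Z1 \<le> card Z + 2 * k"
    using card_Un_le[of "Z \<union> D" D'] card_Un_le[of Z D] D by (simp add: Z1_def)
  have finZ1: "finite Z1" using finZ finD by (simp add: Z1_def)
  have "16 * (card Z1 + R) \<le> card V" using cZ1 R by (intro small16) (simp add: algebra_simps)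
  then have h1: "8 * (card Z1 + R) \<le> card V" and h2: "2 * card Z1 \<le> card V" by simp_all
  \<comment> \<open>The right ends come with a common neighbourhood of at least \<open>R\<close>
    vertices. The last interior vertices \<open>ys\<close> are taken from it, so every tail can end
    at every \<open>bs ! i\<close>.\<close>
  from common_nbrs[OF fin r e(1) finZ1 h1, where s = d] obtain bs where
    bs: "length bs = R" "distinct bs" "set bs \<subseteq> V - Z1"
      "card (V - Z1) \<le> 4 ^ R * card {y \<in> V - Z1. \<forall>b\<in>set bs. arc E d y b}"
    by (elim exE conjE) (rule that)
  define Y where "Y = {y \<in> V - Z1. \<forall>b\<in>set bs. arc E d y b}"
  have "card V - card Z1 \<le> card (V - Z1)" by (rule diff_card_le_card_Diff[OF finZ1])
  then have "card V \<le> 2 * card (V - Z1)" using h2 by linarith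
  also have "\<dots> \<le> 2 * (4 ^ R * card Y)" using bs(4) unfolding Y_def by (rule mult_le_mono2)
  finally have "2 * 4 ^ R * R \<le> 2 * 4 ^ R * card Y" using big by (simp only: mult.assoc)
  then have "R \<le> card Y" by (simp only: mult_le_cancel1) simp
  then obtain Y' where Y': "Y' \<subseteq> Y" "card Y' = R" by (metis obtain_subset_with_card_n)
  have "finite Y'" using Y'(2) R by (metis Suc_eq_plus1 card.infinite nat.distinct(1))
  then obtain ys where ys0: "set ys = Y'" "distinct ys" using finite_distinct_list by blast
  then have ys: "length ys = R" "distinct ys" "set ys \<subseteq> Y" using Y' distinct_card by fastforce+
  have ybs: "set ys \<inter> set bs = {}" using ys(3) asymp_arcD[OF as] by (auto simp: Y_def)
  have yV: "set ys \<subseteq> V - Z1" using ys(3) by (auto simp: Y_def)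
  obtain dl where dl: "set dl = D" "distinct dl" using finite_distinct_list[OF finD(1)] by blast
  obtain dl' where dl': "set dl' = D'" "distinct dl'" using finite_distinct_list[OF finD(2)] by blast
  have ldl: "length dl = k" "length dl' = k" using dl dl' D distinct_card by metis+
  have ne: "dl \<noteq> []" "dl' \<noteq> []" using ldl D(6) by auto
  have K2: "16 / e^2 + 2 \<le> real (2 * K)" using K by simp
  have kK: "(2 * K + 1) * k \<le> (2 * K + 1) * R" using R(3) by (rule mult_le_mono2)
  \<comment> \<open>\<open>D\<close> is released because the left zigzag must pass through it;
    \<open>D'\<close> stays forbidden, being kept for the right zigzag.\<close>
  define Z2 where "Z2 = Z1 - D \<union> set bs \<union> set ys"
  have cZ2: "card Z2 \<le> card Z + k + 2 * R"
  proof -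
    have "Z1 - D = Z \<union> D'" using Z(2) D(5) by (auto simp: Z1_def)
    then have "card (Z1 - D) \<le> card Z + k" using card_Un_le[of Z D'] D by simp
    then show ?thesis using card_Un_set_le[of "Z1 - D \<union> set bs" ys] card_Un_set_le[of "Z1 - D" bs] bs ys
      by (simp add: Z2_def)
  qed
  have finZ2: "finite Z2" using finZ1 by (simp add: Z2_def)
  have "card Z2 + (2 * K + 1) * length dl \<le> e/2 * card V"
    using cZ2 kK R(3) ldl by (intro small) (simp add: algebra_simps)
  from zigzag[OF as fin r e K2 n ne(1) dl(2) _ finZ2 this, where s = s] obtain zs where
    zs: "length zs = 2 * K * (length dl - 1) + 1" "distinct zs" "set zs \<subseteq> set dl \<union> (V - Z2)"
      "wpath E (alt s (2 * K * (length dl - 1))) zs" "\<forall>i<length dl. zs ! (2 * (K * i)) = dl ! i"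
    using dl D by auto
  define Z3 where "Z3 = Z \<union> set bs \<union> set ys \<union> set zs"
  have lzs: "length zs = R" using zs(1) ldl by (simp add: R_def q_def)
  have cZ3: "card Z3 \<le> card Z + 3 * R"
    using card_Un_set_le[of "Z \<union> set bs \<union> set ys" zs] card_Un_set_le[of "Z \<union> set bs" ys]
      card_Un_set_le[of Z bs] bs ys lzs by (simp add: Z3_def)
  have finZ3: "finite Z3" using finZ by (simp add: Z3_def)
  have "card Z3 + (2 * K + 1) * length dl' \<le> e/2 * card V"
    using cZ3 kK ldl by (intro small) (simp add: algebra_simps)
  from zigzag[OF as fin r e K2 n ne(2) dl'(2) _ finZ3 this, where s = "\<not> t"] obtain zs' where
    zs': "length zs' = 2 * K * (length dl' - 1) + 1" "distinct zs'" "set zs' \<subseteq> set dl' \<union> (V - Z3)"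
      "wpath E (alt (\<not> t) (2 * K * (length dl' - 1))) zs'" "\<forall>i<length dl'. zs' ! (2 * (K * i)) = dl' ! i"
    using dl' D by auto
  have lzs': "length zs' = R" using zs'(1) ldl by (simp add: R_def q_def)
  have zsV: "set zs \<subseteq> V - Z" "set zs' \<subseteq> V - Z"
    using zs(3) zs'(3) dl dl' D Z(2) by (auto simp: Z1_def Z2_def Z3_def)
  have bV: "set bs \<subseteq> V - Z" "set ys \<subseteq> V - Z" using bs(3) yV by (auto simp: Z1_def)
  have disj1: "set zs \<inter> (set bs \<union> set ys) = {}"
    using zs(3) dl bs(3) yV by (auto simp: Z1_def Z2_def)
  have disj2: "set zs' \<inter> (set bs \<union> set ys \<union> set zs) = {}"
  proof -
    have "D' \<inter> (set bs \<union> set ys) = {}" using bs(3) yV by (auto simp: Z1_def)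
    moreover have "D' \<subseteq> Z2" using D(5) by (auto simp: Z1_def Z2_def)
    then have "D' \<inter> set zs = {}" using zs(3) dl(1) D(5) by blast
    ultimately show ?thesis using zs'(3) dl'(1) unfolding Z3_def by blast
  qed
  \<comment> \<open>Even positions of the left zigzag become strand ends and those of the right one
    become starts of tails; the odd positions \<open>xs\<close> and \<open>xs'\<close> are the
    fillers that suit two neighbours each.\<close>
  define asl where "asl = map (\<lambda>i. zs ! (2 * i)) [0..<q + 1]"
  define xs where "xs = map (\<lambda>i. zs ! (2 * i + 1)) [0..<q]"
  define ts where "ts = map (\<lambda>i. zs' ! (2 * i)) [0..<q + 1]"
  define xs' where "xs' = map (\<lambda>i. zs' ! (2 * i + 1)) [0..<q]"
  have msz: "mset asl + mset xs = mset zs" "mset ts + mset xs' = mset zs'"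
    unfolding asl_def xs_def ts_def xs'_def by (rule mset_parity, simp only: lzs lzs' R(1))+
  have larcs: "arc E s (asl ! i) (xs ! i) \<and> arc E s (asl ! Suc i) (xs ! i)" if i: "i < q" for i
  proof -
    have l: "2 * K * (length dl - 1) = 2 * q" using ldl by (simp add: q_def)
    have "2 * i < 2 * q" "2 * i + 1 < 2 * q" using i by auto
    moreover have "\<forall>i<2 * q. arc E (alt s (2 * q) ! i) (zs ! i) (zs ! Suc i)"
      using zs(4) unfolding wpath_def l by simp
    ultimately have "arc E (alt s (2 * q) ! (2 * i)) (zs ! (2 * i)) (zs ! Suc (2 * i))"
      "arc E (alt s (2 * q) ! (2 * i + 1)) (zs ! (2 * i + 1)) (zs ! Suc (2 * i + 1))" by blast+
    then have "arc E s (zs ! (2 * i)) (zs ! Suc (2 * i))" "arc E (\<not> s) (zs ! (2 * i + 1)) (zs ! Suc (2 * i + 1))"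
      using i by simp_all
    then show ?thesis using i by (simp add: asl_def xs_def arc_not nth_append del: upt_Suc)
  qed
  have rarcs: "arc E t (xs' ! i) (ts ! i) \<and> arc E t (xs' ! i) (ts ! Suc i)" if i: "i < q" for i
  proof -
    have l: "2 * K * (length dl' - 1) = 2 * q" using ldl by (simp add: q_def)
    have "2 * i < 2 * q" "2 * i + 1 < 2 * q" using i by auto
    moreover have "\<forall>i<2 * q. arc E (alt (\<not> t) (2 * q) ! i) (zs' ! i) (zs' ! Suc i)"
      using zs'(4) unfolding wpath_def l by simp
    ultimately have "arc E (alt (\<not> t) (2 * q) ! (2 * i)) (zs' ! (2 * i)) (zs' ! Suc (2 * i))"
      "arc E (alt (\<not> t) (2 * q) ! (2 * i + 1)) (zs' ! (2 * i + 1)) (zs' ! Suc (2 * i + 1))" by blast+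
    then have "arc E (\<not> t) (zs' ! (2 * i)) (zs' ! Suc (2 * i))" "arc E t (zs' ! (2 * i + 1)) (zs' ! Suc (2 * i + 1))"
      using i by simp_all
    then show ?thesis using i by (simp add: ts_def xs'_def arc_not nth_append del: upt_Suc)
  qed
  have Dasl: "D \<subseteq> set asl" and Dts: "D' \<subseteq> set ts"
  proof -
    have *: "K * i < q + 1" if "i < k" for i
      using that by (simp add: q_def less_Suc_eq_le) (use that in \<open>auto intro!: mult_le_mono2\<close>)
    show "D \<subseteq> set asl"
    proof
      fix v assume "v \<in> D"
      then obtain i where i: "i < k" "dl ! i = v" using dl ldl by (metis in_set_conv_nth)
      then have "zs ! (2 * (K * i)) = v" using zs(5) ldl by simp
      then show "v \<in> set asl" using *[OF i(1)] unfolding asl_def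
        by (auto simp: image_iff simp del: upt_Suc intro!: bexI[of _ "K * i"])
    qed
    show "D' \<subseteq> set ts"
    proof
      fix v assume "v \<in> D'"
      then obtain i where i: "i < k" "dl' ! i = v" using dl' ldl by (metis in_set_conv_nth)
      then have "zs' ! (2 * (K * i)) = v" using zs'(5) ldl by simp
      then show "v \<in> set ts" using *[OF i(1)] unfolding ts_def
        by (auto simp: image_iff simp del: upt_Suc intro!: bexI[of _ "K * i"])
    qed
  qed
  define Z4 where "Z4 = Z3 \<union> set zs'"
  have cZ4: "card Z4 \<le> card Z + 4 * R" using card_Un_set_le[of Z3 zs'] cZ3 lzs' by (simp add: Z4_def)
  have finZ4: "finite Z4" using finZ3 by (simp add: Z4_def)
  have setxs': "set xs' \<subseteq> set zs'" "set ts \<subseteq> set zs'" "set xs \<subseteq> set zs" "set asl \<subseteq> set zs"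
    using msz by (metis set_mset_mset set_mset_union Un_upper1 Un_upper2)+
  have lens: "length asl = q + 1" "length xs = q" "length ts = q + 1" "length xs' = q"
    by (simp_all add: asl_def xs_def ts_def xs'_def)
  \<comment> \<open>The zigzag supplies only \<open>q + 1\<close> left ends. The other
    \<open>q\<close> are predecessors of the vertices of \<open>xs'\<close>, and their strands use
    all tails \<open>Ts\<close> except the one given to the new vertex.\<close>
  have "\<exists>al. length al = q \<and> distinct al \<and> set al \<inter> Z4 = {} \<and> (\<forall>i<q. al ! i \<in> nbrs E (\<not> s) (xs' ! i) V)"
  proof (rule pick_distinct[OF finZ4])
    fix i assume i: "i < q"
    have "xs' ! i \<in> set xs'" using i lens by simp
    then have "xs' ! i \<in> V" using setxs'(1) zsV(2) by blast
    then have "(3/8 + e) * card V \<le> card (nbrs E (\<not> s) (xs' ! i) V)" by (rule richD[OF r])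
    moreover have "1/16 * card V \<le> (3/8 + e) * card V" using e by (intro mult_right_mono) auto
    moreover have "16 * (card Z4 + q) \<le> card V" using cZ4 R by (intro small16) (simp add: algebra_simps)
    ultimately have "16 * (card Z4 + q) \<le> 16 * card (nbrs E (\<not> s) (xs' ! i) V)" by simp
    then show "finite (nbrs E (\<not> s) (xs' ! i) V) \<and> card Z4 + q \<le> card (nbrs E (\<not> s) (xs' ! i) V)" using fin by simp
  qed
  then obtain al where al: "length al = q" "distinct al" "set al \<inter> Z4 = {}"
    "\<forall>i<q. al ! i \<in> nbrs E (\<not> s) (xs' ! i) V" by blast
  have alV: "set al \<subseteq> V" using al(1,4) by (auto simp: in_set_conv_nth nbrs_def)
  define Z5 where "Z5 = Z4 \<union> set al"
  have cZ5: "card Z5 \<le> card Z + 5 * R" using card_Un_set_le[of Z4 al] cZ4 al R by (simp add: Z5_def)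
  have finZ5: "finite Z5" using finZ4 by (simp add: Z5_def)
  \<comment> \<open>Tails that start on the left zigzag carry \<open>t # p\<close>. Those that start
    on the right zigzag carry only \<open>p\<close>, their letter \<open>t\<close> being the step
    from \<open>xs'\<close> or from the new vertex.\<close>
  define w where "w = (\<lambda>j. if j < q then t # p else p)"
  define x where "x = (\<lambda>j. if j < q then xs ! j else ts ! (j - q))"
  have lw: "K \<le> length (w j)" "length (w j) \<le> K + 1" for j using p by (auto simp: w_def)
  have "\<exists>g. (\<forall>j\<in>{..<R}. length (g j) = length (w j) - 1 \<and> distinct (g j) \<and> set (g j) \<subseteq> V - Z5 \<and>
      wpath E (w j) (x j # g j @ [ys ! j])) \<and> (\<forall>i\<in>{..<R}. \<forall>j\<in>{..<R}. i \<noteq> j \<longrightarrow> set (g i) \<inter> set (g j) = {})"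
  proof (rule fill_gaps[OF as fin order_refl r e])
    fix j assume j: "j \<in> {..<R}"
    show "x j \<in> V"
    proof (cases "j < q")
      case True
      then have "xs ! j \<in> set xs" using lens by simp
      then show ?thesis using True setxs' zsV by (auto simp: x_def)
    next
      case False
      then have "ts ! (j - q) \<in> set ts" using lens j R by (intro nth_mem) auto
      then show ?thesis using False setxs' zsV by (auto simp: x_def)
    qed
    have "ys ! j \<in> set ys" using j ys by simp
    then show "ys ! j \<in> V" using bV by auto
    show "16 / e^2 + 2 \<le> length (w j)" using K lw(1)[of j] by linarith
    have "length (w j) \<le> 2 * K" using lw(2)[of j] K0 by linarith
    from of_nat_mono[OF this, where 'a = real] show "length (w j) \<le> e^2/32 * card V" using n by linarith
  next
    have "(\<Sum>j\<in>{..<R}. length (w j)) \<le> (\<Sum>j\<in>{..<R}. K + 1)" by (intro sum_mono lw)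
    moreover have "card (Z5 \<inter> V) \<le> card Z5" using finZ5 by (intro card_mono) auto
    ultimately show "real (card (Z5 \<inter> V) + (\<Sum>j\<in>{..<R}. length (w j))) \<le> e/2 * card V"
      using cZ5 by (intro small) (simp add: algebra_simps)
  qed simp
  then obtain g where
    g: "\<And>j. j < R \<Longrightarrow> length (g j) = length (w j) - 1" "\<And>j. j < R \<Longrightarrow> distinct (g j)"
      "\<And>j. j < R \<Longrightarrow> set (g j) \<subseteq> V - Z5" "\<And>j. j < R \<Longrightarrow> wpath E (w j) (x j # g j @ [ys ! j])"
      "\<And>i j. i < R \<Longrightarrow> j < R \<Longrightarrow> i \<noteq> j \<Longrightarrow> set (g i) \<inter> set (g j) = {}" unfolding lessThan_iff Ball_def by blast
  define Qs where "Qs = map (\<lambda>i. xs ! i # g i @ [ys ! i]) [0..<q]"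
  define Ts where "Ts = map (\<lambda>l. ts ! l # g (q + l) @ [ys ! (q + l)]) [0..<q + 1]"
  define F where "F = concat Qs @ concat Ts @ xs'"
  have mF: "mset F = mset xs + mset zs' + mset ys + mset (concat (map g [0..<R]))"
  proof -
    have 1: "mset (concat Qs) = mset xs + mset (concat (map g [0..<q])) + mset (map (\<lambda>i. ys ! i) [0..<q])"
      unfolding Qs_def mset_concat_strands using lens(2) map_nth[of xs] by simp
    have 2: "mset (concat Ts) = mset ts + mset (concat (map (\<lambda>l. g (q + l)) [0..<q + 1])) + mset (map (\<lambda>l. ys ! (q + l)) [0..<q + 1])"
      unfolding Ts_def mset_concat_strands using lens(3) map_nth[of ts] by (simp del: upt_Suc)
    have 3: "mset ys = mset (map (\<lambda>i. ys ! i) [0..<q]) + mset (map (\<lambda>l. ys ! (q + l)) [0..<q + 1])"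
      using map_upt_split[of "\<lambda>i. ys ! i" q "q + 1"] map_nth[of ys] ys(1) R
      by (metis mset_append add.assoc mult_2)
    have 4: "mset (concat (map g [0..<R])) = mset (concat (map g [0..<q])) + mset (concat (map (\<lambda>l. g (q + l)) [0..<q + 1]))"
      using map_upt_split[of g q "q + 1"] R by (metis mset_append concat_append add.assoc mult_2)
    show ?thesis unfolding F_def mset_append 1 2 3 4 msz(2)[symmetric] by (simp add: ac_simps)
  qed
  have mall: "mset ((asl @ al) @ bs @ F) = mset (zs @ al @ bs @ zs' @ ys @ concat (map g [0..<R]))"
    unfolding mset_append mF msz(1)[symmetric] by (simp add: ac_simps)
  have gZ: "set (concat (map g [0..<R])) \<subseteq> V - Z5" using g(3) by (auto, blast+)
  have dg: "distinct (concat (map g [0..<R]))"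
    using g by (intro distinct_concat_map) auto
  have "distinct (zs @ al @ bs @ zs' @ ys @ concat (map g [0..<R]))"
    using zs(2) zs'(2) al(2,3) bs(2) ys(2) dg gZ ybs disj1 disj2
    unfolding distinct_append set_append Z5_def Z4_def Z3_def by blast
  then have dist: "distinct ((asl @ al) @ bs @ F)" using mset_eq_imp_distinct_iff[OF mall] by simp
  have "set (zs @ al @ bs @ zs' @ ys @ concat (map g [0..<R])) \<subseteq> V - Z"
    using zsV bV gZ alV al(3) unfolding set_append Z5_def Z4_def Z3_def by blast
  then have setV: "set ((asl @ al) @ bs @ F) \<subseteq> V - Z" using mset_eq_setD[OF mall] by simp
  \<comment> \<open>A strand of \<open>K + 3\<close> letters has \<open>K + 2\<close> interior
    vertices; one of the \<open>R * (K + 2)\<close> places is reserved for the new vertex.\<close>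
  have lenF: "length F = R * (K + 2) - 1"
  proof -
    have "length (concat (map g [0..<R])) = (\<Sum>j<R. length (g j))"
      by (simp add: length_concat o_def interv_sum_list_conv_sum_set_nat atLeast0LessThan)
    also have "\<dots> = (\<Sum>j<R. length (w j) - 1)" using g(1) by (intro sum.cong) auto
    also have "\<dots> = (\<Sum>j<q. length (w j) - 1) + (\<Sum>j<q + 1. length (w (q + j)) - 1)"
      using sum_lessThan_split[of "\<lambda>j. length (w j) - 1" q "q + 1"] by (simp only: R(1) mult_2 add.assoc)
    also have "\<dots> = q * K + (q + 1) * (K - 1)" using p by (simp add: w_def)
    finally have g_len: "length (concat (map g [0..<R])) = q * K + (q + 1) * (K - 1)" .
    obtain K' where K': "K = Suc K'" using K0 by (cases K) auto
    have "length F = size (mset F)" by simp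
    also have "\<dots> = q + R + R + (q * K + (q + 1) * (K - 1))" unfolding mF by (simp add: lens lzs' ys g_len)
    also have "\<dots> = R * (K + 2) - 1" unfolding R_def K' by (simp add: algebra_simps)
    finally show ?thesis .
  qed
  have accept: "\<exists>Ls. length Ls = R \<and> (\<forall>i<R. wpath E (s # t # p @ [d]) ((asl @ al) ! i # Ls ! i @ [bs ! i])) \<and>
        mset (concat Ls) = mset (v # F)" if v: "v \<in> V" "\<not> rejects E (\<not> s) t D D' v" for v
  proof -
    obtain a where a: "a \<in> D" "arc E s a v" using v(2) by (auto simp: rejects_def nbrs_def arc_not)
    obtain b where b: "b \<in> D'" "arc E t v b" using v(2) by (auto simp: rejects_def nbrs_def)
    obtain j where j: "j < length asl" "asl ! j = a" using a Dasl by (metis in_set_conv_nth subsetD)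
    obtain l where l: "l < length ts" "ts ! l = b" using b Dts by (metis in_set_conv_nth subsetD)
    define P where "P = (\<lambda>a L. arc E s a (hd L) \<and> wpath E (t # p) L \<and> last L \<in> set ys)"
    have ysm: "ys ! i \<in> set ys" if "i < R" for i using that ys(1) by simp
    have Tw: "wpath E p (Ts ! i)" "hd (Ts ! i) = ts ! i" "last (Ts ! i) \<in> set ys" "Ts ! i \<noteq> []" if "i < q + 1" for i
      using that g(4)[of "q + i"] ysm[of "q + i"] R by (auto simp: Ts_def w_def x_def simp del: upt_Suc)
    have Qw: "wpath E (t # p) (Qs ! i)" "hd (Qs ! i) = xs ! i" "last (Qs ! i) \<in> set ys" if "i < q" for i
      using that g(4)[of i] ysm[of i] R by (auto simp: Qs_def w_def x_def)
    have lQT: "length Qs = q" "length Ts = q + 1" by (simp_all add: Qs_def Ts_def)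
    have cons: "P a' (y # Ts ! i)" if "i < q + 1" "arc E s a' y" "arc E t y (ts ! i)" for a' y i
      using that Tw[OF that(1)] unfolding P_def by (cases "Ts ! i") (auto simp: wpath_Cons)
    \<comment> \<open>The strand of \<open>a = asl ! j\<close> runs through \<open>v\<close> into
      the tail \<open>Ts ! l\<close>; the other ends in \<open>asl\<close> share out
      \<open>Qs\<close> by a shift.\<close>
    have 1: "list_all2 P asl (take j Qs @ [v # Ts ! l] @ drop j Qs)"
    proof (rule shift_match)
      show "P (asl ! i) (Qs ! i) \<and> P (asl ! Suc i) (Qs ! i)" if "i < length Qs" for i
        using that lQT larcs[of i] Qw[of i] by (simp add: P_def)
      show "P (asl ! j) (v # Ts ! l)" using cons[of l a v] a b j l lens by simp
    qed (use lens lQT j in auto)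
    \<comment> \<open>The tail \<open>Ts ! l\<close> is now taken; the right zigzag lets
      \<open>xs'\<close> share out the others.\<close>
    let ?T' = "take l Ts @ drop (Suc l) Ts"
    have "list_all2 (\<lambda>y L. wpath E (t # p) (y # L) \<and> last L \<in> set ys \<and> L \<noteq> []) xs' ?T'"
    proof (rule shift_match')
      fix i assume i: "i < length xs'"
      then show "(wpath E (t # p) (xs' ! i # Ts ! i) \<and> last (Ts ! i) \<in> set ys \<and> Ts ! i \<noteq> []) \<and>
        wpath E (t # p) (xs' ! i # Ts ! Suc i) \<and> last (Ts ! Suc i) \<in> set ys \<and> Ts ! Suc i \<noteq> []"
        using rarcs[of i] Tw[of i] Tw[of "Suc i"] lens
        by (cases "Ts ! i"; cases "Ts ! Suc i") (auto simp: wpath_Cons)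
    qed (use lens lQT l in auto)
    then have 2: "list_all2 P al (map2 (#) xs' ?T')"
      using al(1,4) lens by (auto simp: list_all2_conv_all_nth P_def nbrs_def arc_not)
    define Ls where "Ls = (take j Qs @ [v # Ts ! l] @ drop j Qs) @ map2 (#) xs' ?T'"
    have 3: "list_all2 P (asl @ al) Ls" unfolding Ls_def using 1 2 by (rule list_all2_appendI)
    have lLs: "length Ls = R" using list_all2_lengthD[OF 3] lens al R by simp
    have "wpath E (s # t # p @ [d]) ((asl @ al) ! i # Ls ! i @ [bs ! i])" if i: "i < R" for i
    proof (rule wpath_strand)
      have "P ((asl @ al) ! i) (Ls ! i)" using 3 i lLs by (simp add: list_all2_conv_all_nth)
      then show "wpath E (t # p) (Ls ! i)" "arc E s ((asl @ al) ! i) (hd (Ls ! i))"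
        and "arc E d (last (Ls ! i)) (bs ! i)"
        using ys(3) i bs(1) by (auto simp: P_def Y_def)
    qed
    moreover have "mset (concat Ls) = mset (v # F)"
    proof -
      have lT': "length xs' = length ?T'" using lens lQT l by simp
      have "mset (concat Qs) = mset (concat (take j Qs)) + mset (concat (drop j Qs))"
        by (metis append_take_drop_id concat_append mset_append)
      moreover have "Ts = take l Ts @ Ts ! l # drop (Suc l) Ts" using l lens lQT by (intro id_take_nth_drop) simp
      then have "mset (concat Ts) = mset (concat (take l Ts @ Ts ! l # drop (Suc l) Ts))" by (rule arg_cong)
      then have "mset (concat Ts) = mset (concat ?T') + mset (Ts ! l)" by simp
      ultimately show ?thesis unfolding Ls_def F_def
        using mset_map2_Cons[OF lT'] by simp
    qed
    ultimately show ?thesis using lLs by blast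
  qed
  have "length (asl @ al) = R" using lens al R by simp
  moreover have "set ((asl @ al) @ bs @ F) \<subseteq> V" "set ((asl @ al) @ bs @ F) \<inter> Z = {}" using setV by blast+
  ultimately show ?thesis unfolding is_gadget_def using bs(1) dist lenF accept
    by (intro exI[of _ "asl @ al"] exI[of _ bs] exI[of _ F]) blast
qed

subsection \<open>The absorbing zone\<close>

text \<open>Hall's condition from degrees of at least one half on both sides: for at most
  \<open>z/2\<close> gadgets one of them alone accepts enough, and for more than \<open>z/2\<close>
  no vertex is refused by all.\<close>

lemma match_absorb:
  assumes fin: "finite L" and L: "card L = z"
    and v: "\<And>v. v \<in> L \<Longrightarrow> 2 * card {g. g < z \<and> \<not> acc g v} \<le> z"
    and g: "\<And>g. g < z \<Longrightarrow> 2 * card {v \<in> L. \<not> acc g v} \<le> z"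
  shows "\<exists>f. bij_betw f {..<z} L \<and> (\<forall>g<z. acc g (f g))"
proof -
  define A where "A = (\<lambda>g. {v \<in> L. acc g v})"
  have "card J \<le> card (\<Union>g\<in>J. A g)" if J: "J \<subseteq> {..<z}" for J
  proof (cases "J = {}")
    case False
    then obtain h where h: "h \<in> J" by blast
    have finA: "finite (\<Union>g\<in>J. A g)" using J fin by (auto simp: A_def intro: finite_subset)
    show ?thesis
    proof (cases "2 * card J \<le> z")
      case True
      have "card L = card (A h) + card {v \<in> L. \<not> acc h v}"
        unfolding A_def using fin
        by (subst card_Un_disjoint[symmetric]) (auto intro!: arg_cong[where f = card])
      moreover have "card (A h) \<le> card (\<Union>g\<in>J. A g)" using h finA by (intro card_mono) auto
      ultimately show ?thesis using g[of h] h J True L by auto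
    next
      case False
      have "L \<subseteq> (\<Union>g\<in>J. A g)"
      proof
        fix x assume x: "x \<in> L"
        have "\<not> J \<subseteq> {g. g < z \<and> \<not> acc g x}"
        proof
          assume "J \<subseteq> {g. g < z \<and> \<not> acc g x}"
          then have "card J \<le> card {g. g < z \<and> \<not> acc g x}" by (intro card_mono) auto
          then show False using v[OF x] False by simp
        qed
        then show "x \<in> (\<Union>g\<in>J. A g)" using x J by (auto simp: A_def)
      qed
      then have "z \<le> card (\<Union>g\<in>J. A g)" using card_mono[OF finA] L by blast
      moreover have "card J \<le> z" using card_mono[OF _ J] by simp
      ultimately show ?thesis by simp
    qed
  qed simp
  then obtain f where f: "inj_on f {..<z}" "\<forall>g\<in>{..<z}. f g \<in> A g"
    using hall[of "{..<z}" A] fin by (auto simp: A_def)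
  have "f ` {..<z} \<subseteq> L" using f by (auto simp: A_def)
  then have "f ` {..<z} = L" using f(1) fin L by (metis card_image card_lessThan card_subset_eq)
  then show ?thesis using f by (intro exI[of _ f]) (auto simp: bij_betw_def A_def)
qed

lemma wpath_join:
  assumes "wpath E ws xs" "wpath E ws' (last xs # ys)"
  shows "wpath E (ws @ ws') (xs @ ys)"
proof -
  obtain us x where xs: "xs = us @ [x]" using assms(1) by (cases xs rule: rev_cases) (auto simp: wpath_def)
  have "length us = length ws" using assms(1) xs by (simp add: wpath_def)
  then show ?thesis using assms xs wpath_append[of us ws E ws' x ys] by simp
qed

lemma cycles_factor:
  assumes l: "l \<ge> 1"
    and len: "\<And>c. c < m \<Longrightarrow> length (cyc c) = l" and dist: "\<And>c. c < m \<Longrightarrow> distinct (cyc c)"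
    and path: "\<And>c. c < m \<Longrightarrow> wpath E (map dir [0..<l]) (cyc c @ [hd (cyc c)])"
    and disj: "\<And>c c'. c < m \<Longrightarrow> c' < m \<Longrightarrow> c \<noteq> c' \<Longrightarrow> set (cyc c) \<inter> set (cyc c') = {}"
    and cover: "(\<Union>c<m. set (cyc c)) = V"
  shows "has_cycle_factor l dir V E"
proof -
  define f where "f = (\<lambda>c i. cyc c ! i)"
  have im: "f c ` {0..<l} = set (cyc c)" if "c < m" for c
    using len[OF that] by (auto simp: f_def set_conv_nth)
  have "is_cycle_copy l dir V E (f c)" if c: "c < m" for c
    unfolding is_cycle_copy_def
  proof (intro conjI allI impI)
    show "inj_on (f c) {0..<l}" using dist[OF c] len[OF c] by (auto simp: f_def inj_on_def nth_eq_iff_index_eq)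
    show "f c ` {0..<l} \<subseteq> V" using im[OF c] cover c by auto
    fix i j assume "cycle_edge l dir i j"
    then obtain k where k: "k < l" "(dir k \<and> i = k \<and> j = (k + 1) mod l) \<or> (\<not> dir k \<and> i = (k + 1) mod l \<and> j = k)"
      unfolding cycle_edge_def by blast
    have "arc E (dir k) ((cyc c @ [hd (cyc c)]) ! k) ((cyc c @ [hd (cyc c)]) ! Suc k)"
      using path[OF c] k(1) unfolding wpath_def by simp
    moreover have "(cyc c @ [hd (cyc c)]) ! k = f c k" using k(1) len[OF c] by (simp add: f_def nth_append)
    moreover have "(cyc c @ [hd (cyc c)]) ! Suc k = f c ((k + 1) mod l)"
    proof (cases "Suc k = l")
      case True
      then have "cyc c \<noteq> []" using len[OF c] by auto
      then show ?thesis using True len[OF c] by (simp add: f_def nth_append hd_conv_nth)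
    next
      case False
      then show ?thesis using k(1) len[OF c] by (simp add: f_def nth_append)
    qed
    ultimately show "E (f c i) (f c j)" using k(2) by (auto simp: arc_def)
  qed
  moreover have "f c ` {0..<l} \<inter> f c' ` {0..<l} = {}" if "c < m" "c' < m" "f c \<noteq> f c'" for c c'
    using that disj[of c c'] im by auto
  moreover have "(\<Union>g\<in>f ` {..<m}. g ` {0..<l}) = V" using cover im by auto
  ultimately show ?thesis unfolding has_cycle_factor_def by (intro exI[of _ "f ` {..<m}"]) auto
qed

text \<open>The dominating pairs are prescribed in advance, as their rejections were balanced
  jointly. A new gadget must therefore avoid the earlier gadgets and also the pairs of all other
  gadgets, which the third clause of the induction records.\<close>

lemma gadget_family:
  fixes e :: real and K k :: nat
  defines "R \<equiv> 2 * (K * (k - 1)) + 1"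
  assumes as: "asymp E" and fin: "finite V" and r: "rich E e V V" and e: "0 < e" "e \<le> 1/8"
    and K: "16 / e^2 + 2 \<le> K" and p: "length p = K" and n: "real (2 * K) \<le> e^2/32 * card V" and k: "1 \<le> k"
    and D: "\<And>g. g < z \<Longrightarrow> D g \<subseteq> V \<and> D' g \<subseteq> V \<and> card (D g) = k \<and> card (D' g) = k \<and> D g \<inter> D' g = {}"
    and disj: "\<And>g h. g < z \<Longrightarrow> h < z \<Longrightarrow> g \<noteq> h \<Longrightarrow> (D g \<union> D' g) \<inter> (D h \<union> D' h) = {}"
    and Zb: "z * (R * (K + 4)) + z * (2 * k) + R * (2 * K + 8) \<le> e/2 * card V"
    and big: "2 * 4 ^ R * R \<le> card V"
  shows "\<exists>as bs F. (\<forall>g<z. is_gadget E V (s # t # p @ [d]) R (R * (K + 2) - 1)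
        (\<lambda>v. \<not> rejects E (\<not> s) t (D g) (D' g) v) (as g) (bs g) (F g)) \<and>
      (\<forall>g<z. \<forall>h<z. g \<noteq> h \<longrightarrow> set (as g @ bs g @ F g) \<inter> set (as h @ bs h @ F h) = {})"
proof -
  have "\<exists>as bs F. (\<forall>g<n. is_gadget E V (s # t # p @ [d]) R (R * (K + 2) - 1)
        (\<lambda>v. \<not> rejects E (\<not> s) t (D g) (D' g) v) (as g) (bs g) (F g)) \<and>
      (\<forall>g<n. \<forall>h<n. g \<noteq> h \<longrightarrow> set (as g @ bs g @ F g) \<inter> set (as h @ bs h @ F h) = {}) \<and>
      (\<forall>g<n. \<forall>h<z. g \<noteq> h \<longrightarrow> set (as g @ bs g @ F g) \<inter> (D h \<union> D' h) = {})" if "n \<le> z" for n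
    using that
  proof (induction n)
    case (Suc n)
    then have nz: "n < z" by simp
    from Suc.IH[OF less_imp_le[OF nz]] obtain as bs F where
      IH1: "\<forall>g<n. is_gadget E V (s # t # p @ [d]) R (R * (K + 2) - 1)
        (\<lambda>v. \<not> rejects E (\<not> s) t (D g) (D' g) v) (as g) (bs g) (F g)"
      and IH2: "\<forall>g<n. \<forall>h<n. g \<noteq> h \<longrightarrow> set (as g @ bs g @ F g) \<inter> set (as h @ bs h @ F h) = {}"
      and IH3: "\<forall>g<n. \<forall>h<z. g \<noteq> h \<longrightarrow> set (as g @ bs g @ F g) \<inter> (D h \<union> D' h) = {}"
      by (elim exE conjE) (rule that)
    define G where "G = (\<lambda>g. set (as g @ bs g @ F g))"
    define Z where "Z = (\<Union>g<n. G g) \<union> (\<Union>h\<in>{..<z} - {n}. D h \<union> D' h)"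
    have GV: "G g \<subseteq> V" if "g < n" for g using IH1 that by (simp add: is_gadget_def G_def)
    have ZV: "Z \<subseteq> V" unfolding Z_def using GV D by (intro Un_least UN_least) auto
    have cG: "card (G g) \<le> R * (K + 4)" if "g < n" for g
    proof -
      have "length (as g @ bs g @ F g) \<le> R * (K + 4)"
        using IH1 that by (simp add: is_gadget_def algebra_simps)
      then show ?thesis using card_length[of "as g @ bs g @ F g"] unfolding G_def by linarith
    qed
    have "card (\<Union>g<n. G g) \<le> (\<Sum>g<n. card (G g))" by (rule card_UN_le) simp
    also have "\<dots> \<le> (\<Sum>g<n. R * (K + 4))" using cG by (intro sum_mono) auto
    also have "\<dots> \<le> z * (R * (K + 4))" using nz by (simp add: mult_le_mono1)
    finally have c1: "card (\<Union>g<n. G g) \<le> z * (R * (K + 4))" .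
    have "card (\<Union>h\<in>{..<z} - {n}. D h \<union> D' h) \<le> (\<Sum>h\<in>{..<z} - {n}. card (D h \<union> D' h))"
      by (rule card_UN_le) simp
    also have "\<dots> \<le> (\<Sum>h\<in>{..<z} - {n}. 2 * k)"
    proof (rule sum_mono)
      fix h assume "h \<in> {..<z} - {n}"
      then show "card (D h \<union> D' h) \<le> 2 * k" using D[of h] card_Un_le[of "D h" "D' h"] by auto
    qed
    also have "\<dots> \<le> z * (2 * k)" using nz by (simp add: card_Diff_singleton_if)
    finally have c2: "card (\<Union>h\<in>{..<z} - {n}. D h \<union> D' h) \<le> z * (2 * k)" .
    have "card Z + R * (2 * K + 8) \<le> z * (R * (K + 4)) + z * (2 * k) + R * (2 * K + 8)"
      using c1 c2 card_Un_le[of "\<Union>g<n. G g" "\<Union>h\<in>{..<z} - {n}. D h \<union> D' h"] unfolding Z_def by linarith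
    then have cZ: "real (card Z + R * (2 * K + 8)) \<le> e/2 * card V" using Zb by linarith
    have Zdisj: "Z \<inter> (D n \<union> D' n) = {}"
    proof -
      have "G g \<inter> (D n \<union> D' n) = {}" if "g < n" for g using IH3 that nz by (auto simp: G_def)
      moreover have "(D h \<union> D' h) \<inter> (D n \<union> D' n) = {}" if "h \<in> {..<z} - {n}" for h using disj[of h n] that nz by simp
      ultimately show ?thesis unfolding Z_def by blast
    qed
    have Dn: "D n \<subseteq> V" "card (D n) = k" "D' n \<subseteq> V" "card (D' n) = k" "D n \<inter> D' n = {}" using D[OF nz] by auto
    from gadget[OF as fin r e K p n Dn k ZV Zdisj cZ[unfolded R_def] big[unfolded R_def], where s = s and t = t and d = d,
        folded R_def]
    obtain a b f where abf: "is_gadget E V (s # t # p @ [d]) R (R * (K + 2) - 1)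
        (\<lambda>v. \<not> rejects E (\<not> s) t (D n) (D' n) v) a b f" "set (a @ b @ f) \<inter> Z = {}"
      by (elim exE conjE) (rule that)
    define as' where "as' = as(n := a)"
    define bs' where "bs' = bs(n := b)"
    define F' where "F' = F(n := f)"
    have old: "as' g = as g" "bs' g = bs g" "F' g = F g" if "g < n" for g
      using that by (auto simp: as'_def bs'_def F'_def)
    have new: "as' n = a" "bs' n = b" "F' n = f" by (auto simp: as'_def bs'_def F'_def)
    have nG: "set (a @ b @ f) \<inter> G g = {}" if "g < n" for g using abf(2) that unfolding Z_def by blast
    have nD: "set (a @ b @ f) \<inter> (D h \<union> D' h) = {}" if "h < z" "h \<noteq> n" for h
      using abf(2) that unfolding Z_def by blast
    have "is_gadget E V (s # t # p @ [d]) R (R * (K + 2) - 1)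
        (\<lambda>v. \<not> rejects E (\<not> s) t (D g) (D' g) v) (as' g) (bs' g) (F' g)" if "g < Suc n" for g
    proof (cases "g = n")
      case True
      then show ?thesis using abf(1) new by simp
    next
      case False
      then have "g < n" using that by simp
      then show ?thesis using IH1 old by simp
    qed
    moreover have "set (as' g @ bs' g @ F' g) \<inter> set (as' h @ bs' h @ F' h) = {}"
      if gh: "g < Suc n" "h < Suc n" "g \<noteq> h" for g h
    proof -
      consider "g < n" "h < n" | "g = n" "h < n" | "g < n" "h = n" using gh by linarith
      then show ?thesis
      proof cases
        case 1 then show ?thesis using IH2 old gh by simp
      next
        case 2 then show ?thesis using nG[of h] old new by (simp only: G_def)
      next
        case 3 then show ?thesis using nG[of g] old new by (simp only: G_def Int_commute)
      qed
    qed
    moreover have "set (as' g @ bs' g @ F' g) \<inter> (D h \<union> D' h) = {}" if gh: "g < Suc n" "h < z" "g \<noteq> h" for g h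
    proof (cases "g = n")
      case True then show ?thesis using nD[of h] new gh by simp
    next
      case False
      then have "g < n" using gh by simp
      then show ?thesis using IH3 old gh by simp
    qed
    ultimately show ?case by (intro exI[of _ as'] exI[of _ bs'] exI[of _ F'] conjI allI impI)
  qed simp
  from this[OF order_refl] show ?thesis by (elim exE conjE) (intro exI conjI; assumption)
qed

lemma wpath_blocks:
  assumes "\<And>i. i < n \<Longrightarrow> wpath E (w i) (h i # b i @ [h (Suc i)])"
  shows "wpath E (concat (map w [0..<n])) (h 0 # concat (map (\<lambda>i. b i @ [h (Suc i)]) [0..<n]))"
    and "last (h 0 # concat (map (\<lambda>i. b i @ [h (Suc i)]) [0..<n])) = h n"
proof -
  have "wpath E (concat (map w [0..<n])) (h 0 # concat (map (\<lambda>i. b i @ [h (Suc i)]) [0..<n])) \<and>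
    last (h 0 # concat (map (\<lambda>i. b i @ [h (Suc i)]) [0..<n])) = h n"
    using assms
  proof (induction n)
    case (Suc n)
    then have 1: "wpath E (concat (map w [0..<n])) (h 0 # concat (map (\<lambda>i. b i @ [h (Suc i)]) [0..<n]))"
      "last (h 0 # concat (map (\<lambda>i. b i @ [h (Suc i)]) [0..<n])) = h n" by auto
    have "wpath E (w n) (last (h 0 # concat (map (\<lambda>i. b i @ [h (Suc i)]) [0..<n])) # b n @ [h (Suc n)])"
      using Suc.prems[of n] 1(2) by simp
    from wpath_join[OF 1(1) this] show ?case by simp
  qed simp
  then show "wpath E (concat (map w [0..<n])) (h 0 # concat (map (\<lambda>i. b i @ [h (Suc i)]) [0..<n]))"
    and "last (h 0 # concat (map (\<lambda>i. b i @ [h (Suc i)]) [0..<n])) = h n" by auto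
qed

lemma concat_chunks:
  "length u = n * k \<Longrightarrow> concat (map (\<lambda>i. take k (drop (i * k) u)) [0..<n]) = u"
proof (induction n arbitrary: u)
  case (Suc n)
  let ?v = "take (n * k) u"
  have "concat (map (\<lambda>i. take k (drop (i * k) ?v)) [0..<n]) = ?v" using Suc by (intro Suc.IH) simp
  moreover have "map (\<lambda>i. take k (drop (i * k) ?v)) [0..<n] = map (\<lambda>i. take k (drop (i * k) u)) [0..<n]"
  proof (rule map_cong[OF refl])
    fix i assume "i \<in> set [0..<n]"
    then have "Suc i * k \<le> n * k" by (intro mult_le_mono1) simp
    then show "take k (drop (i * k) ?v) = take k (drop (i * k) u)"
      by (simp add: drop_take min_def)
  qed
  ultimately show ?case using Suc.prems by simp
qed simp

lemma distinct_concat_mapD: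
  assumes "distinct (concat (map f [0..<m]))"
  shows "c < m \<Longrightarrow> distinct (f c)" and "c < m \<Longrightarrow> c' < m \<Longrightarrow> c \<noteq> c' \<Longrightarrow> set (f c) \<inter> set (f c') = {}"
proof -
  have "(\<forall>c<m. distinct (f c)) \<and> (\<forall>c<m. \<forall>c'<c. set (f c) \<inter> set (f c') = {})"
    using assms
  proof (induction m)
    case (Suc m)
    then have "distinct (concat (map f [0..<m]))" "distinct (f m)" "(\<Union>c<m. set (f c)) \<inter> set (f m) = {}"
      by (auto simp: lessThan_atLeast0)
    then show ?case using Suc.IH by (auto simp: less_Suc_eq)
  qed simp
  then have 1: "\<And>c. c < m \<Longrightarrow> distinct (f c)" and 2: "\<And>c c'. c < m \<Longrightarrow> c' < c \<Longrightarrow> set (f c) \<inter> set (f c') = {}" by auto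
  show "c < m \<Longrightarrow> distinct (f c)" by (rule 1)
  show "c < m \<Longrightarrow> c' < m \<Longrightarrow> c \<noteq> c' \<Longrightarrow> set (f c) \<inter> set (f c') = {}"
    using 2[of c c'] 2[of c' c] by (cases c c' rule: linorder_cases) auto
qed

text \<open>Pigeonhole: \<open>m * n\<close> list positions covering \<open>m * n\<close> elements
  leave no room for repetition. Disjointness thus follows from a count and need not be followed
  through the rearrangement.\<close>

lemma exact_cover:
  assumes "finite X" "\<And>c. c < m \<Longrightarrow> length (f c) = n" "X \<subseteq> (\<Union>c<m. set (f c))" "card X = m * n"
  shows "(\<Union>c<m. set (f c)) = X" and "c < m \<Longrightarrow> distinct (f c)"
    and "c < m \<Longrightarrow> c' < m \<Longrightarrow> c \<noteq> c' \<Longrightarrow> set (f c) \<inter> set (f c') = {}"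
proof -
  let ?xs = "concat (map f [0..<m])"
  have set: "set ?xs = (\<Union>c<m. set (f c))" by (auto simp: lessThan_atLeast0)
  have "length ?xs = (\<Sum>c<m. length (f c))"
    by (simp add: length_concat o_def interv_sum_list_conv_sum_set_nat atLeast0LessThan)
  also have "\<dots> = m * n" using assms(2) by simp
  finally have len: "length ?xs = card X" using assms(4) by simp
  have le: "card X \<le> card (set ?xs)" using assms(3) set by (intro card_mono) auto
  then have c: "card (set ?xs) = length ?xs" using len card_length[of ?xs] by linarith
  then have d: "distinct ?xs" by (rule card_distinct)
  show "(\<Union>c<m. set (f c)) = X"
    using card_subset_eq[of "set ?xs" X] assms(3) set c len by auto
  show "c < m \<Longrightarrow> distinct (f c)" by (rule distinct_concat_mapD(1)[OF d])
  show "c < m \<Longrightarrow> c' < m \<Longrightarrow> c \<noteq> c' \<Longrightarrow> set (f c) \<inter> set (f c') = {}"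
    by (rule distinct_concat_mapD(2)[OF d])
qed

text \<open>The zone of a cycle consists of \<open>\<beta>\<close> blocks of \<open>t1\<close>
  letters. A block used for absorption starts with a strand of \<open>K + 3\<close> letters and ends
  with a link of \<open>K\<close> letters to the next block; any other block is a single link.
  \<open>Uz\<close>, \<open>hA\<close> and \<open>eA\<close> are fixed before \<open>L\<close> is
  known: \<open>L\<close> affects only the interiors of strands.\<close>

lemma zone:
  fixes e :: real and K k z m \<beta> :: nat
  defines "R \<equiv> 2 * (K * (k - 1)) + 1" and "t1 \<equiv> 2 * K + 3"
  assumes as: "asymp E" and fin: "finite V" and r: "rich E e V V" and e: "0 < e" "e \<le> 1/8"
    and K: "16 / e^2 + 2 \<le> K" and p: "length p = K" and u: "length u = \<beta> * t1"
    and S: "S \<subseteq> {..<\<beta>}" "\<forall>i\<in>S. take (K + 3) (drop (i * t1) u) = s # t # p @ [d]"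
    and zR: "z * R \<le> m * card S" and k: "1 \<le> k" and dom: "16 * (k * z) \<le> card V"
    and rej1: "2 * (4 * (3/4)^k * card V) \<le> z" and rej2: "(card V * (1 + 4 * (3/4)^k) ^ z)^2 \<le> (2::real) ^ z"
    and n: "t1 \<le> e^2/32 * card V" and size: "2 * (m * (\<beta> * t1 + 1)) + R * (2 * K + 8) \<le> e/2 * card V"
    and big: "2 * 4 ^ R * R \<le> card V"
  shows "\<exists>hA eA Uz. Uz \<subseteq> V \<and> card Uz + z = m * (\<beta> * t1 + 1) \<and> (\<forall>c<m. hA c \<in> V \<and> eA c \<in> V) \<and>
    (\<forall>L. L \<subseteq> V - Uz \<longrightarrow> card L = z \<longrightarrow>
      (\<exists>zl. (\<forall>c<m. wpath E u (zl c) \<and> hd (zl c) = hA c \<and> last (zl c) = eA c \<and> distinct (zl c)) \<and>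
        (\<forall>c<m. \<forall>c'<m. c \<noteq> c' \<longrightarrow> set (zl c) \<inter> set (zl c') = {}) \<and> (\<Union>c<m. set (zl c)) = Uz \<union> L))"
proof -
  have K2: "2 \<le> K"
  proof -
    have "16 / e^2 > 0" using e by simp
    then have "2 < real K" using K by linarith
    then show ?thesis by simp
  qed
  have R1: "1 \<le> R" by (simp add: R_def)
  have kR: "k \<le> R" using K2 k by (cases k) (auto simp: R_def)
  have "0 < 2 * 4 ^ R * R" using R1 by simp
  then have "0 < card V" using big by linarith
  then have Vne: "V \<noteq> {}" by auto
  have cS: "card S \<le> \<beta>" using card_mono[OF _ S(1)] by simp
  have zRb: "z * R \<le> m * \<beta>" using zR cS by (meson le_trans mult_le_mono2)
  have e16: "e/2 * card V \<le> card V" using e by (intro mult_left_le_one_le) auto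
  define acc where "acc = (\<lambda>D D' v. \<not> rejects E (\<not> s) t D D' v)"
  from dominators[OF fin r e(1) dom Vne, where s = "\<not> s" and t = t] obtain D D' where
    D: "\<forall>g<z. D g \<subseteq> V \<and> D' g \<subseteq> V \<and> card (D g) = k \<and> card (D' g) = k \<and> D g \<inter> D' g = {} \<and>
       real (card {v \<in> V. rejects E (\<not> s) t (D g) (D' g) v}) \<le> 4 * (3/4)^k * card V"
    and Ddisj: "\<forall>g<z. \<forall>h<z. g \<noteq> h \<longrightarrow> (D g \<union> D' g) \<inter> (D h \<union> D' h) = {}"
    and pot: "(\<Sum>v\<in>V. 2 ^ card {g. g < z \<and> rejects E (\<not> s) t (D g) (D' g) v}) \<le> card V * (1 + 4 * (3/4)^k) ^ z"
    by (elim exE conjE) (rule that)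
  have few: "2 * card {g. g < z \<and> \<not> acc (D g) (D' g) v} \<le> z" if v: "v \<in> V" for v
  proof (rule ccontr)
    let ?r = "card {g. g < z \<and> rejects E (\<not> s) t (D g) (D' g) v}"
    assume "\<not> ?thesis"
    \<comment> \<open>If more than half of the pairs rejected \<open>v\<close>, its weight
      \<open>2 ^ ?r\<close> alone would exceed the bound on the total weight, by
      \<open>rej2\<close>.\<close>
    then have "z + 1 \<le> 2 * ?r" by (simp add: acc_def)
    then have "(2::real) ^ (z + 1) \<le> 2 ^ (2 * ?r)" by (intro power_increasing) auto
    also have "\<dots> = (2 ^ ?r)^2" by (simp add: power_mult[symmetric] mult.commute)
    also have "\<dots> \<le> (card V * (1 + 4 * (3/4)^k) ^ z)^2"
    proof (rule power_mono)
      have "(2::real) ^ ?r \<le> (\<Sum>v\<in>V. 2 ^ card {g. g < z \<and> rejects E (\<not> s) t (D g) (D' g) v})"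
        by (rule member_le_sum[OF v]) (use fin in auto)
      then show "(2::real) ^ ?r \<le> card V * (1 + 4 * (3/4)^k) ^ z" using pot by linarith
    qed simp
    also have "\<dots> \<le> 2 ^ z" by (rule rej2)
    finally show False by simp
  qed
  have sizes: "m * (\<beta> * (K + 4)) + m * (2 * \<beta>) + R * (2 * K + 8) \<le> 2 * (m * (\<beta> * t1 + 1)) + R * (2 * K + 8)"
    by (simp add: t1_def algebra_simps)
  have zz: "z * (R * (K + 4)) \<le> m * (\<beta> * (K + 4))" "z * (2 * k) \<le> m * (2 * \<beta>)"
  proof -
    show "z * (R * (K + 4)) \<le> m * (\<beta> * (K + 4))"
      using mult_le_mono1[OF zRb, of "K + 4"] by (simp only: mult.assoc)
    have "z * k \<le> z * R" using kR by (rule mult_le_mono2)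
    then have "z * k \<le> m * \<beta>" using zRb by linarith
    then show "z * (2 * k) \<le> m * (2 * \<beta>)" by simp
  qed
  have "z * (R * (K + 4)) + z * (2 * k) + R * (2 * K + 8) \<le> 2 * (m * (\<beta> * t1 + 1)) + R * (2 * K + 8)"
    using sizes zz by linarith
  from of_nat_mono[OF this, where 'a = real]
  have Zb: "real (z * (R * (K + 4)) + z * (2 * k) + R * (2 * K + 8)) \<le> e/2 * card V" using size by linarith
  have n2: "real (2 * K) \<le> e^2/32 * card V" using n by (simp add: t1_def)
  have D1: "D g \<subseteq> V \<and> D' g \<subseteq> V \<and> card (D g) = k \<and> card (D' g) = k \<and> D g \<inter> D' g = {}" if "g < z" for g
    using D that by blast
  have D2: "(D g \<union> D' g) \<inter> (D h \<union> D' h) = {}" if "g < z" "h < z" "g \<noteq> h" for g h using Ddisj that by blast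
  have "\<exists>A Bs F. (\<forall>g<z. is_gadget E V (s # t # p @ [d]) R (R * (K + 2) - 1)
        (\<lambda>v. \<not> rejects E (\<not> s) t (D g) (D' g) v) (A g) (Bs g) (F g)) \<and>
      (\<forall>g<z. \<forall>h<z. g \<noteq> h \<longrightarrow> set (A g @ Bs g @ F g) \<inter> set (A h @ Bs h @ F h) = {})"
    unfolding R_def
    by (rule gadget_family[where D = D and D' = D' and z = z, OF as fin r e K p n2 k D1 D2 Zb[unfolded R_def] big[unfolded R_def]])
  then obtain A Bs F where gad: "\<forall>g<z. is_gadget E V (s # t # p @ [d]) R (R * (K + 2) - 1)
        (\<lambda>v. \<not> rejects E (\<not> s) t (D g) (D' g) v) (A g) (Bs g) (F g)"
    and gdisj: "\<forall>g<z. \<forall>h<z. g \<noteq> h \<longrightarrow> set (A g @ Bs g @ F g) \<inter> set (A h @ Bs h @ F h) = {}"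
    by (elim exE conjE) (rule that)
  define G where "G = (\<lambda>g. set (A g @ Bs g @ F g))"
  define GG where "GG = (\<Union>g<z. G g)"
  have GV: "G g \<subseteq> V" if "g < z" for g using gad that by (simp add: is_gadget_def G_def)
  then have GGV: "GG \<subseteq> V" by (auto simp: GG_def)
  have gl: "length (A g) = R" "length (Bs g) = R" if "g < z" for g using gad that by (simp_all add: is_gadget_def)
  have cG: "card (G g) + 1 = R * (K + 4)" if "g < z" for g
  proof -
    have d: "distinct (A g @ Bs g @ F g)" and l: "length (F g) = R * (K + 2) - 1"
      using gad that by (simp_all add: is_gadget_def)
    have "1 \<le> R * (K + 2)" using R1 by simp
    then have "length (A g @ Bs g @ F g) + 1 = R * (K + 4)" using gl[OF that] l by (simp add: algebra_simps)
    then show ?thesis using distinct_card[OF d] by (simp add: G_def)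
  qed
  have cGG: "card GG + z = z * (R * (K + 4))"
  proof -
    have "card GG = (\<Sum>g<z. card (G g))"
      unfolding GG_def using gdisj by (intro card_UN_disjoint) (auto simp: G_def)
    then have "card GG + z = (\<Sum>g<z. card (G g) + 1)" by (simp only: sum.distrib) simp
    also have "\<dots> = (\<Sum>g<z. R * (K + 4))" using cG by (intro sum.cong) auto
    finally show ?thesis by simp
  qed
  define Blk where "Blk = {..<m} \<times> {..<\<beta>}"
  \<comment> \<open>Strand \<open>i\<close> of gadget \<open>g\<close> goes into the window
    \<open>win (g, i)\<close>. Strands of one gadget may land in different cycles, as only their
    word matters.\<close>
  have "\<exists>f. f ` ({..<z} \<times> {..<R}) \<subseteq> {..<m} \<times> S \<and> inj_on f ({..<z} \<times> {..<R})"
    using zR finite_subset[OF S(1)] by (intro card_le_inj) (auto simp: card_cartesian_product)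
  then obtain win where win: "win ` ({..<z} \<times> {..<R}) \<subseteq> {..<m} \<times> S" "inj_on win ({..<z} \<times> {..<R})" by blast
  define WB where "WB = win ` ({..<z} \<times> {..<R})"
  define wi where "wi = inv_into ({..<z} \<times> {..<R}) win"
  have wi1: "wi (win (g, i)) = (g, i)" if "g < z" "i < R" for g i
    unfolding wi_def using win(2) that by (intro inv_into_f_f) auto
  have wi2: "wi b \<in> {..<z} \<times> {..<R}" if "b \<in> WB" for b
    using that unfolding wi_def WB_def by (rule inv_into_into)
  have WBS: "WB \<subseteq> {..<m} \<times> S" using win by (simp add: WB_def)
  then have WBB: "WB \<subseteq> Blk" using S(1) by (auto simp: Blk_def)
  have finWB: "finite WB" by (simp add: WB_def)
  have cWB: "card WB = z * R" unfolding WB_def using win(2) by (simp add: card_image card_cartesian_product)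
  \<comment> \<open>These starts need fresh vertices. The range includes \<open>\<beta>\<close>,
    since the last vertex of each zone starts no block but still has to be chosen.\<close>
  define AB where "AB = {..<m} \<times> {..\<beta>} - WB"
  have finAB: "finite AB" by (simp add: AB_def)
  have cAB: "card AB + z * R = m * (\<beta> + 1)"
  proof -
    have sub: "WB \<subseteq> {..<m} \<times> {..\<beta>}" using WBB by (auto simp: Blk_def)
    have "card AB = card ({..<m} \<times> {..\<beta>}) - card WB" unfolding AB_def by (rule card_Diff_subset[OF finWB sub])
    moreover have "card WB \<le> card ({..<m} \<times> {..\<beta>})" by (rule card_mono[OF _ sub]) simp
    ultimately show ?thesis using cWB by (simp add: card_cartesian_product)
  qed
  have szn: "2 * (m * (\<beta> * t1 + 1)) + R * (2 * K + 8) \<le> card V" using size e16 by linarith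
  have "m * (\<beta> * (K + 4)) + m * (\<beta> + 1) \<le> 2 * (m * (\<beta> * t1 + 1))" by (simp add: t1_def algebra_simps)
  then have "card GG + card AB \<le> card V" using cGG cAB zz(1) szn by linarith
  then have "card AB \<le> card (V - GG)" using GGV fin by (simp add: card_Diff_subset finite_subset)
  then obtain an where an: "an ` AB \<subseteq> V - GG" "inj_on an AB"
    using card_le_inj[OF finAB, of "V - GG"] fin by auto
  \<comment> \<open>A block starts at \<open>h\<close>, and its link leaves from \<open>ee\<close>:
    the two ends of the strand in a window, one and the same anchor otherwise.\<close>
  define h where "h = (\<lambda>b. if b \<in> WB then A (fst (wi b)) ! snd (wi b) else an b)"
  define ee where "ee = (\<lambda>b. if b \<in> WB then Bs (fst (wi b)) ! snd (wi b) else an b)"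
  define W where "W = (\<lambda>i. take t1 (drop (i * t1) u))"
  define gw where "gw = (\<lambda>b. if b \<in> WB then drop (K + 3) (W (snd b)) else W (snd b))"
  have mem: "A g ! i \<in> G g" "Bs g ! i \<in> G g" if "g < z" "i < R" for g i
    using gl[OF that(1)] that(2) by (auto simp: G_def)
  have hV: "h b \<in> V" "ee b \<in> V" if "b \<in> {..<m} \<times> {..\<beta>}" for b
  proof -
    have "h b \<in> V \<and> ee b \<in> V"
    proof (cases "b \<in> WB")
      case True
      then show ?thesis using wi2[OF True] mem[of "fst (wi b)" "snd (wi b)"] GV[of "fst (wi b)"]
        by (auto simp: h_def ee_def)
    next
      case False
      then have "b \<in> AB" using that by (simp add: AB_def)
      then show ?thesis using an(1) False by (auto simp: h_def ee_def)
    qed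
    then show "h b \<in> V" "ee b \<in> V" by auto
  qed
  have lW: "length (W i) = t1" if "i < \<beta>" for i
  proof -
    have "Suc i * t1 \<le> \<beta> * t1" using that by (intro mult_le_mono1) simp
    then show ?thesis using u by (simp add: W_def)
  qed
  have lgw: "length (gw b) = (if b \<in> WB then K else t1)" if "b \<in> Blk" for b
    using lW[of "snd b"] that by (auto simp: gw_def Blk_def t1_def)
  have "\<exists>gap. (\<forall>b\<in>Blk. length (gap b) = length (gw b) - 1 \<and> distinct (gap b) \<and> set (gap b) \<subseteq> V - (GG \<union> an ` AB) \<and>
      wpath E (gw b) (ee b # gap b @ [h (fst b, Suc (snd b))])) \<and>
      (\<forall>i\<in>Blk. \<forall>j\<in>Blk. i \<noteq> j \<longrightarrow> set (gap i) \<inter> set (gap j) = {})"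
  proof (rule fill_gaps[OF as fin order_refl r e])
    show "finite Blk" by (simp add: Blk_def)
    fix b assume b: "b \<in> Blk"
    show "ee b \<in> V" using b by (intro hV) (auto simp: Blk_def)
    show "h (fst b, Suc (snd b)) \<in> V" using b by (intro hV) (auto simp: Blk_def)
    have "K \<le> length (gw b)" "length (gw b) \<le> t1" using lgw[OF b] by (auto simp: t1_def)
    from of_nat_mono[OF this(1), where 'a = real] of_nat_mono[OF this(2), where 'a = real]
    show "16 / e^2 + 2 \<le> length (gw b)" "length (gw b) \<le> e^2/32 * card V" using K n by linarith+
  next
    have "(\<Sum>b\<in>Blk. length (gw b)) \<le> (\<Sum>b\<in>Blk. t1)" using lgw by (intro sum_mono) (auto simp: t1_def)
    then have 1: "(\<Sum>b\<in>Blk. length (gw b)) \<le> m * \<beta> * t1" by (simp add: Blk_def card_cartesian_product)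
    have "finite (GG \<union> an ` AB)" using GGV fin finAB by (auto intro: finite_subset)
    then have "card ((GG \<union> an ` AB) \<inter> V) \<le> card (GG \<union> an ` AB)" by (intro card_mono) auto
    also have "\<dots> \<le> card GG + card (an ` AB)" by (rule card_Un_le)
    also have "card (an ` AB) \<le> card AB" by (rule card_image_le[OF finAB])
    finally have 2: "card ((GG \<union> an ` AB) \<inter> V) \<le> m * (\<beta> * (K + 4)) + m * (\<beta> + 1)" using cGG cAB zz(1) by linarith
    obtain K' where "K = 2 + K'" using K2 le_Suc_ex by blast
    then have "m * \<beta> * t1 + (m * (\<beta> * (K + 4)) + m * (\<beta> + 1)) \<le> 2 * (m * (\<beta> * t1 + 1))"
      by (simp add: t1_def algebra_simps)
    then have "card ((GG \<union> an ` AB) \<inter> V) + (\<Sum>b\<in>Blk. length (gw b)) \<le> 2 * (m * (\<beta> * t1 + 1)) + R * (2 * K + 8)"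
      using 1 2 by linarith
    from of_nat_mono[OF this, where 'a = real]
    show "real (card ((GG \<union> an ` AB) \<inter> V) + (\<Sum>b\<in>Blk. length (gw b))) \<le> e/2 * card V" using size by linarith
  qed
  then obtain gap where
    gap: "\<forall>b\<in>Blk. length (gap b) = length (gw b) - 1 \<and> distinct (gap b) \<and> set (gap b) \<subseteq> V - (GG \<union> an ` AB) \<and>
      wpath E (gw b) (ee b # gap b @ [h (fst b, Suc (snd b))])"
    and gapdisj: "\<forall>i\<in>Blk. \<forall>j\<in>Blk. i \<noteq> j \<longrightarrow> set (gap i) \<inter> set (gap j) = {}"
    by (elim exE conjE) (rule that)
  define GP where "GP = (\<Union>b\<in>Blk. set (gap b))"
  define Uz where "Uz = GG \<union> an ` AB \<union> GP"
  have finB: "finite Blk" "card Blk = m * \<beta>" by (auto simp: Blk_def card_cartesian_product)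
  have fins: "finite GG" "finite (an ` AB)" "finite GP"
    using GGV fin finAB finB by (auto simp: GP_def intro: finite_subset)
  have GPV: "GP \<subseteq> V - (GG \<union> an ` AB)" using gap unfolding GP_def by blast
  have UzV: "Uz \<subseteq> V" using GGV an(1) GPV by (auto simp: Uz_def)
  have cGP: "card GP + card Blk = z * R * K + (m * \<beta> - z * R) * t1"
  proof -
    have "card GP = (\<Sum>b\<in>Blk. card (set (gap b)))"
      unfolding GP_def using finB gapdisj by (intro card_UN_disjoint) auto
    then have "card GP + card Blk = (\<Sum>b\<in>Blk. card (set (gap b)) + 1)" by (simp only: sum.distrib) simp
    also have "\<dots> = (\<Sum>b\<in>Blk. if b \<in> WB then K else t1)"
    proof (rule sum.cong[OF refl])
      fix b assume b: "b \<in> Blk"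
      have "card (set (gap b)) = length (gw b) - 1" using gap b by (simp add: distinct_card)
      then show "card (set (gap b)) + 1 = (if b \<in> WB then K else t1)" using lgw[OF b] K2 by (auto simp: t1_def)
    qed
    also have "\<dots> = (\<Sum>b\<in>WB. K) + (\<Sum>b\<in>Blk - WB. t1)"
      using finB(1) WBB by (simp add: sum.If_cases Int_absorb1 Diff_eq[symmetric] del: sum_constant)
    also have "\<dots> = z * R * K + (m * \<beta> - z * R) * t1"
      using cWB finB WBB finWB by (simp add: card_Diff_subset)
    finally show ?thesis .
  qed
  have cUz: "card Uz + z = m * (\<beta> * t1 + 1)"
  proof -
    have "card Uz = card GG + card (an ` AB) + card GP"
      unfolding Uz_def using fins an(1) GPV by (subst card_Un_disjoint, auto)+
    also have "card (an ` AB) = card AB" using an(2) by (rule card_image)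
    finally have c: "card Uz = card GG + card AB + card GP" .
    obtain y where y: "m * \<beta> = z * R + y" using zRb le_Suc_ex by blast
    have "card Uz + z + m * \<beta> = z * (R * (K + 4)) + card AB + (z * R * K + y * t1)"
      using c cGG cGP finB y by simp
    moreover have "card AB = y + m" using cAB y by simp
    ultimately have "card Uz + z + m * \<beta> = z * R * (2 * K + 4) + y + m + y * t1" by (simp add: algebra_simps)
    moreover have "m * (\<beta> * t1 + 1) + m * \<beta> = (z * R + y) * t1 + m + (z * R + y)"
      unfolding y[symmetric] by (simp add: algebra_simps)
    ultimately show ?thesis by (simp add: t1_def algebra_simps)
  qed
  have main: "\<exists>zl. (\<forall>c<m. wpath E u (zl c) \<and> hd (zl c) = h (c, 0) \<and> last (zl c) = h (c, \<beta>) \<and> distinct (zl c)) \<and>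
        (\<forall>c<m. \<forall>c'<m. c \<noteq> c' \<longrightarrow> set (zl c) \<inter> set (zl c') = {}) \<and> (\<Union>c<m. set (zl c)) = Uz \<union> L"
    if L: "L \<subseteq> V - Uz" "card L = z" for L
  proof -
    have finL: "finite L" using L(1) fin by (auto intro: finite_subset)
    have "\<exists>f. bij_betw f {..<z} L \<and> (\<forall>g<z. acc (D g) (D' g) (f g))"
    proof (rule match_absorb[OF finL L(2)])
      show "2 * card {g. g < z \<and> \<not> acc (D g) (D' g) v} \<le> z" if "v \<in> L" for v using few[of v] that L(1) by blast
      show "2 * card {v \<in> L. \<not> acc (D g) (D' g) v} \<le> z" if g: "g < z" for g
      proof -
        have "card {v \<in> L. \<not> acc (D g) (D' g) v} \<le> card {v \<in> V. rejects E (\<not> s) t (D g) (D' g) v}"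
          using fin L(1) by (intro card_mono) (auto simp: acc_def)
        moreover have "real (card {v \<in> V. rejects E (\<not> s) t (D g) (D' g) v}) \<le> 4 * (3/4)^k * card V"
          using D g by blast
        ultimately have "2 * real (card {v \<in> L. \<not> acc (D g) (D' g) v}) \<le> z" using rej1 by linarith
        then show ?thesis by simp
      qed
    qed
    then obtain f where f: "bij_betw f {..<z} L" "\<forall>g<z. acc (D g) (D' g) (f g)" by blast
    have "\<exists>Ls. length Ls = R \<and> (\<forall>i<R. wpath E (s # t # p @ [d]) (A g ! i # Ls ! i @ [Bs g ! i])) \<and>
        mset (concat Ls) = mset (f g # F g)" if g: "g < z" for g
    proof -
      have "f g \<in> V" using f(1) g L(1) by (auto simp: bij_betw_def)
      then show ?thesis using gad g f(2) unfolding is_gadget_def acc_def by blast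
    qed
    then obtain Ls where Ls: "\<And>g. g < z \<Longrightarrow> length (Ls g) = R"
      "\<And>g i. g < z \<Longrightarrow> i < R \<Longrightarrow> wpath E (s # t # p @ [d]) (A g ! i # Ls g ! i @ [Bs g ! i])"
      "\<And>g. g < z \<Longrightarrow> mset (concat (Ls g)) = mset (f g # F g)" by metis
    define body where "body = (\<lambda>b. if b \<in> WB then Ls (fst (wi b)) ! snd (wi b) @ [ee b] @ gap b else gap b)"
    define zl where "zl = (\<lambda>c. h (c, 0) # concat (map (\<lambda>i. body (c, i) @ [h (c, Suc i)]) [0..<\<beta>]))"
    have blk: "wpath E (W i) (h (c, i) # body (c, i) @ [h (c, Suc i)])" if ci: "c < m" "i < \<beta>" for c i
    proof -
      have b: "(c, i) \<in> Blk" using ci by (simp add: Blk_def)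
      have w: "wpath E (gw (c, i)) (ee (c, i) # gap (c, i) @ [h (c, Suc i)])" using gap b by force
      show ?thesis
      proof (cases "(c, i) \<in> WB")
        case False
        then show ?thesis using w by (simp add: body_def gw_def h_def ee_def)
      next
        case True
        define g where "g = fst (wi (c, i))"
        define j where "j = snd (wi (c, i))"
        have gj: "g < z" "j < R" using wi2[OF True] by (auto simp: g_def j_def)
        have "i \<in> S" using True WBS by auto
        then have "take (K + 3) (W i) = s # t # p @ [d]" using S(2)[rule_format, of i] by (simp add: W_def t1_def min_def)
        then have Wi: "W i = (s # t # p @ [d]) @ drop (K + 3) (W i)" by (metis append_take_drop_id)
        have he: "h (c, i) = A g ! j" "ee (c, i) = Bs g ! j" using True by (simp_all add: h_def ee_def g_def j_def)
        have "wpath E ((s # t # p @ [d]) @ drop (K + 3) (W i))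
            ((A g ! j # Ls g ! j @ [Bs g ! j]) @ gap (c, i) @ [h (c, Suc i)])"
          using Ls(2)[OF gj] w True he by (intro wpath_join) (auto simp: gw_def)
        then show ?thesis using Wi he True by (simp add: body_def g_def j_def)
      qed
    qed
    have zlpath: "wpath E u (zl c)" "last (zl c) = h (c, \<beta>)" if c: "c < m" for c
    proof -
      have "wpath E (concat (map W [0..<\<beta>])) (zl c) \<and> last (zl c) = h (c, \<beta>)"
        unfolding zl_def
        using wpath_blocks[of \<beta> E W "\<lambda>i. h (c, i)" "\<lambda>i. body (c, i)"] blk[OF c] by blast
      then show "wpath E u (zl c)" "last (zl c) = h (c, \<beta>)" using concat_chunks[OF u] by (simp_all add: W_def)
    qed
    have zlh: "h (c, i) \<in> set (zl c)" if "i \<le> \<beta>" for c i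
      using that by (cases i) (auto simp: zl_def)
    have zlb: "set (body b) \<subseteq> set (zl (fst b))" if "b \<in> Blk" for b
      using that by (cases b) (auto simp: zl_def Blk_def)
    define X where "X = (\<Union>c<m. set (zl c))"
    have hX: "h b \<in> X" if "b \<in> {..<m} \<times> {..\<beta>}" for b using that zlh by (cases b) (auto simp: X_def)
    have bX: "set (body b) \<subseteq> X" if "b \<in> Blk" for b
    proof -
      have "fst b < m" using that by (auto simp: Blk_def)
      then show ?thesis using zlb[OF that] unfolding X_def by blast
    qed
    have WX: "A g ! i \<in> X \<and> Bs g ! i \<in> X \<and> set (Ls g ! i) \<subseteq> X" if gi: "g < z" "i < R" for g i
    proof -
      have b: "win (g, i) \<in> WB" using gi by (auto simp: WB_def)
      then have "win (g, i) \<in> Blk" "win (g, i) \<in> {..<m} \<times> {..\<beta>}" using WBB by (auto simp: Blk_def)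
      then show ?thesis using hX[of "win (g, i)"] bX[of "win (g, i)"] b wi1[OF gi] by (auto simp: h_def ee_def body_def)
    qed
    have GX: "G g \<union> {f g} \<subseteq> X" if g: "g < z" for g
    proof -
      have "set (concat (Ls g)) = set (f g # F g)" using Ls(3)[OF g] by (rule mset_eq_setD)
      moreover have "set L \<subseteq> X" if "L \<in> set (Ls g)" for L
        using that WX[OF g] Ls(1)[OF g] unfolding in_set_conv_nth by blast
      then have "set (concat (Ls g)) \<subseteq> X" unfolding set_concat by blast
      moreover have "set (A g) \<subseteq> X" "set (Bs g) \<subseteq> X" using WX[OF g] gl[OF g] by (auto simp: in_set_conv_nth)
      ultimately show ?thesis by (auto simp: G_def)
    qed
    \<comment> \<open>Covering is enough: the sizes agree, so \<open>exact_cover\<close> turns it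
      into a partition.\<close>
    have "Uz \<union> L \<subseteq> X"
    proof -
      have "GG \<subseteq> X" using GX by (auto simp: GG_def)
      moreover have "L \<subseteq> X" using GX f(1) by (auto simp: bij_betw_def)
      moreover have "an b \<in> X" if "b \<in> AB" for b using hX[of b] that by (auto simp: AB_def h_def)
      moreover have "set (gap b) \<subseteq> X" if "b \<in> Blk" for b using bX[OF that] by (auto simp: body_def split: if_splits)
      ultimately show ?thesis unfolding Uz_def GP_def by blast
    qed
    moreover have "card (Uz \<union> L) = m * (\<beta> * t1 + 1)"
      using cUz L UzV fin finL by (subst card_Un_disjoint) (auto intro: finite_subset)
    moreover have "length (zl c) = \<beta> * t1 + 1" if "c < m" for c using zlpath(1)[OF that] u by (simp add: wpath_def)
    moreover have "finite (Uz \<union> L)" using UzV fin finL by (auto intro: finite_subset)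
    ultimately have cover: "(\<Union>c<m. set (zl c)) = Uz \<union> L" "\<And>c. c < m \<Longrightarrow> distinct (zl c)"
      "\<And>c c'. c < m \<Longrightarrow> c' < m \<Longrightarrow> c \<noteq> c' \<Longrightarrow> set (zl c) \<inter> set (zl c') = {}"
      using exact_cover[of "Uz \<union> L" m zl "\<beta> * t1 + 1"] unfolding X_def by auto
    show ?thesis
    proof (intro exI[of _ zl] conjI allI impI)
      show "hd (zl c) = h (c, 0)" for c by (simp add: zl_def)
    qed (use cover zlpath in auto)
  qed
  show ?thesis
    by (intro exI[of _ "\<lambda>c. h (c, 0)"] exI[of _ "\<lambda>c. h (c, \<beta>)"] exI[of _ Uz]) (use UzV cUz hV main in auto)
qed

subsection \<open>Covering by long pieces\<close>

lemma words_of_length: "finite {p :: bool list. length p = n}" "card {p :: bool list. length p = n} = 2 ^ n"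
  using finite_lists_length_eq[of "UNIV :: bool set" n] card_lists_length_eq[of "UNIV :: bool set" n] by simp_all

text \<open>Pieces with the same word \<open>p\<close> share the parts \<open>W p j\<close>, one for
  each level \<open>j \<le> q\<close>, each of size about \<open>cnt p + \<theta> * N\<close>. As
  \<open>H\<close> is regular, degrees between consecutive parts nearly agree, and the surplus
  \<open>\<theta> * N\<close> covers the discrepancy and the losses of all \<open>q\<close>
  matchings. The class \<open>None\<close> is the reserve.\<close>

lemma pieces:
  fixes e \<theta> \<rho> \<tau> :: real and q :: nat and wd :: "'b \<Rightarrow> bool list"
  assumes as: "asymp E" and fin: "finite V" and V1: "V1 \<subseteq> V" and r: "rich E e V V1" and e: "0 < e" "e \<le> 1/8"
    and Bk: "finite Bk" and wd: "\<And>b. b \<in> Bk \<Longrightarrow> length (wd b) = q"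
    and sz: "card Bk * (q + 1) + 2 ^ q * (q + 1) * \<theta> * card V1 \<le> (1 - \<rho>) * card V1"
    and pos: "0 < \<theta>" "0 < \<rho>" "\<rho> \<le> 1" "0 < \<tau>"
    and \<tau>: "\<tau> \<le> e * \<rho> / 8" "\<tau> \<le> \<theta> * e / 4"
    and chain: "q * (8 * \<tau> * card V1 / (\<theta> * e) + 1) + \<tau> * card V1 \<le> \<theta> * card V1"
    and n: "4 / e \<le> card V1"
    and log: "ln (2 * (4 * card V + 1) * (2 ^ q * (q + 1) + 1)) \<le> (\<tau>/2)^2 * card V1"
  shows "\<exists>Res P. Res \<subseteq> V1 \<and> \<rho>/2 * card V1 \<le> card Res \<and> rich E (e/2) V Res \<and>
    (\<forall>b\<in>Bk. wpath E (wd b) (P b) \<and> distinct (P b) \<and> set (P b) \<subseteq> V1 - Res) \<and>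
    (\<forall>b\<in>Bk. \<forall>b'\<in>Bk. b \<noteq> b' \<longrightarrow> set (P b) \<inter> set (P b') = {})"
proof -
  define N where "N = real (card V1)"
  have fin1: "finite V1" using V1 fin by (rule finite_subset)
  have N4: "4 \<le> e * N" using n e by (simp add: N_def divide_le_eq mult.commute)
  then have N0: "0 < N" using e by (smt (verit) zero_less_mult_iff)
  have r1: "rich E e V1 V1" using r V1 unfolding rich_def by blast
  \<comment> \<open>The largest integer degree that \<open>regular_subgraph\<close> allows; as
    \<open>e * N \<ge> 4\<close>, rounding down loses at most half.\<close>
  define dd where "dd = nat \<lfloor>e/2 * N\<rfloor>"
  have dd: "real dd \<le> e/2 * N" "e/4 * N \<le> real dd"
    using N4 unfolding dd_def by linarith+
  obtain H where H: "\<And>u v. H u v \<Longrightarrow> E u v" "\<And>v s. v \<in> V1 \<Longrightarrow> card (nbrs H s v V1) = dd"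
    using regular_subgraph[OF as fin1 r1 e, of dd] dd(1) unfolding N_def by blast
  define Pw where "Pw = {p :: bool list. length p = q}"
  have Pw: "finite Pw" "card Pw = 2 ^ q" by (simp_all add: Pw_def words_of_length)
  define cnt where "cnt = (\<lambda>p. card {b \<in> Bk. wd b = p})"
  have cnt: "(\<Sum>p\<in>Pw. cnt p) = card Bk"
  proof -
    have "Bk = (\<Union>p\<in>Pw. {b \<in> Bk. wd b = p})" using wd by (auto simp: Pw_def)
    then have "card Bk = card (\<Union>p\<in>Pw. {b \<in> Bk. wd b = p})" by (rule arg_cong)
    also have "\<dots> = (\<Sum>p\<in>Pw. card {b \<in> Bk. wd b = p})"
      using Pw Bk by (intro card_UN_disjoint) auto
    finally show ?thesis by (simp add: cnt_def)
  qed
  define J where "J = Pw \<times> {..q}"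
  have finJ: "finite J" "card J = 2 ^ q * (q + 1)" using Pw by (auto simp: J_def card_cartesian_product)
  define I where "I = insert None (Some ` J)"
  have finI: "finite I" "card I = 2 ^ q * (q + 1) + 1"
    using finJ by (simp_all add: I_def card_image card_insert_if image_iff)
  \<comment> \<open>The summand \<open>\<theta>\<close> gives even a word without pieces a linear
    share, so no part is too small for its degrees to be controlled.\<close>
  define w where "w = (\<lambda>p. (cnt p + \<theta> * N) / N)"
  define pr where "pr = (\<lambda>i :: (bool list \<times> nat) option. case i of None \<Rightarrow> 1 - (\<Sum>pj\<in>J. w (fst pj)) | Some pj \<Rightarrow> w (fst pj))"
  have w0: "\<theta> \<le> w p" for p using N0 by (simp add: w_def add_divide_distrib)
  have "(\<Sum>pj\<in>J. w (fst pj)) = (\<Sum>p\<in>Pw. \<Sum>j\<in>{..q}. w p)"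
    unfolding J_def by (subst sum.cartesian_product) (simp add: case_prod_beta)
  also have "\<dots> = (q + 1) * (\<Sum>p\<in>Pw. w p)" by (simp add: sum_distrib_left)
  also have "(\<Sum>p\<in>Pw. w p) = (card Bk + 2 ^ q * \<theta> * N) / N"
    unfolding w_def sum_divide_distrib[symmetric] sum.distrib using cnt[symmetric] Pw by simp
  finally have sw: "(\<Sum>pj\<in>J. w (fst pj)) = (card Bk * (q + 1) + 2 ^ q * (q + 1) * \<theta> * N) / N"
    by (simp add: algebra_simps)
  also have "\<dots> \<le> 1 - \<rho>" using sz N0 by (simp add: divide_le_eq N_def)
  finally have prN: "\<rho> \<le> pr None" by (simp add: pr_def)
  have prS: "pr (Some (p, j)) = w p" for p j by (simp add: pr_def)
  have pr0: "0 \<le> pr i" for i using prN pos order_trans[OF less_imp_le[OF pos(1)] w0]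
    by (cases i) (auto simp: pr_def)
  have prI: "sum pr I = 1"
    unfolding I_def using finJ by (subst sum.insert) (auto simp: sum.reindex pr_def)
  \<comment> \<open>Test sets: \<open>V1\<close> itself, and for each vertex both neighbourhoods in
    \<open>V1\<close> under \<open>E\<close>, needed for the reserve, and under \<open>H\<close>,
    needed for the matchings.\<close>
  define T where "T = insert None (Some ` (V \<times> (UNIV :: bool set) \<times> (UNIV :: bool set)))"
  have finT: "finite T" "card T = 4 * card V + 1"
  proof -
    have "card (UNIV :: (bool \<times> bool) set) = 4" by (simp add: card_cartesian_product flip: UNIV_Times_UNIV)
    then show "finite T" "card T = 4 * card V + 1"
      using fin by (simp_all add: T_def card_image card_insert_if image_iff card_cartesian_product)
  qed
  define A where "A = (\<lambda>k. case k of None \<Rightarrow> V1 | Some (v, s, b) \<Rightarrow> nbrs (if b then H else E) s v V1)"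
  have AV: "V1 \<inter> A k = A k" for k by (auto simp: A_def nbrs_def split: option.splits)
  have "\<tau>/2 \<le> 1" using \<tau>(1) e pos mult_mono[of e 1 \<rho> 1] by simp
  moreover have "ln (real (2 * card T * card I)) \<le> (\<tau>/2)^2 * card V1" using log unfolding finT finI by simp
  ultimately have "\<exists>f. (\<forall>v\<in>V1. f v \<in> I) \<and>
    (\<forall>k\<in>T. \<forall>i\<in>I. \<bar>real (card {v \<in> V1 \<inter> A k. f v = i}) - pr i * card (V1 \<inter> A k)\<bar> \<le> 2 * (\<tau>/2) * card V1)"
    using pos pr0 prI by (intro split_evenly[OF fin1 finI(1) _ _ finT(1)]) auto
  then obtain f where f: "\<And>v. v \<in> V1 \<Longrightarrow> f v \<in> I"
    "\<And>k i. k \<in> T \<Longrightarrow> i \<in> I \<Longrightarrow> \<bar>real (card {v \<in> A k. f v = i}) - pr i * card (A k)\<bar> \<le> \<tau> * N"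
    unfolding AV N_def by auto
  define W where "W = (\<lambda>p j. {v \<in> V1. f v = Some (p, j)})"
  define Res where "Res = {v \<in> V1. f v = None}"
  have finW: "finite (W p j)" for p j using fin1 by (simp add: W_def)
  have NoneI: "None \<in> I" "None \<in> T" by (auto simp: I_def T_def)
  have pI: "Some (p, j) \<in> I" if "p \<in> Pw" "j \<le> q" for p j using that by (auto simp: I_def J_def)
  have F1: "cnt p + \<theta> * N - \<tau> * N \<le> card (W p j)" if "p \<in> Pw" "j \<le> q" for p j
  proof -
    have "w p * N = cnt p + \<theta> * N" using N0 by (simp add: w_def)
    then show ?thesis using f(2)[OF NoneI(2) pI[OF that]] unfolding A_def prS W_def N_def by simp
  qed
  have F2: "\<bar>real (card (nbrs H s x (W p j))) - w p * dd\<bar> \<le> \<tau> * N" if "p \<in> Pw" "j \<le> q" "x \<in> V1" for p j s x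
  proof -
    have "Some (x, s, True) \<in> T" using that V1 by (auto simp: T_def)
    from f(2)[OF this pI[OF that(1,2)]]
    have "\<bar>real (card {v \<in> nbrs H s x V1. f v = Some (p, j)}) - w p * dd\<bar> \<le> \<tau> * N"
      using H(2)[OF that(3)] by (simp add: A_def prS)
    moreover have "{v \<in> nbrs H s x V1. f v = Some (p, j)} = nbrs H s x (W p j)" by (auto simp: nbrs_def W_def)
    ultimately show ?thesis by simp
  qed
  have R1: "\<bar>card Res - pr None * N\<bar> \<le> \<tau> * N"
    using f(2)[OF NoneI(2) NoneI(1)] by (simp add: A_def Res_def N_def)
  have "\<rho> * N \<le> pr None * N" using prN N0 by (intro mult_right_mono) auto
  moreover have "\<tau> \<le> \<rho>/2"
  proof -
    have "e * \<rho> \<le> 1/8 * \<rho>" using e pos by (intro mult_right_mono) auto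
    then show ?thesis using \<tau>(1) pos by linarith
  qed
  then have "\<tau> * N \<le> \<rho>/2 * N" using N0 by (intro mult_right_mono) auto
  ultimately have Res: "\<rho>/2 * N \<le> card Res" using R1 by (simp add: abs_le_iff algebra_simps)
  have "rich E (e/2) V Res"
    unfolding rich_def
  proof (intro ballI allI)
    fix v s assume v: "v \<in> V"
    have "Some (v, s, False) \<in> T" using v by (auto simp: T_def)
    from f(2)[OF this NoneI(1)]
    have "\<bar>real (card {x \<in> nbrs E s v V1. f x = None}) - pr None * card (nbrs E s v V1)\<bar> \<le> \<tau> * N"
      by (simp add: A_def)
    moreover have "{x \<in> nbrs E s v V1. f x = None} = nbrs E s v Res" by (auto simp: nbrs_def Res_def)
    ultimately have 1: "pr None * card (nbrs E s v V1) - \<tau> * N \<le> card (nbrs E s v Res)" by (simp add: abs_le_iff)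
    have "(3/8 + e) * N \<le> card (nbrs E s v V1)" using richD[OF r v] by (simp add: N_def)
    then have "pr None * ((3/8 + e) * N) \<le> pr None * card (nbrs E s v V1)" using pr0 by (intro mult_left_mono)
    moreover have "(3/8 + e) * (card Res - \<tau> * N) \<le> (3/8 + e) * (pr None * N)"
      using R1 e by (intro mult_left_mono) (auto simp: abs_le_iff)
    moreover have "pr None * ((3/8 + e) * N) = (3/8 + e) * (pr None * N)" by simp
    ultimately have "(3/8 + e) * (card Res - \<tau> * N) \<le> card (nbrs E s v Res) + \<tau> * N"
      using 1 by linarith
    then have 2: "(3/8 + e) * card Res - (3/8 + e) * (\<tau> * N) \<le> card (nbrs E s v Res) + \<tau> * N"
      by (simp only: right_diff_distrib)
    have "(3/8 + e) * (\<tau> * N) \<le> 1 * (\<tau> * N)" using e pos N0 by (intro mult_right_mono) auto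
    moreover have "2 * (\<tau> * N) \<le> e/2 * card Res"
    proof -
      have "2 * (\<tau> * N) \<le> 2 * (e * \<rho> / 8 * N)"
        using mult_right_mono[OF \<tau>(1) less_imp_le[OF N0]] by linarith
      also have "\<dots> = e/2 * (\<rho>/2 * N)" by simp
      also have "\<dots> \<le> e/2 * card Res" using Res e by (intro mult_left_mono) auto
      finally show ?thesis .
    qed
    ultimately have "(3/8 + e) * card Res - e/2 * card Res \<le> card (nbrs E s v Res)" using 2 by linarith
    then show "(3/8 + e/2) * card Res \<le> card (nbrs E s v Res)"
      by (simp only: left_diff_distrib[symmetric]) (simp add: add.commute)
  qed
  have piece: "\<exists>P. (\<forall>b\<in>Bk. wd b = p \<longrightarrow> wpath E p (P b) \<and> distinct (P b) \<and> set (P b) \<subseteq> (\<Union>j\<le>q. W p j)) \<and>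
      (\<forall>b\<in>Bk. \<forall>b'\<in>Bk. wd b = p \<longrightarrow> wd b' = p \<longrightarrow> b \<noteq> b' \<longrightarrow> set (P b) \<inter> set (P b') = {})" if p: "p \<in> Pw" for p
  proof -
    have lp: "length p = q" using p by (simp add: Pw_def)
    define D1 where "D1 = w p * dd - \<tau> * N"
    define D2 where "D2 = w p * dd + \<tau> * N"
    \<comment> \<open>The loss at one level: \<open>D2 - D1 = 2 * \<tau> * N\<close>,
      \<open>D2 \<ge> \<theta> * e * N / 4\<close>, and a part has at most \<open>N\<close>
      vertices.\<close>
    define k where "k = nat \<lceil>8 * \<tau> * N / (\<theta> * e)\<rceil>"
    have wdd: "\<theta> * e * N / 4 \<le> w p * dd"
      using mult_mono[OF w0[of p] dd(2)] pos e N0 w0[of p] by (simp add: mult_ac)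
    moreover have "\<tau> * N \<le> \<theta> * e / 4 * N" using \<tau>(2) N0 by (intro mult_right_mono) auto
    ultimately have D10: "0 \<le> D1" by (simp add: D1_def)
    have "0 < \<theta> * e * N / 4" "0 < \<tau> * N" using pos e N0 by simp_all
    then have D20: "0 < D2" "\<theta> * e * N / 4 \<le> D2" using wdd unfolding D2_def by linarith+
    have D12: "D1 \<le> D2" using pos N0 by (simp add: D1_def D2_def)
    have kk: "8 * \<tau> * N / (\<theta> * e) \<le> k" "k \<le> 8 * \<tau> * N / (\<theta> * e) + 1"
    proof -
      have "0 \<le> 8 * \<tau> * N / (\<theta> * e)" using pos e N0 by simp
      then show "8 * \<tau> * N / (\<theta> * e) \<le> k" "k \<le> 8 * \<tau> * N / (\<theta> * e) + 1" unfolding k_def by linarith+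
    qed
    have loss: "(1 - D1 / D2) * card (W p j) \<le> k" for j
    proof -
      have "card (W p j) \<le> card V1" using fin1 by (intro card_mono) (auto simp: W_def)
      then have 1: "(1 - D1 / D2) * card (W p j) \<le> (1 - D1 / D2) * N"
        using D12 D20 by (intro mult_left_mono) (auto simp: N_def)
      have 2: "1 - D1 / D2 = 2 * \<tau> * N / D2" using D20 by (simp add: D1_def D2_def field_simps)
      have "2 * \<tau> * N / D2 * N \<le> 2 * \<tau> * N / (\<theta> * e * N / 4) * N"
        using D20 pos e N0 by (intro mult_right_mono divide_left_mono) auto
      also have "\<dots> = 8 * \<tau> * N / (\<theta> * e)" using N0 by simp
      finally show ?thesis using kk 1 unfolding 2 by linarith
    qed
    have WV: "W p j \<subseteq> V1" for j by (auto simp: W_def)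
    have "\<exists>I P. I \<subseteq> W p 0 \<and> card (W p 0) \<le> card I + length p * k \<and>
     (\<forall>j\<le>length p. inj_on (P j) I \<and> P j ` I \<subseteq> W p j) \<and>
     (\<forall>j<length p. \<forall>i\<in>I. arc H (p ! j) (P j i) (P (Suc j) i))"
    proof (rule matching_chain[OF finW D10 D20(1) _ _ loss D12])
      show "D1 \<le> card (nbrs H (p ! j) x (W p (Suc j)))" if "j < length p" "x \<in> W p j" for j x
        using subsetD[OF WV that(2)] F2[OF p, of "Suc j" x "p ! j"] that lp WV by (auto simp: D1_def abs_le_iff)
      show "card (nbrs H (\<not> p ! j) y (W p j)) \<le> D2" if "j < length p" "y \<in> W p (Suc j)" for j y
        using subsetD[OF WV that(2)] F2[OF p, of j y "\<not> p ! j"] that lp WV by (auto simp: D2_def abs_le_iff)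
    qed
    then obtain Ip Pf where Ip: "Ip \<subseteq> W p 0" "card (W p 0) \<le> card Ip + length p * k"
      and Pf: "\<forall>j\<le>length p. inj_on (Pf j) Ip \<and> Pf j ` Ip \<subseteq> W p j"
      and Pa: "\<forall>j<length p. \<forall>i\<in>Ip. arc H (p ! j) (Pf j i) (Pf (Suc j) i)"
      by (elim exE conjE) (rule that)
    have "q * k \<le> q * (8 * \<tau> * N / (\<theta> * e) + 1)"
      unfolding of_nat_mult using kk by (intro mult_left_mono) auto
    then have "q * k + \<tau> * N \<le> \<theta> * N" using chain unfolding N_def by linarith
    moreover have "real (card (W p 0)) \<le> card Ip + q * k" using of_nat_mono[OF Ip(2), where 'a = real] lp by simp
    ultimately have "real (cnt p) \<le> card Ip" using F1[OF p, of 0] by simp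
    then have "card {b \<in> Bk. wd b = p} \<le> card Ip" by (simp add: cnt_def)
    then obtain \<iota> where \<iota>: "\<iota> ` {b \<in> Bk. wd b = p} \<subseteq> Ip" "inj_on \<iota> {b \<in> Bk. wd b = p}"
      using card_le_inj[of "{b \<in> Bk. wd b = p}" Ip] Bk finite_subset[OF Ip(1) finW] by auto
    define P where "P = (\<lambda>b. map (\<lambda>j. Pf j (\<iota> b)) [0..<q + 1])"
    have Wd: "W p j \<inter> W p j' = {}" if "j \<noteq> j'" for j j' using that by (auto simp: W_def)
    have inW: "Pf j (\<iota> b) \<in> W p j" if "b \<in> Bk" "wd b = p" "j \<le> q" for b j
      using Pf \<iota>(1) that lp by blast
    have "wpath E p (P b) \<and> distinct (P b) \<and> set (P b) \<subseteq> (\<Union>j\<le>q. W p j)" if b: "b \<in> Bk" "wd b = p" for b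
    proof (intro conjI)
      have "\<iota> b \<in> Ip" using \<iota>(1) b by auto
      then have "wpath H p (P b)" unfolding wpath_def P_def using Pa lp by (simp del: upt_Suc)
      then show "wpath E p (P b)" by (rule wpath_mono) (rule H(1))
      have "inj_on (\<lambda>j. Pf j (\<iota> b)) {0..<q + 1}"
      proof (rule inj_onI)
        fix j j' assume "j \<in> {0..<q + 1}" "j' \<in> {0..<q + 1}" "Pf j (\<iota> b) = Pf j' (\<iota> b)"
        then show "j = j'" using inW[OF b, of j] inW[OF b, of j'] Wd[of j j'] by auto
      qed
      then show "distinct (P b)" by (simp add: P_def distinct_map del: upt_Suc)
      show "set (P b) \<subseteq> (\<Union>j\<le>q. W p j)"
      proof
        fix v assume "v \<in> set (P b)"
        then obtain j where "j \<le> q" "v = Pf j (\<iota> b)" by (auto simp: P_def less_Suc_eq_le simp del: upt_Suc)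
        then show "v \<in> (\<Union>j\<le>q. W p j)" using inW[OF b] by blast
      qed
    qed
    moreover have "set (P b) \<inter> set (P b') = {}" if b: "b \<in> Bk" "b' \<in> Bk" "wd b = p" "wd b' = p" "b \<noteq> b'" for b b'
    proof (rule ccontr)
      assume "set (P b) \<inter> set (P b') \<noteq> {}"
      then obtain j j' where jj: "j \<le> q" "j' \<le> q" "Pf j (\<iota> b) = Pf j' (\<iota> b')"
        by (auto simp: P_def less_Suc_eq_le simp del: upt_Suc)
      then have "j = j'" using inW[OF b(1,3) jj(1)] inW[OF b(2,4) jj(2)] Wd[of j j'] by auto
      moreover have "\<iota> b \<in> Ip" "\<iota> b' \<in> Ip" using \<iota>(1) b by auto
      ultimately have "\<iota> b = \<iota> b'" using jj Pf lp by (auto simp: inj_on_def)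
      then show False using \<iota>(2) b by (auto simp: inj_on_def)
    qed
    ultimately show ?thesis by (intro exI[of _ P]) blast
  qed
  define PP where "PP = (\<lambda>p. SOME P. (\<forall>b\<in>Bk. wd b = p \<longrightarrow> wpath E p (P b) \<and> distinct (P b) \<and> set (P b) \<subseteq> (\<Union>j\<le>q. W p j)) \<and>
      (\<forall>b\<in>Bk. \<forall>b'\<in>Bk. wd b = p \<longrightarrow> wd b' = p \<longrightarrow> b \<noteq> b' \<longrightarrow> set (P b) \<inter> set (P b') = {}))"
  have PP: "(\<forall>b\<in>Bk. wd b = p \<longrightarrow> wpath E p (PP p b) \<and> distinct (PP p b) \<and> set (PP p b) \<subseteq> (\<Union>j\<le>q. W p j)) \<and>
      (\<forall>b\<in>Bk. \<forall>b'\<in>Bk. wd b = p \<longrightarrow> wd b' = p \<longrightarrow> b \<noteq> b' \<longrightarrow> set (PP p b) \<inter> set (PP p b') = {})" if "p \<in> Pw" for p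
    unfolding PP_def by (rule someI_ex[OF piece[OF that]])
  have wdP: "wd b \<in> Pw" if "b \<in> Bk" for b using wd[OF that] by (simp add: Pw_def)
  define P where "P = (\<lambda>b. PP (wd b) b)"
  have P1: "wpath E (wd b) (P b)" "distinct (P b)" "set (P b) \<subseteq> (\<Union>j\<le>q. W (wd b) j)" if "b \<in> Bk" for b
    using PP[OF wdP[OF that]] that by (auto simp: P_def)
  have P2: "set (P b) \<inter> set (P b') = {}" if b: "b \<in> Bk" "b' \<in> Bk" "b \<noteq> b'" for b b'
  proof (cases "wd b = wd b'")
    case True
    then show ?thesis using PP[OF wdP[OF b(1)]] b by (simp add: P_def)
  next
    case False
    then have "(\<Union>j\<le>q. W (wd b) j) \<inter> (\<Union>j\<le>q. W (wd b') j) = {}" by (auto simp: W_def)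
    then show ?thesis using P1(3)[OF b(1)] P1(3)[OF b(2)] by blast
  qed
  have P3: "set (P b) \<subseteq> V1 - Res" if "b \<in> Bk" for b
  proof -
    have "(\<Union>j\<le>q. W (wd b) j) \<subseteq> V1 - Res" by (auto simp: W_def Res_def)
    then show ?thesis using P1(3)[OF that] by blast
  qed
  have "Res \<subseteq> V1" by (auto simp: Res_def)
  then show ?thesis using Res[unfolded N_def] \<open>rich E (e/2) V Res\<close> P1(1,2) P2 P3
    by (intro exI[of _ Res] exI[of _ P]) blast
qed

text \<open>A block of \<open>t\<close> letters is a link of \<open>K + 1\<close> letters followed
  by a piece of \<open>q\<close> letters; one last link of \<open>K + 1 + rem\<close> letters takes
  up the remainder. Pieces avoid \<open>Res\<close> and links have their interiors in it, so they
  cannot collide. As \<open>Res\<close> is rich with \<open>e/2\<close> only, links need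
  \<open>64 / e^2 + 2\<close> letters.\<close>

lemma linking:
  fixes e \<theta> \<rho> \<tau> :: real and q K b rem m :: nat
  defines "t \<equiv> q + 1 + K"
  assumes as: "asymp E" and fin: "finite V" and V1: "V1 \<subseteq> V" and r: "rich E e V V1" and e: "0 < e" "e \<le> 1/8"
    and u: "length u = b * t + K + 1 + rem" and K: "64 / e^2 + 2 \<le> K"
    and xy: "\<And>c. c < m \<Longrightarrow> x c \<in> V" "\<And>c. c < m \<Longrightarrow> y c \<in> V"
    and sz: "m * b * (q + 1) + 2 ^ q * (q + 1) * \<theta> * card V1 \<le> (1 - \<rho>) * card V1"
    and pos: "0 < \<theta>" "0 < \<rho>" "\<rho> \<le> 1" "0 < \<tau>"
    and \<tau>: "\<tau> \<le> e * \<rho> / 8" "\<tau> \<le> \<theta> * e / 4"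
    and chain: "q * (8 * \<tau> * card V1 / (\<theta> * e) + 1) + \<tau> * card V1 \<le> \<theta> * card V1"
    and n: "4 / e \<le> card V1"
    and log: "ln (2 * (4 * card V + 1) * (2 ^ q * (q + 1) + 1)) \<le> (\<tau>/2)^2 * card V1"
    and gaps: "m * ((b + 1) * (K + 1) + rem) \<le> e * \<rho> / 8 * card V1" "K + 1 + rem \<le> e^2 * \<rho> / 256 * card V1"
  shows "\<exists>ml. (\<forall>c<m. wpath E u (x c # ml c @ [y c]) \<and> distinct (ml c) \<and> set (ml c) \<subseteq> V1) \<and>
    (\<forall>c<m. \<forall>c'<m. c \<noteq> c' \<longrightarrow> set (ml c) \<inter> set (ml c') = {})"
proof -
  define Bk where "Bk = {..<m} \<times> {..<b}"
  define wd where "wd = (\<lambda>ci :: nat \<times> nat. take q (drop (snd ci * t + (K + 1)) u))"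
  have fit: "Suc i * t \<le> b * t" if "i < b" for i using that by (intro mult_le_mono1) simp
  have lwd: "length (wd ci) = q" if "ci \<in> Bk" for ci
  proof -
    have "Suc (snd ci) * t \<le> b * t" using fit[of "snd ci"] that by (auto simp: Bk_def)
    then show ?thesis using u by (simp add: wd_def t_def)
  qed
  have cBk: "card Bk = m * b" "finite Bk" by (auto simp: Bk_def card_cartesian_product)
  have "real (card Bk * (q + 1)) + 2 ^ q * (q + 1) * \<theta> * card V1 \<le> (1 - \<rho>) * card V1" using sz cBk by simp
  then have "\<exists>Res P. Res \<subseteq> V1 \<and> \<rho>/2 * card V1 \<le> card Res \<and> rich E (e/2) V Res \<and>
    (\<forall>b\<in>Bk. wpath E (wd b) (P b) \<and> distinct (P b) \<and> set (P b) \<subseteq> V1 - Res) \<and>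
    (\<forall>b\<in>Bk. \<forall>b'\<in>Bk. b \<noteq> b' \<longrightarrow> set (P b) \<inter> set (P b') = {})"
    by (intro pieces[OF as fin V1 r e cBk(2) lwd _ pos \<tau> chain n log])
  then obtain Res P where
    Res: "Res \<subseteq> V1" "\<rho>/2 * card V1 \<le> card Res" "rich E (e/2) V Res"
    and P: "\<forall>b\<in>Bk. wpath E (wd b) (P b) \<and> distinct (P b) \<and> set (P b) \<subseteq> V1 - Res"
    and Pd: "\<forall>b\<in>Bk. \<forall>b'\<in>Bk. b \<noteq> b' \<longrightarrow> set (P b) \<inter> set (P b') = {}"
    by (elim exE conjE) (rule that)
  have Pne: "P ci \<noteq> []" if "ci \<in> Bk" for ci using P that by (auto simp: wpath_def)
  have PV: "hd (P ci) \<in> V" "last (P ci) \<in> V" if "ci \<in> Bk" for ci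
  proof -
    have "set (P ci) \<subseteq> V" using P that V1 by blast
    then show "hd (P ci) \<in> V" "last (P ci) \<in> V" using Pne[OF that] by auto
  qed
  define h where "h = (\<lambda>c i. if i = 0 then x c else last (P (c, i - 1)))"
  define k where "k = (\<lambda>c i. if i < b then hd (P (c, i)) else y c)"
  define gw where "gw = (\<lambda>i. if i < b then take (K + 1) (drop (i * t) u) else drop (b * t) u)"
  define J where "J = {..<m} \<times> {..b}"
  have finJ: "finite J" by (simp add: J_def)
  have lgw: "length (gw i) = (if i < b then K + 1 else K + 1 + rem)" for i
    using fit[of i] u by (auto simp: gw_def t_def)
  have finR: "finite Res" using Res(1) V1 fin by (meson finite_subset)
  have "\<exists>g. (\<forall>ci\<in>J. length (g ci) = length (gw (snd ci)) - 1 \<and> distinct (g ci) \<and> set (g ci) \<subseteq> Res - {} \<and>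
      wpath E (gw (snd ci)) (h (fst ci) (snd ci) # g ci @ [k (fst ci) (snd ci)])) \<and>
      (\<forall>i\<in>J. \<forall>j\<in>J. i \<noteq> j \<longrightarrow> set (g i) \<inter> set (g j) = {})"
  proof (rule fill_gaps[OF as finR _ Res(3) _ _ finJ])
    show "Res \<subseteq> V" using Res(1) V1 by blast
    show "0 < e/2" "e/2 \<le> 1/8" using e by auto
    fix ci assume ci: "ci \<in> J"
    then obtain c i where [simp]: "ci = (c, i)" and ci': "c < m" "i \<le> b" by (auto simp: J_def)
    show "h (fst ci) (snd ci) \<in> V"
    proof (cases i)
      case (Suc j)
      then have "(c, j) \<in> Bk" using ci' by (simp add: Bk_def)
      then show ?thesis using PV Suc by (simp add: h_def)
    qed (use xy ci' in \<open>simp add: h_def\<close>)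
    show "k (fst ci) (snd ci) \<in> V"
      using xy(2)[OF ci'(1)] PV(1)[of "(c, i)"] ci' by (auto simp: k_def Bk_def)
    have l: "K \<le> length (gw i)" "length (gw i) \<le> K + 1 + rem" using lgw[of i] by auto
    have "16 / (e/2)^2 = 64 / e^2" by (simp add: power2_eq_square)
    then show "16 / (e/2)^2 + 2 \<le> length (gw (snd ci))" using K of_nat_mono[OF l(1), where 'a = real] by simp
    have "e^2 * \<rho> / 256 * card V1 = (e/2)^2/32 * (\<rho>/2 * card V1)" by (simp add: power2_eq_square)
    also have "\<dots> \<le> (e/2)^2/32 * card Res" using Res(2) by (intro mult_left_mono) auto
    finally have "real (length (gw i)) \<le> (e/2)^2/32 * card Res"
      using gaps(2) of_nat_mono[OF l(2), where 'a = real] by linarith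
    then show "length (gw (snd ci)) \<le> (e/2)^2/32 * card Res" by simp
  next
    have "(\<Sum>ci\<in>J. length (gw (snd ci))) = (\<Sum>c<m. \<Sum>i\<le>b. length (gw i))"
      unfolding J_def by (subst sum.cartesian_product) (simp add: case_prod_beta)
    also have "(\<Sum>i\<le>b. length (gw i)) = (\<Sum>i<b. K + 1) + (K + 1 + rem)"
      using lgw by (simp add: lessThan_Suc_atMost[symmetric])
    finally have "(\<Sum>ci\<in>J. length (gw (snd ci))) = m * ((b + 1) * (K + 1) + rem)" by simp
    then have "real (card ({} \<inter> Res) + (\<Sum>ci\<in>J. length (gw (snd ci)))) \<le> e * \<rho> / 8 * card V1"
      using gaps(1) by simp
    also have "\<dots> = e/2/2 * (\<rho>/2 * card V1)" by simp
    also have "\<dots> \<le> e/2/2 * card Res" using Res(2) e by (intro mult_left_mono) auto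
    finally show "real (card ({} \<inter> Res) + (\<Sum>ci\<in>J. length (gw (snd ci)))) \<le> e/2/2 * card Res" .
  qed
  then obtain g where g: "\<forall>ci\<in>J. length (g ci) = length (gw (snd ci)) - 1 \<and> distinct (g ci) \<and> set (g ci) \<subseteq> Res - {} \<and>
      wpath E (gw (snd ci)) (h (fst ci) (snd ci) # g ci @ [k (fst ci) (snd ci)])"
    and gd: "\<forall>i\<in>J. \<forall>j\<in>J. i \<noteq> j \<longrightarrow> set (g i) \<inter> set (g j) = {}"
    by (elim exE conjE) (rule that)
  define Q where "Q = (\<lambda>c i. if i < b then g (c, i) @ P (c, i) else g (c, i))"
  define ml where "ml = (\<lambda>c. concat (map (Q c) [0..<b + 1]))"
  have Qd: "distinct (Q c i)" "set (Q c i) \<subseteq> V1" if "c < m" "i \<le> b" for c i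
  proof -
    have "(c, i) \<in> J" using that by (simp add: J_def)
    then have G: "distinct (g (c, i))" "set (g (c, i)) \<subseteq> Res" using g by auto
    have "distinct (Q c i) \<and> set (Q c i) \<subseteq> V1"
    proof (cases "i < b")
      case True
      then have "(c, i) \<in> Bk" using that by (simp add: Bk_def)
      then have "distinct (P (c, i))" "set (P (c, i)) \<subseteq> V1 - Res" using P by auto
      then show ?thesis using G Res(1) True by (auto simp: Q_def)
    qed (use G Res(1) in \<open>auto simp: Q_def\<close>)
    then show "distinct (Q c i)" "set (Q c i) \<subseteq> V1" by auto
  qed
  have Qdisj: "set (Q c i) \<inter> set (Q c' i') = {}"
    if "c < m" "i \<le> b" "c' < m" "i' \<le> b" "(c, i) \<noteq> (c', i')" for c i c' i'
  proof -
    have J: "(c, i) \<in> J" "(c', i') \<in> J" using that by (auto simp: J_def)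
    have G: "set (g (c, i)) \<subseteq> Res" "set (g (c', i')) \<subseteq> Res" using g J by auto
    have Gd: "set (g (c, i)) \<inter> set (g (c', i')) = {}" using gd J that(5) by blast
    have PR: "set (P (a, j)) \<inter> Res = {}" if "a < m" "j < b" for a j
    proof -
      have "(a, j) \<in> Bk" using that by (simp add: Bk_def)
      then show ?thesis using P by blast
    qed
    have PP: "set (P (c, i)) \<inter> set (P (c', i')) = {}" if "i < b" "i' < b"
    proof -
      have "(c, i) \<in> Bk" "(c', i') \<in> Bk" using that \<open>c < m\<close> \<open>c' < m\<close> by (auto simp: Bk_def)
      then show ?thesis using Pd \<open>(c, i) \<noteq> (c', i')\<close> by blast
    qed
    show ?thesis using G Gd PR[of c i] PR[of c' i'] PP that(1,3) unfolding Q_def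
      by (cases "i < b"; cases "i' < b"; simp; blast)
  qed
  have setml: "set (ml c) = (\<Union>i\<le>b. set (Q c i))" for c
    unfolding ml_def by (simp add: atLeast0LessThan lessThan_Suc_atMost del: upt_Suc)
  have "distinct (ml c)" if c: "c < m" for c
    unfolding ml_def
  proof (rule distinct_concat_map)
    show "distinct (Q c i)" if "i \<in> set [0..<b + 1]" for i
      using Qd(1)[OF c, of i] that by (simp del: upt_Suc)
    show "set (Q c i) \<inter> set (Q c j) = {}" if "i \<in> set [0..<b + 1]" "j \<in> set [0..<b + 1]" "i \<noteq> j" for i j
      using Qdisj[OF c _ c, of i j] that by (simp del: upt_Suc)
  qed simp
  moreover have "set (ml c) \<subseteq> V1" if "c < m" for c
    unfolding setml using Qd(2)[OF that] by blast
  moreover have "set (ml c) \<inter> set (ml c') = {}" if c: "c < m" "c' < m" "c \<noteq> c'" for c c'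
  proof -
    have "set (Q c i) \<inter> set (Q c' i') = {}" if "i \<le> b" "i' \<le> b" for i i' using Qdisj c that by blast
    then show ?thesis unfolding setml by blast
  qed
  moreover have "wpath E u (x c # ml c @ [y c])" if c: "c < m" for c
  proof -
    define W where "W = (\<lambda>i. take t (drop (i * t) u))"
    \<comment> \<open>The last vertex of a piece is the start \<open>h c (Suc i)\<close> of the next
      link; \<open>butlast\<close> keeps it from being listed twice.\<close>
    have blk: "wpath E (W i) (h c i # (g (c, i) @ butlast (P (c, i))) @ [h c (Suc i)])" if i: "i < b" for i
    proof -
      have B: "(c, i) \<in> Bk" "(c, i) \<in> J" using c i by (auto simp: Bk_def J_def)
      have w1: "wpath E (take (K + 1) (drop (i * t) u)) (h c i # g (c, i) @ [hd (P (c, i))])"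
        using g B(2) i by (force simp: gw_def k_def)
      have w2: "wpath E (wd (c, i)) (hd (P (c, i)) # tl (P (c, i)))" using P B(1) Pne[OF B(1)] by simp
      have "W i = take (K + 1) (drop (i * t) u) @ wd (c, i)"
        unfolding W_def wd_def t_def using take_add[of "K + 1" q "drop (i * t) u"] by (simp add: t_def add.commute add.left_commute)
      moreover have "wpath E (take (K + 1) (drop (i * t) u) @ wd (c, i)) ((h c i # g (c, i) @ [hd (P (c, i))]) @ tl (P (c, i)))"
        using w1 w2 by (intro wpath_join) auto
      moreover have "(h c i # g (c, i) @ [hd (P (c, i))]) @ tl (P (c, i)) = h c i # (g (c, i) @ butlast (P (c, i))) @ [h c (Suc i)]"
        using Pne[OF B(1)] by (simp add: h_def)
      ultimately show ?thesis by simp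
    qed
    have "concat (map W [0..<b]) = take (b * t) u"
    proof -
      have "concat (map (\<lambda>i. take t (drop (i * t) (take (b * t) u))) [0..<b]) = take (b * t) u"
        using u by (intro concat_chunks) simp
      moreover have "map (\<lambda>i. take t (drop (i * t) (take (b * t) u))) [0..<b] = map W [0..<b]"
      proof (rule map_cong[OF refl])
        fix i assume "i \<in> set [0..<b]"
        then have "Suc i * t \<le> b * t" by (intro fit) simp
        then show "take t (drop (i * t) (take (b * t) u)) = W i" by (simp add: W_def drop_take min_def)
      qed
      ultimately show ?thesis by simp
    qed
    moreover have "concat (map (\<lambda>i. (g (c, i) @ butlast (P (c, i))) @ [h c (Suc i)]) [0..<b]) = concat (map (Q c) [0..<b])"
    proof (rule arg_cong[where f = concat], rule map_cong[OF refl])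
      fix i assume "i \<in> set [0..<b]"
      then have "i < b" "P (c, i) \<noteq> []" using c Pne by (auto simp: Bk_def)
      then show "(g (c, i) @ butlast (P (c, i))) @ [h c (Suc i)] = Q c i" by (simp add: Q_def h_def)
    qed
    ultimately have a: "wpath E (take (b * t) u) (h c 0 # concat (map (Q c) [0..<b]))"
      "last (h c 0 # concat (map (Q c) [0..<b])) = h c b"
      using wpath_blocks[of b E W "h c" "\<lambda>i. g (c, i) @ butlast (P (c, i))"] blk by simp_all
    have "(c, b) \<in> J" using c by (simp add: J_def)
    then have "wpath E (drop (b * t) u) (h c b # g (c, b) @ [y c])" using g by (force simp: gw_def k_def)
    then have "wpath E (take (b * t) u @ drop (b * t) u) ((h c 0 # concat (map (Q c) [0..<b])) @ g (c, b) @ [y c])"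
      using a by (intro wpath_join) auto
    then show ?thesis by (simp add: ml_def Q_def h_def)
  qed
  ultimately show ?thesis by (intro exI[of _ ml]) blast
qed

section \<open>Assembling the cycles from zones and linked pieces\<close>

lemma popular_word:
  "\<exists>om. length om = w \<and> \<beta> \<le> 2 ^ w * card {i. i < \<beta> \<and> f i = om}" if "\<And>i. i < \<beta> \<Longrightarrow> length (f i :: bool list) = w"
proof (rule ccontr)
  assume neg: "\<not> ?thesis"
  define Pw where "Pw = {p :: bool list. length p = w}"
  have Pw: "finite Pw" "card Pw = 2 ^ w" by (simp_all add: Pw_def words_of_length)
  have less: "2 ^ w * card {i. i < \<beta> \<and> f i = om} < \<beta>" if "om \<in> Pw" for om
    using neg that by (auto simp: Pw_def not_le)
  have ne: "Pw \<noteq> {}" using Pw by (metis card.empty power_not_zero zero_neq_numeral)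
  have "\<beta> = card (\<Union>om\<in>Pw. {i. i < \<beta> \<and> f i = om})"
  proof -
    have "(\<Union>om\<in>Pw. {i. i < \<beta> \<and> f i = om}) = {..<\<beta>}" using that by (auto simp: Pw_def)
    then show ?thesis by simp
  qed
  also have "\<dots> \<le> (\<Sum>om\<in>Pw. card {i. i < \<beta> \<and> f i = om})" by (rule card_UN_le[OF Pw(1)])
  finally have "2 ^ w * \<beta> \<le> 2 ^ w * (\<Sum>om\<in>Pw. card {i. i < \<beta> \<and> f i = om})" by (rule mult_le_mono2)
  also have "\<dots> = (\<Sum>om\<in>Pw. 2 ^ w * card {i. i < \<beta> \<and> f i = om})" by (rule sum_distrib_left)
  also have "\<dots> < (\<Sum>om\<in>Pw. \<beta>)" using less Pw ne by (intro sum_strict_mono) auto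
  also have "\<dots> = 2 ^ w * \<beta>" using Pw by simp
  finally show False by simp
qed

text \<open>A cycle is a zone with word \<open>uA\<close>, followed by a path with word
  \<open>uB\<close> from the last vertex of the zone back to its first. After the zones are
  reserved, \<open>uB\<close> is embedded outside \<open>Uz\<close>, and the \<open>z\<close>
  vertices then left over complete the zones. Richness is halved twice, by removing
  \<open>Uz\<close> and by passing to the reserve, so \<open>16 / e^2\<close> becomes
  \<open>256 / e^2\<close>.\<close>

lemma combine:
  fixes e \<theta> \<rho> \<tau> :: real and K k z \<beta> q b rem m l n1 :: nat
  defines "R \<equiv> 2 * (K * (k - 1)) + 1" and "t1 \<equiv> 2 * K + 3" and "t \<equiv> q + 1 + K"
  assumes as: "asymp E" and fin: "finite V" and cV: "card V = l * m" and r: "rich E e V V" and e: "0 < e" "e \<le> 1/8"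
    and K: "256 / e^2 + 2 \<le> K" and l: "l = \<beta> * t1 + (b * t + K + 1 + rem)"
    and n1: "n1 = m * (b * t + K + rem) + z"
    and zR: "2 ^ (K + 3) * (z * R) \<le> m * \<beta>" and k: "1 \<le> k" and dom: "16 * (k * z) \<le> card V"
    and rej1: "2 * (4 * (3/4)^k * card V) \<le> z" and rej2: "(card V * (1 + 4 * (3/4)^k) ^ z)^2 \<le> (2::real) ^ z"
    and n: "t1 \<le> e^2/32 * card V" and size: "2 * (m * (\<beta> * t1 + 1)) + R * (2 * K + 8) \<le> e/2 * card V"
    and big: "2 * 4 ^ R * R \<le> card V"
    and sz: "m * b * (q + 1) + 2 ^ q * (q + 1) * \<theta> * n1 \<le> (1 - \<rho>) * n1"
    and pos: "0 < \<theta>" "0 < \<rho>" "\<rho> \<le> 1" "0 < \<tau>"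
    and \<tau>: "\<tau> \<le> e/2 * \<rho> / 8" "\<tau> \<le> \<theta> * (e/2) / 4"
    and chain: "q * (8 * \<tau> * n1 / (\<theta> * (e/2)) + 1) + \<tau> * n1 \<le> \<theta> * n1"
    and n4: "4 / (e/2) \<le> n1"
    and log: "ln (2 * (4 * card V + 1) * (2 ^ q * (q + 1) + 1)) \<le> (\<tau>/2)^2 * n1"
    and gaps: "m * ((b + 1) * (K + 1) + rem) \<le> e/2 * \<rho> / 8 * n1" "K + 1 + rem \<le> (e/2)^2 * \<rho> / 256 * n1"
  shows "has_cycle_factor l dir V E"
proof -
  define a where "a = \<beta> * t1"
  define uA where "uA = map dir [0..<a]"
  define uB where "uB = map dir [a..<l]"
  have lu: "length uA = \<beta> * t1" "length uB = b * t + K + 1 + rem" using l by (simp_all add: uA_def uB_def a_def)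
  define f where "f = (\<lambda>i. take (K + 3) (drop (i * t1) uA))"
  have lf: "length (f i) = K + 3" if "i < \<beta>" for i
  proof -
    have "Suc i * t1 \<le> \<beta> * t1" using that by (intro mult_le_mono1) simp
    then show ?thesis using lu by (simp add: f_def t1_def)
  qed
  \<comment> \<open>All cycles carry the same pattern \<open>dir\<close>, so a word popular in one
    zone gives \<open>m * card S\<close> windows in all.\<close>
  obtain om where om: "length om = K + 3" "\<beta> \<le> 2 ^ (K + 3) * card {i. i < \<beta> \<and> f i = om}"
    using popular_word[of \<beta> f "K + 3"] lf by blast
  then obtain s t' om' where "om = s # t' # om'" "length om' = K + 1"
    by (cases om; cases "tl om") auto
  moreover then obtain p d where "om' = p @ [d]" by (cases om' rule: rev_cases) auto
  ultimately have omp: "om = s # t' # p @ [d]" "length p = K" by auto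
  define S where "S = {i. i < \<beta> \<and> f i = om}"
  have S: "S \<subseteq> {..<\<beta>}" "\<forall>i\<in>S. take (K + 3) (drop (i * t1) uA) = s # t' # p @ [d]"
    using omp by (auto simp: S_def f_def)
  have "m * \<beta> \<le> m * (2 ^ (K + 3) * card S)" using om(2) unfolding S_def by (rule mult_le_mono2)
  then have "2 ^ (K + 3) * (z * R) \<le> 2 ^ (K + 3) * (m * card S)" using zR by (simp only: mult.left_commute)
  then have zS: "z * R \<le> m * card S" by simp
  have "0 < e^2" using e by simp
  then have "16 / e^2 \<le> 256 / e^2" by (intro divide_right_mono) auto
  then have K16: "16 / e^2 + 2 \<le> K" using K by linarith
  from zone[OF as fin r e K16 omp(2) lu(1)[unfolded t1_def] S[unfolded t1_def] zS[unfolded R_def] k dom rej1 rej2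
      n[unfolded t1_def] size[unfolded t1_def R_def] big[unfolded R_def], folded t1_def R_def]
  obtain hA eA Uz where Uz: "Uz \<subseteq> V" "card Uz + z = m * (\<beta> * t1 + 1)" "\<forall>c<m. hA c \<in> V \<and> eA c \<in> V"
    and zone: "\<forall>L. L \<subseteq> V - Uz \<longrightarrow> card L = z \<longrightarrow>
      (\<exists>zl. (\<forall>c<m. wpath E uA (zl c) \<and> hd (zl c) = hA c \<and> last (zl c) = eA c \<and> distinct (zl c)) \<and>
        (\<forall>c<m. \<forall>c'<m. c \<noteq> c' \<longrightarrow> set (zl c) \<inter> set (zl c') = {}) \<and> (\<Union>c<m. set (zl c)) = Uz \<union> L)"
    by (elim exE conjE) (rule that)
  define V1 where "V1 = V - Uz"
  have finUz: "finite Uz" using Uz(1) fin by (rule finite_subset)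
  have cV1: "card V1 = n1"
  proof -
    have "card V1 + card Uz = card V" unfolding V1_def using Uz(1) fin
      by (simp add: card_Diff_subset finUz card_mono)
    then have "card V1 + m * (\<beta> * t1 + 1) = l * m + z" using Uz(2) cV by simp
    also have "\<dots> = m * (\<beta> * t1 + 1) + n1" unfolding l n1 by (simp add: algebra_simps)
    finally show ?thesis by simp
  qed
  have cUz: "card Uz \<le> e/2 * card V"
  proof -
    have "card Uz \<le> 2 * (m * (\<beta> * t1 + 1)) + R * (2 * K + 8)" using Uz(2) by linarith
    from of_nat_mono[OF this, where 'a = real] show ?thesis using size by linarith
  qed
  have "Uz \<inter> V = Uz" using Uz(1) by blast
  then have r1: "rich E (e/2) V V1"
    unfolding V1_def using rich_Diff[OF r fin, of Uz] cUz e by simp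
  have e2: "0 < e/2" "e/2 \<le> 1/8" using e by auto
  have "64 / (e/2)^2 = 256 / e^2" by (simp add: power2_eq_square)
  then have K64: "64 / (e/2)^2 + 2 \<le> K" using K by simp
  have "V1 \<subseteq> V" by (auto simp: V1_def)
  have "\<exists>ml. (\<forall>c<m. wpath E uB (eA c # ml c @ [hA c]) \<and> distinct (ml c) \<and> set (ml c) \<subseteq> V1) \<and>
    (\<forall>c<m. \<forall>c'<m. c \<noteq> c' \<longrightarrow> set (ml c) \<inter> set (ml c') = {})"
    using Uz(3) sz gaps log n4 chain unfolding cV1[symmetric]
    by (intro linking[OF as fin \<open>V1 \<subseteq> V\<close> r1 e2 lu(2)[unfolded t_def] K64 _ _ _ pos \<tau>]) auto
  then obtain ml where ml: "\<forall>c<m. wpath E uB (eA c # ml c @ [hA c]) \<and> distinct (ml c) \<and> set (ml c) \<subseteq> V1"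
    and mld: "\<forall>c<m. \<forall>c'<m. c \<noteq> c' \<longrightarrow> set (ml c) \<inter> set (ml c') = {}"
    by blast
  define M where "M = (\<Union>c<m. set (ml c))"
  have lml: "length (ml c) = b * t + K + rem" if "c < m" for c using ml that lu(2) by (auto simp: wpath_def)
  have MV: "M \<subseteq> V1" using ml by (auto simp: M_def)
  have "card M = (\<Sum>c<m. card (set (ml c)))" unfolding M_def using mld by (intro card_UN_disjoint) auto
  also have "\<dots> = (\<Sum>c<m. b * t + K + rem)" using ml lml by (intro sum.cong) (auto simp: distinct_card)
  finally have cM: "card M = m * (b * t + K + rem)" by simp
  define L where "L = V1 - M"
  have finV1: "finite V1" using fin by (simp add: V1_def)
  have cL: "card L = z"
    unfolding L_def using MV finV1 cV1 cM n1 by (simp add: card_Diff_subset finite_subset)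
  have "L \<subseteq> V - Uz" by (auto simp: L_def V1_def)
  from zone[rule_format, OF this cL] obtain zl where
    zl: "\<forall>c<m. wpath E uA (zl c) \<and> hd (zl c) = hA c \<and> last (zl c) = eA c \<and> distinct (zl c)"
    and zld: "\<forall>c<m. \<forall>c'<m. c \<noteq> c' \<longrightarrow> set (zl c) \<inter> set (zl c') = {}" and zlU: "(\<Union>c<m. set (zl c)) = Uz \<union> L"
    by (elim exE conjE) (rule that)
  have sub: "set (zl c) \<inter> M = {}" "set (ml c) \<subseteq> M" if "c < m" for c
  proof -
    have "set (zl c) \<subseteq> Uz \<union> L" using zlU that by blast
    then show "set (zl c) \<inter> M = {}" using MV by (auto simp: L_def V1_def)
    show "set (ml c) \<subseteq> M" using that by (auto simp: M_def)
  qed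
  define cyc where "cyc = (\<lambda>c. zl c @ ml c)"
  show ?thesis
  proof (rule cycles_factor)
    show "l \<ge> 1" using l by simp
    fix c assume c: "c < m"
    have zw: "wpath E uA (zl c)" "last (zl c) = eA c" "hd (zl c) = hA c" "distinct (zl c)" using zl c by auto
    then have lz: "length (zl c) = \<beta> * t1 + 1" using lu by (simp add: wpath_def)
    then have "zl c \<noteq> []" by auto
    then have h: "hd (cyc c) = hA c" using zw by (simp add: cyc_def)
    show "length (cyc c) = l" using lz lml[OF c] l by (simp add: cyc_def)
    show "distinct (cyc c)" using zw(4) ml c sub[OF c] by (auto simp: cyc_def)
    have "wpath E (uA @ uB) (zl c @ ml c @ [hA c])"
      using zw(1,2) ml c by (intro wpath_join) auto
    moreover have "uA @ uB = map dir [0..<l]"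
      unfolding uA_def uB_def map_append[symmetric] using l
      by (metis a_def le_add1 upt_add_eq_append zero_le le_add_diff_inverse)
    ultimately show "wpath E (map dir [0..<l]) (cyc c @ [hd (cyc c)])" unfolding h by (simp add: cyc_def)
  next
    fix c c' assume c: "c < m" "c' < m" "c \<noteq> c'"
    have "set (zl c) \<inter> set (zl c') = {}" "set (ml c) \<inter> set (ml c') = {}" using zld mld c by auto
    then show "set (cyc c) \<inter> set (cyc c') = {}"
      using sub[OF c(1)] sub[OF c(2)] unfolding cyc_def set_append by blast
  next
    have "(\<Union>c<m. set (cyc c)) = (\<Union>c<m. set (zl c)) \<union> M" by (auto simp: cyc_def M_def)
    then show "(\<Union>c<m. set (cyc c)) = V" using zlU MV Uz(1) by (auto simp: L_def V1_def)
  qed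
qed

text \<open>From \<open>ln y \<le> y\<close> at \<open>y = sqrt (M * x)\<close> one gets
  \<open>ln (M * x) \<le> 2 * sqrt (M * x)\<close>, and the square root is below a linear function
  for large \<open>x\<close>.\<close>

lemma ln_le_linear:
  fixes c M :: real
  assumes "0 < c" "0 < M" "4 * M / c^2 \<le> x"
  shows "ln (M * x) \<le> c * x"
proof -
  have x: "0 < x" using assms by (smt (verit) divide_pos_pos mult_pos_pos zero_less_power)
  have "4 * M \<le> c^2 * x" using assms by (simp add: divide_le_eq mult.commute)
  then have "4 * M * x \<le> c^2 * x * x" using x by (intro mult_right_mono) auto
  then have "4 * (M * x) \<le> (c * x)^2" by (simp add: power2_eq_square mult_ac)
  then have "sqrt (4 * (M * x)) \<le> c * x" using assms x by (intro real_le_lsqrt) auto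
  then have s: "2 * sqrt (M * x) \<le> c * x" by (simp add: real_sqrt_mult)
  have "ln (sqrt (M * x)) \<le> sqrt (M * x)" using assms x ln_bound[of "sqrt (M * x)"] by simp
  then have "ln (M * x) / 2 \<le> sqrt (M * x)" using assms x by (simp add: ln_sqrt)
  then show ?thesis using s by linarith
qed

subsection \<open>Choice of the constants\<close>

text \<open>Constants are chosen in the order \<open>K\<close>, \<open>k\<close>,
  \<open>\<eta>\<close>, \<open>\<rho>\<close>, \<open>q\<close>, \<open>\<theta>\<close>,
  \<open>\<tau>\<close>, \<open>l0\<close>, all from \<open>e\<close> alone. Since
  \<open>card V = l * m \<ge> l\<close>, a lower bound on \<open>l\<close> serves every
  \<open>m\<close>.\<close>

lemma core:
  fixes e :: real
  assumes e: "0 < e" "e \<le> 1/8"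
  shows "\<exists>l0. \<forall>l\<ge>l0. \<forall>dir m (V :: 'a set) E. m \<ge> 1 \<longrightarrow> asymp E \<longrightarrow> finite V \<longrightarrow> card V = l * m \<longrightarrow>
    rich E e V V \<longrightarrow> has_cycle_factor l dir V E"
proof -
  define K where "K = nat \<lceil>256 / e^2\<rceil> + 2"
  have K: "256 / e^2 + 2 \<le> real K" unfolding K_def by (simp add: real_nat_ceiling_ge)
  have K1: "1 \<le> K" by (simp add: K_def)
  define t1 where "t1 = 2 * K + 3"
  \<comment> \<open>Zones fill about \<open>e/8\<close> of each cycle, in blocks of
    \<open>t1\<close> letters, and at least one block in \<open>2 ^ (K + 3)\<close> has the popular
    word. With a factor 2 for rounding, \<open>c0 * n\<close> strands find a window.\<close>
  define c0 where "c0 = e / (16 * t1 * 2 ^ (K + 3))"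
  have t1: "1 \<le> real t1" by (simp add: t1_def)
  have c0: "0 < c0" "c0 \<le> 1/128"
  proof -
    show "0 < c0" using e t1 by (simp add: c0_def)
    have "16 * 1 * 1 \<le> 16 * real t1 * 2 ^ (K + 3)" using t1 by (intro mult_mono) auto
    then have "c0 \<le> e / 16" unfolding c0_def using e by (intro divide_left_mono) auto
    then show "c0 \<le> 1/128" using e by simp
  qed
  \<comment> \<open>\<open>R\<close> grows only linearly in \<open>k\<close>, while the share of
    vertices that a pair rejects decays like \<open>(3/4)^k\<close>. For large \<open>k\<close> the
    share \<open>\<eta> = c0 / R\<close> of absorbed vertices therefore exceeds the rejected share
    by the margin needed.\<close>
  have "(\<lambda>k. 32 * real K * (real k * (3/4)^k) + 16 * (3/4)^k) \<longlonglongrightarrow> 32 * real K * 0 + 16 * 0"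
    by (intro tendsto_intros powser_times_n_limit_0) auto
  then have "\<forall>\<^sub>F k in sequentially. 32 * real K * (real k * (3/4)^k) + 16 * (3/4)^k < c0"
    using c0(1) by (intro order_tendstoD(2)) auto
  then obtain k where k: "1 \<le> k" "32 * real K * (real k * (3/4)^k) + 16 * (3/4)^k < c0"
    unfolding eventually_sequentially by (meson le_cases nle_le)
  define R where "R = 2 * (K * (k - 1)) + 1"
  have R1: "1 \<le> real R" by (simp add: R_def)
  have kR: "k \<le> R" using K1 k(1) by (cases k) (auto simp: R_def)
  define \<eta> where "\<eta> = c0 / R"
  have \<eta>R: "\<eta> * R = c0" using R1 by (simp add: \<eta>_def)
  have \<eta>: "0 < \<eta>" "\<eta> \<le> 1/128"
  proof -
    show "0 < \<eta>" using c0 R1 by (simp add: \<eta>_def)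
    then have "\<eta> * 1 \<le> \<eta> * R" using R1 by (intro mult_left_mono) auto
    then show "\<eta> \<le> 1/128" using \<eta>R c0 by simp
  qed
  have pk: "8 * (3/4)^k \<le> \<eta> / 2"
  proof -
    have "real R \<le> 2 * real K * real k + 1"
    proof -
      have "R \<le> 2 * K * k + 1" by (simp add: R_def)
      from of_nat_mono[OF this, where 'a = real] show ?thesis by simp
    qed
    then have "(16 * (3/4)^k) * real R \<le> (16 * (3/4)^k) * (2 * real K * real k + 1)" by (intro mult_left_mono) auto
    also have "\<dots> = 32 * real K * (real k * (3/4)^k) + 16 * (3/4)^k" by (simp add: algebra_simps)
    also have "\<dots> \<le> \<eta> * R" using k(2) \<eta>R by simp
    finally have "16 * (3/4)^k \<le> \<eta>" using R1 by (simp add: mult_le_cancel_right)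
    then show ?thesis by simp
  qed
  \<comment> \<open>The reserve and the slack of all parts are allotted \<open>\<eta> / 4\<close>
    each; together they fit into the \<open>z \<ge> \<eta> * n / 2\<close> vertices that are left
    for absorption.\<close>
  define \<rho> where "\<rho> = \<eta> / 4"
  have \<rho>: "0 < \<rho>" "\<rho> \<le> 1" using \<eta> by (auto simp: \<rho>_def)
  have e\<rho>: "0 < e * \<rho>" "0 < e^2 * \<rho>" using e \<rho> by auto
  \<comment> \<open>Pieces must be so much longer than links that all links fit into a reserve of
    share \<open>\<rho>\<close>.\<close>
  define q where "q = nat \<lceil>64 * real (K + 1) / (e * \<rho>)\<rceil>"
  define t where "t = q + 1 + K"
  have tK: "64 * real (K + 1) \<le> e * \<rho> * t"
  proof -
    have "64 * real (K + 1) / (e * \<rho>) \<le> real q" unfolding q_def by (rule real_nat_ceiling_ge)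
    also have "\<dots> \<le> t" by (simp add: t_def)
    finally show ?thesis using e\<rho> by (simp add: divide_le_eq mult.commute)
  qed
  define M0 :: real where "M0 = 2 ^ q * real (q + 1)"
  have M0: "1 \<le> M0"
  proof -
    have "1 * 1 \<le> (2 ^ q :: real) * real (q + 1)" by (intro mult_mono) auto
    then show ?thesis by (simp only: M0_def)
  qed
  define \<theta> where "\<theta> = \<eta> / (4 * M0)"
  have \<theta>M: "M0 * \<theta> = \<eta> / 4" using M0 by (simp add: \<theta>_def)
  have \<theta>: "0 < \<theta>" "\<theta> \<le> 1"
  proof -
    show "0 < \<theta>" using \<eta> M0 by (simp add: \<theta>_def)
    then have "1 * \<theta> \<le> M0 * \<theta>" using M0 by (intro mult_right_mono) auto
    then show "\<theta> \<le> 1" using \<theta>M \<eta> by simp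
  qed
  \<comment> \<open>The first bound keeps the reserve rich, the second keeps the losses of
    \<open>q\<close> matchings within the slack \<open>\<theta>\<close>.\<close>
  define \<tau> where "\<tau> = min (e/2 * \<rho> / 8) (\<theta>^2 * (e/2) / (32 * (real q + 1)))"
  have \<tau>: "0 < \<tau>" "\<tau> \<le> e/2 * \<rho> / 8" "\<tau> \<le> \<theta>^2 * (e/2) / (32 * (real q + 1))"
  proof -
    show "0 < \<tau>" using e \<rho> \<theta> by (auto simp: \<tau>_def intro!: divide_pos_pos mult_pos_pos add_nonneg_pos)
  qed (unfold \<tau>_def, rule min.cobounded1, rule min.cobounded2)
  have \<tau>q: "8 * \<tau> / (\<theta> * (e/2)) * (real q + 1) \<le> \<theta> / 4"
  proof -
    have "0 < 32 * (real q + 1)" by simp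
    from pos_le_divide_eq[THEN iffD1, OF this \<tau>(3)] have "\<tau> * (32 * (real q + 1)) \<le> \<theta>^2 * (e/2)" .
    moreover have "4 * (8 * \<tau> * (real q + 1)) = \<tau> * (32 * (real q + 1))" by simp
    moreover have "4 * (\<theta> / 4 * (\<theta> * (e/2))) = \<theta>^2 * (e/2)" by (simp add: power2_eq_square)
    ultimately have "8 * \<tau> * (real q + 1) \<le> \<theta> / 4 * (\<theta> * (e/2))" by linarith
    moreover have "0 < \<theta> * (e/2)" using \<theta> e by simp
    ultimately have "8 * \<tau> * (real q + 1) / (\<theta> * (e/2)) \<le> \<theta> / 4" by (simp only: pos_divide_le_eq)
    then show ?thesis by simp
  qed
  have \<tau>\<theta>: "\<tau> \<le> \<theta> * (e/2) / 4"
  proof -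
    have "\<theta>^2 * (e/2) / (32 * (real q + 1)) \<le> \<theta>^2 * (e/2) / 4"
      using e by (intro divide_left_mono) auto
    also have "\<dots> \<le> \<theta> * (e/2) / 4"
      using \<theta> e by (intro divide_right_mono mult_right_mono) (auto simp: power2_eq_square mult_left_le)
    finally show ?thesis using \<tau>(3) by linarith
  qed
  have \<tau>4: "\<tau> \<le> \<theta> / 4"
  proof -
    have "\<theta> * (e/2) \<le> \<theta> * 1" using e \<theta> by (intro mult_left_mono) auto
    then show ?thesis using \<tau>\<theta> by simp
  qed
  \<comment> \<open>Prepares \<open>rej2\<close>: together with
    \<open>\<eta> * n / 2 \<le> z\<close> this yields \<open>n \<le> (6/5)^z\<close>, so the factor
    \<open>card V\<close> in the potential is harmless.\<close>
  have "(\<lambda>z. real z * (5/6)^z) \<longlonglongrightarrow> 0" by (intro powser_times_n_limit_0) auto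
  then have "\<forall>\<^sub>F z in sequentially. real z * (5/6)^z < \<eta> / 2"
    using \<eta>(1) by (intro order_tendstoD(2)) auto
  then obtain z0 where z0: "\<And>z. z0 \<le> z \<Longrightarrow> real z * (5/6)^z < \<eta> / 2"
    unfolding eventually_sequentially by blast
  define C where "C = 10 * (M0 + 1)"
  \<comment> \<open>One entry for each place where size matters: requirements on a single cycle are
    read off for \<open>l\<close>, the others for \<open>n \<ge> l\<close>.\<close>
  define x where "x = Max {32 * t1 / e, 32 / e, 128 * (K + 1 + t) / (e * \<rho>), 16 * (R * (2 * K + 8)) / e, 32 * t1 / e^2,
    2 * 4 ^ R * R, 2 / \<eta>, 2 * z0 / \<eta>, 2048 * (K + 1 + t) / (e^2 * \<rho>), 16 * q / \<theta>, 16 / e,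
    4 * C / (\<tau>^2 / 8)^2, 4 * real (K + 1)}"
  obtain l0 :: nat where "x \<le> real l0" using real_arch_simple by blast
  have "has_cycle_factor l dir V E"
    if l0: "l0 \<le> l" and m: "1 \<le> m" and as: "asymp E" and fin: "finite V" and cV: "card V = l * m"
      and r: "rich E e V V" for l dir m E and V :: "'a set"
  proof -
    have xl: "x \<le> l" using \<open>x \<le> real l0\<close> l0 by linarith
    define n where "n = real l * real m"
    have ln: "real l \<le> n" unfolding n_def using m mult_left_mono[of 1 "real m" "real l"] by simp
    have cVn: "real (card V) = n" by (simp add: n_def cV)
    have le_x: "y \<le> real l" "y \<le> n" if "y \<in> {32 * t1 / e, 32 / e, 128 * (K + 1 + t) / (e * \<rho>), 16 * (R * (2 * K + 8)) / e, 32 * t1 / e^2,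
    2 * 4 ^ R * R, 2 / \<eta>, 2 * z0 / \<eta>, 2048 * (K + 1 + t) / (e^2 * \<rho>), 16 * q / \<theta>, 16 / e,
    4 * C / (\<tau>^2 / 8)^2, 4 * real (K + 1)}" for y
    proof -
      have "y \<le> x" unfolding x_def using that by (intro Max_ge) auto
      then show "y \<le> real l" "y \<le> n" using xl ln by linarith+
    qed
    have L1: "32 * t1 \<le> e * l" using le_x(1)[of "32 * t1 / e"] e by (simp add: divide_le_eq mult.commute)
    have L2: "32 \<le> e * l" using le_x(1)[of "32 / e"] e by (simp add: divide_le_eq mult.commute)
    have L3: "128 * real (K + 1 + t) \<le> e * \<rho> * l"
      using le_x(1)[of "128 * (K + 1 + t) / (e * \<rho>)"] e\<rho> by (simp add: divide_le_eq mult.commute)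
    have N1: "16 * real (R * (2 * K + 8)) \<le> e * n"
      using le_x(2)[of "16 * (R * (2 * K + 8)) / e"] e by (simp add: divide_le_eq mult.commute)
    have N2: "t1 \<le> e^2/32 * card V"
      using le_x(2)[of "32 * t1 / e^2"] e unfolding cVn by (simp add: divide_le_eq mult.commute)
    have N3: "real (2 * 4 ^ R * R) \<le> n" using le_x(2)[of "2 * 4 ^ R * R"] by simp
    have N4: "2 \<le> \<eta> * n" using le_x(2)[of "2 / \<eta>"] \<eta> by (simp add: divide_le_eq mult.commute)
    have N5: "2 * real z0 \<le> \<eta> * n" using le_x(2)[of "2 * z0 / \<eta>"] \<eta> by (simp add: divide_le_eq mult.commute)
    have N6: "2048 * real (K + 1 + t) \<le> e^2 * \<rho> * n"
      using le_x(2)[of "2048 * (K + 1 + t) / (e^2 * \<rho>)"] e\<rho> by (simp add: divide_le_eq mult.commute)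
    have N7: "16 * real q \<le> \<theta> * n" using le_x(2)[of "16 * q / \<theta>"] \<theta> by (simp add: divide_le_eq mult.commute)
    have N8: "16 / e \<le> n" using le_x(2)[of "16 / e"] by simp
    have N9: "4 * C / (\<tau>^2 / 8)^2 \<le> n" using le_x(2)[of "4 * C / (\<tau>^2 / 8)^2"] by simp
    have L4: "4 * real (K + 1) \<le> l" using le_x(1)[of "4 * real (K + 1)"] by simp
    have n0: "0 < n" using ln L4 by simp
    have n1': "1 \<le> n" using ln L4 by simp
    define \<beta> where "\<beta> = nat \<lfloor>e * l / (8 * t1)\<rfloor>"
    have \<beta>: "real \<beta> \<le> e * l / (8 * t1)" "e * l / (8 * t1) - 1 \<le> real \<beta>"
    proof -
      have "0 \<le> e * l / (8 * t1)" using e by simp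
      then show "real \<beta> \<le> e * l / (8 * t1)" "e * l / (8 * t1) - 1 \<le> real \<beta>" unfolding \<beta>_def by linarith+
    qed
    have \<beta>1: "real \<beta> * t1 \<le> e * l / 8" using \<beta>(1) t1 by (simp add: le_divide_eq mult_ac)
    have \<beta>2: "e * l / (16 * t1) \<le> real \<beta>"
    proof -
      have "1 \<le> e * l / (16 * t1)" using L1 t1 by (simp add: le_divide_eq)
      moreover have "e * l / (8 * t1) = 2 * (e * l / (16 * t1))" by simp
      ultimately show ?thesis using \<beta>(2) by linarith
    qed
    have el: "e * l \<le> l / 8" using e mult_right_mono[of e "1/8" "real l"] by simp
    have K1l: "real (K + 1) \<le> l / 4" using L4 by simp
    have "real (\<beta> * t1 + (K + 1)) \<le> real l"
      using \<beta>1 el K1l unfolding of_nat_add[of "\<beta> * t1"] of_nat_mult by linarith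
    then have fit: "\<beta> * t1 + (K + 1) \<le> l" by (simp only: of_nat_le_iff)
    define w where "w = l - \<beta> * t1 - (K + 1)"
    define b where "b = w div t"
    define rem where "rem = w mod t"
    have lw: "l = \<beta> * t1 + (w + K + 1)" using fit by (simp add: w_def)
    have wb: "w = b * t + rem" by (simp add: b_def rem_def)
    have l: "l = \<beta> * t1 + (b * t + K + 1 + rem)" using lw wb by simp
    have rem: "rem \<le> t" unfolding rem_def by (intro less_imp_le mod_less_divisor) (simp add: t_def)
    define z where "z = nat \<lfloor>\<eta> * n\<rfloor>"
    have z: "real z \<le> \<eta> * n" "\<eta> * n / 2 \<le> real z" using N4 unfolding z_def by linarith+
    define n1 where "n1 = m * (b * t + K + rem) + z"
    have \<beta>m: "e * n / (16 * t1) \<le> real (m * \<beta>)"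
    proof -
      have "real m * (e * l / (16 * t1)) \<le> real m * real \<beta>" using \<beta>2 by (intro mult_left_mono) auto
      then show ?thesis by (simp add: n_def mult_ac)
    qed
    have zR: "2 ^ (K + 3) * (z * R) \<le> m * \<beta>"
    proof -
      have "real z * R \<le> \<eta> * n * R" using z(1) by (intro mult_right_mono) auto
      also have "\<dots> = c0 * n" using \<eta>R by (simp add: mult_ac)
      finally have "2 ^ (K + 3) * (real z * R) \<le> 2 ^ (K + 3) * (c0 * n)" by (intro mult_left_mono) auto
      also have "\<dots> = e * n / (16 * t1)" by (simp add: c0_def)
      finally have "real (2 ^ (K + 3) * (z * R)) \<le> real (m * \<beta>)" using \<beta>m by simp
      then show ?thesis by (simp only: of_nat_le_iff)
    qed
    have zRc: "real (z * R) \<le> n / 128"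
    proof -
      have "real z * R \<le> \<eta> * n * R" using z(1) by (intro mult_right_mono) auto
      also have "\<dots> = c0 * n" using \<eta>R by (simp add: mult_ac)
      also have "\<dots> \<le> 1/128 * n" using c0 n0 by (intro mult_right_mono) auto
      finally show ?thesis by simp
    qed
    have dom: "16 * (k * z) \<le> card V"
    proof -
      have "k * z \<le> z * R" using kR by (simp add: mult.commute)
      then have "real (k * z) \<le> n / 128" using zRc of_nat_mono[of "k * z" "z * R", where 'a = real] by linarith
      then have "real (16 * (k * z)) \<le> real (card V)" using n0 unfolding cVn by simp
      then show ?thesis by (simp only: of_nat_le_iff)
    qed
    have rej1: "2 * (4 * (3/4)^k * card V) \<le> real z"
    proof -
      have "8 * (3/4)^k * n \<le> \<eta> / 2 * n" using pk n0 by (intro mult_right_mono) auto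
      then show ?thesis using z(2) unfolding cVn by simp
    qed
    have rej2: "(card V * (1 + 4 * (3/4)^k) ^ z)^2 \<le> (2::real) ^ z"
    proof -
      have "z0 \<le> z" using N5 z(2) by linarith
      from z0[OF this] have "real z * (5/6)^z \<le> \<eta> / 2" by simp
      then have "real z * ((5/6)^z * (6/5)^z) \<le> \<eta> / 2 * (6/5)^z"
        using mult_right_mono[of "real z * (5/6)^z" "\<eta>/2" "(6/5)^z"] by (simp only: mult.assoc) simp
      moreover have "(5/6)^z * (6/5)^z = (1::real)" unfolding power_mult_distrib[symmetric] by simp
      ultimately have "\<eta> * n / 2 \<le> \<eta> / 2 * (6/5)^z" using z(2) by simp
      then have "n \<le> (6/5)^z" using \<eta> by simp
      moreover have "(1 + 4 * (3/4)^k) ^ z \<le> (17/16 :: real) ^ z"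
        using pk \<eta> by (intro power_mono) auto
      ultimately have "n * (1 + 4 * (3/4)^k) ^ z \<le> (6/5)^z * (17/16)^z" using n0 by (intro mult_mono) auto
      \<comment> \<open>\<open>6/5 * 17/16 = 51/40\<close>, and its square \<open>2601/1600\<close>
        is still below 2.\<close>
      also have "\<dots> = (51/40)^z" unfolding power_mult_distrib[symmetric] by simp
      finally have "(n * (1 + 4 * (3/4)^k) ^ z)^2 \<le> ((51/40)^z)^2" using n0 by (intro power_mono) auto
      also have "\<dots> = (2601/1600)^z" by (simp add: power2_eq_square power_mult_distrib[symmetric])
      also have "\<dots> \<le> 2^z" by (intro power_mono) auto
      finally show ?thesis unfolding cVn .
    qed
    have size: "2 * (m * (\<beta> * t1 + 1)) + R * (2 * K + 8) \<le> e/2 * card V"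
    proof -
      have "real m * (real \<beta> * t1) \<le> real m * (e * l / 8)" using \<beta>1 by (intro mult_left_mono) auto
      moreover have "real m * 32 \<le> real m * (e * l)" using L2 by (intro mult_left_mono) auto
      ultimately have "2 * (real m * (real \<beta> * t1) + real m) + real (R * (2 * K + 8)) \<le> e / 2 * n"
        using N1 unfolding n_def by (simp add: algebra_simps)
      then show ?thesis unfolding cVn by (simp add: algebra_simps)
    qed
    have n1n: "real n1 \<le> n" "n / 2 \<le> real n1"
    proof -
      have nl: "n = real (m * (\<beta> * t1 + 1)) + real (m * (b * t + K + rem))"
        unfolding n_def by (subst l) (simp add: algebra_simps)
      have "1 \<le> 2 ^ (K + 3) * R" using R1 by (simp add: Suc_le_eq)
      then have "z * 1 \<le> z * (2 ^ (K + 3) * R)" by (rule mult_le_mono2)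
      also have "\<dots> = 2 ^ (K + 3) * (z * R)" by (rule mult.left_commute)
      also have "\<dots> \<le> m * \<beta>" by (rule zR)
      finally have "z \<le> m * \<beta>" by simp
      also have "m * \<beta> \<le> m * (\<beta> * t1 + 1)"
      proof (rule mult_le_mono2)
        have "\<beta> * 1 \<le> \<beta> * t1" using t1 by (intro mult_le_mono2) simp
        then show "\<beta> \<le> \<beta> * t1 + 1" by (simp only: mult_1_right trans_le_add1)
      qed
      finally have "z \<le> m * (\<beta> * t1 + 1)" .
      from of_nat_mono[OF this, where 'a = real] show "real n1 \<le> n" unfolding nl n1_def by simp
      have "real (m * (\<beta> * t1 + 1)) \<le> n / 2"
      proof -
        have "4 \<le> real l" using L4 by simp
        then have "real \<beta> * t1 + 1 \<le> l / 2" using \<beta>1 el by linarith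
        then have "real m * (real \<beta> * t1 + 1) \<le> real m * (l / 2)" by (intro mult_left_mono) auto
        moreover have "real (m * (\<beta> * t1 + 1)) = real m * (real \<beta> * t1 + 1)" by (simp only: of_nat_mult of_nat_add of_nat_1)
        moreover have "real m * (l / 2) = n / 2" by (simp add: n_def)
        ultimately show ?thesis by linarith
      qed
      moreover have "real n1 = real (m * (b * t + K + rem)) + real z" by (simp only: n1_def of_nat_add)
      ultimately show "n / 2 \<le> real n1" using nl by linarith
    qed
    have mbt: "real (m * b) * t + z \<le> n1"
      unfolding n1_def by (simp add: algebra_simps)
    have sz: "m * b * (q + 1) + 2 ^ q * (q + 1) * \<theta> * n1 \<le> (1 - \<rho>) * n1"
    proof -
      have "real (m * b) * (q + 1) \<le> real (m * b) * t" by (intro mult_left_mono) (auto simp: t_def)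
      moreover have "real (2 ^ q * (q + 1)) = M0"
        by (simp only: M0_def of_nat_mult of_nat_power of_nat_numeral)
      then have "2 ^ q * (q + 1) * \<theta> * n1 = \<eta> / 4 * n1" by (simp only: \<theta>M)
      moreover have "\<eta> / 4 * n1 \<le> \<eta> / 4 * n" using n1n \<eta> by (intro mult_left_mono) auto
      moreover have "\<rho> * n1 \<le> \<eta> / 4 * n" using n1n \<eta> unfolding \<rho>_def by (intro mult_left_mono) auto
      ultimately have "real (m * b) * (q + 1) + 2 ^ q * (q + 1) * \<theta> * n1 + \<rho> * n1 \<le> n1"
        using mbt z(2) by linarith
      moreover have "real (m * b * (q + 1)) = real (m * b) * (q + 1)" by (simp only: of_nat_mult)
      moreover have "(1 - \<rho>) * n1 = n1 - \<rho> * n1" by (simp only: left_diff_distrib mult_1)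
      ultimately show ?thesis by linarith
    qed
    have chain: "q * (8 * \<tau> * n1 / (\<theta> * (e/2)) + 1) + \<tau> * n1 \<le> \<theta> * n1"
    proof -
      have "8 * \<tau> / (\<theta> * (e/2)) * q \<le> 8 * \<tau> / (\<theta> * (e/2)) * (real q + 1)"
        using \<tau> \<theta> e by (intro mult_left_mono) auto
      then have "8 * \<tau> / (\<theta> * (e/2)) * q * n1 \<le> \<theta> / 4 * n1" using \<tau>q by (intro mult_right_mono) auto
      moreover have "8 * \<tau> / (\<theta> * (e/2)) * q * n1 = q * (8 * \<tau> * n1 / (\<theta> * (e/2)))" by simp
      moreover have "\<tau> * n1 \<le> \<theta> / 4 * n1" using \<tau>4 by (intro mult_right_mono) auto
      moreover have "\<theta> * n \<le> \<theta> * (2 * n1)" using n1n \<theta> by (intro mult_left_mono) auto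
      moreover have "q * (8 * \<tau> * n1 / (\<theta> * (e/2)) + 1) = q * (8 * \<tau> * n1 / (\<theta> * (e/2))) + q"
        by (simp only: distrib_left mult_1_right)
      moreover have "\<theta> * (2 * n1) = 2 * (\<theta> * n1)" by simp
      ultimately show ?thesis using N7 by linarith
    qed
    have n4: "4 / (e/2) \<le> real n1" using N8 n1n by simp
    have log: "ln (2 * (4 * card V + 1) * (2 ^ q * (q + 1) + 1)) \<le> (\<tau>/2)^2 * n1"
    proof -
      have "2 * (4 * n + 1) * (M0 + 1) \<le> 2 * (5 * n) * (M0 + 1)"
        using n1' M0 by (intro mult_right_mono mult_left_mono) auto
      also have "\<dots> = C * n" by (simp add: C_def)
      finally have "2 * (4 * n + 1) * (M0 + 1) \<le> C * n" .
      moreover have "0 < 2 * (4 * n + 1) * (M0 + 1)" using n0 M0 by simp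
      ultimately have "ln (2 * (4 * n + 1) * (M0 + 1)) \<le> ln (C * n)" by simp
      also have "\<dots> \<le> \<tau>^2 / 8 * n" using N9 \<tau> M0 by (intro ln_le_linear) (auto simp: C_def)
      also have "\<tau>^2 / 8 * n \<le> \<tau>^2 / 8 * (2 * n1)" using n1n by (intro mult_left_mono) auto
      also have "\<dots> = (\<tau>/2)^2 * n1" by (simp add: power2_eq_square)
      finally have "ln (2 * (4 * n + 1) * (M0 + 1)) \<le> (\<tau>/2)^2 * n1" .
      moreover have "real (2 * (4 * card V + 1) * (2 ^ q * (q + 1) + 1)) = 2 * (4 * n + 1) * (M0 + 1)"
        by (simp only: M0_def of_nat_mult of_nat_add of_nat_1 of_nat_numeral of_nat_power cVn)
      ultimately show ?thesis by (simp only:)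
    qed
    define X where "X = real (K + 1 + t)"
    have gaps1: "m * ((b + 1) * (K + 1) + rem) \<le> e/2 * \<rho> / 8 * n1"
    proof -
      \<comment> \<open>The links inside the blocks are paid for by \<open>tK\<close>, the last link
        and the remainder by \<open>L3\<close>.\<close>
      have "real (m * b) * (64 * real (K + 1)) \<le> real (m * b) * (e * \<rho> * t)" using tK by (intro mult_left_mono) auto
      also have "\<dots> = e * \<rho> * (real (m * b) * t)" by simp
      also have "\<dots> \<le> e * \<rho> * n1" using mbt e\<rho> by (intro mult_left_mono) auto
      also have "real (m * b) * (64 * real (K + 1)) = 64 * (real (m * b) * real (K + 1))" by (rule mult.left_commute)
      finally have a: "64 * (real (m * b) * real (K + 1)) \<le> e * \<rho> * n1" .
      have "real m * (128 * X) \<le> real m * (e * \<rho> * l)" using L3 by (intro mult_left_mono) (auto simp: X_def)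
      also have "\<dots> = e * \<rho> * n" by (simp add: n_def)
      also have "\<dots> \<le> e * \<rho> * (2 * n1)" using n1n e\<rho> by (intro mult_left_mono) auto
      finally have "128 * (real m * X) \<le> 2 * (e * \<rho> * n1)" by simp
      then have c: "64 * (real m * X) \<le> e * \<rho> * n1" by linarith
      have "m * ((b + 1) * (K + 1) + rem) \<le> m * b * (K + 1) + m * (K + 1 + t)"
        using mult_le_mono2[OF rem, of m] by (simp add: algebra_simps)
      from of_nat_mono[OF this, where 'a = real]
      have "real (m * ((b + 1) * (K + 1) + rem)) \<le> real (m * b) * real (K + 1) + real m * X"
        by (simp only: X_def of_nat_add of_nat_mult)
      moreover have "0 \<le> e * \<rho> * n1" using e\<rho> by simp
      ultimately have "real (m * ((b + 1) * (K + 1) + rem)) \<le> e * \<rho> * n1 / 16" using a c by linarith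
      then show ?thesis by simp
    qed
    have gaps2: "K + 1 + rem \<le> (e/2)^2 * \<rho> / 256 * n1"
    proof -
      have "real (K + 1 + rem) \<le> X" using rem by (simp add: X_def)
      moreover have "e^2 * \<rho> * n \<le> e^2 * \<rho> * (2 * real n1)" using n1n e\<rho> by (intro mult_left_mono) auto
      moreover have "e^2 * \<rho> * (2 * real n1) = 2 * (e^2 * \<rho> * real n1)" by simp
      moreover have "2048 * X \<le> e^2 * \<rho> * n" using N6 by (simp only: X_def)
      ultimately have "real (K + 1 + rem) \<le> e^2 * \<rho> * n1 / 1024" by linarith
      then show ?thesis by (simp add: power2_eq_square)
    qed
    have big: "2 * 4 ^ R * R \<le> card V"
      using N3 unfolding cVn[symmetric] by (simp only: of_nat_le_iff)
    show ?thesis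
      by (rule combine[OF as fin cV r e K l[unfolded t1_def t_def] n1_def[unfolded t_def] zR[unfolded R_def] k(1) dom rej1 rej2
        N2[unfolded t1_def] size[unfolded t1_def R_def] big[unfolded R_def] sz \<theta>(1) \<rho> \<tau>(1,2) \<tau>\<theta> chain n4 log gaps1 gaps2])
  qed
  then show ?thesis by blast
qed

theorem theorem1p2:
  "\<forall>\<epsilon>::real. \<epsilon> > 0 \<longrightarrow>
     (\<exists>l0::nat. \<forall>l::nat. l \<ge> l0 \<longrightarrow> l \<ge> 3 \<longrightarrow>
        (\<forall>dir::nat \<Rightarrow> bool. \<forall>m::nat. m \<ge> 1 \<longrightarrow>
          (\<forall>(V::'a set) E. oriented_graph V E \<longrightarrow> card V = l * m \<longrightarrow>
             real (min_semidegree V E) \<ge> (3/8 + \<epsilon>) * real m * real l \<longrightarrow>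
             has_cycle_factor l dir V E)))"
proof (intro allI impI)
  fix \<epsilon> :: real assume \<epsilon>: "\<epsilon> > 0"
  \<comment> \<open>The expansion lemmas assume \<open>e \<le> 1/8\<close>; passing to a smaller
    value only weakens the degree condition.\<close>
  define e where "e = min \<epsilon> (1/8)"
  have e: "0 < e" "e \<le> 1/8" "e \<le> \<epsilon>" using \<epsilon> by (auto simp: e_def)
  obtain l0 where l0: "\<forall>l\<ge>l0. \<forall>dir m (V :: 'a set) E. m \<ge> 1 \<longrightarrow> asymp E \<longrightarrow> finite V \<longrightarrow> card V = l * m \<longrightarrow>
    rich E e V V \<longrightarrow> has_cycle_factor l dir V E"
    using core[OF e(1,2)] by blast
  show "\<exists>l0::nat. \<forall>l::nat. l \<ge> l0 \<longrightarrow> l \<ge> 3 \<longrightarrow>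
        (\<forall>dir::nat \<Rightarrow> bool. \<forall>m::nat. m \<ge> 1 \<longrightarrow>
          (\<forall>(V::'a set) E. oriented_graph V E \<longrightarrow> card V = l * m \<longrightarrow>
             real (min_semidegree V E) \<ge> (3/8 + \<epsilon>) * real m * real l \<longrightarrow>
             has_cycle_factor l dir V E))"
  proof (intro exI[of _ l0] allI impI)
    fix l m :: nat and dir :: "nat \<Rightarrow> bool" and V :: "'a set" and E
    assume A: "l0 \<le> l" "3 \<le> l" "1 \<le> m" "oriented_graph V E" "card V = l * m"
      and d: "(3/8 + \<epsilon>) * real m * real l \<le> real (min_semidegree V E)"
    have fin: "finite V" and as: "asymp E" using A(4) by (auto simp: oriented_graph_def asymp_on_def)
    have "rich E e V V"
      unfolding rich_def
    proof (intro ballI allI)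
      fix v s assume v: "v \<in> V"
      have "min_semidegree V E \<le> min (out_degree V E v) (in_degree V E v)"
        unfolding min_semidegree_def using fin v by (intro Min_le) auto
      also have "\<dots> \<le> card (nbrs E s v V)"
        by (cases s) (auto simp: out_degree_def in_degree_def nbrs_def arc_def)
      finally have "real (min_semidegree V E) \<le> card (nbrs E s v V)" by simp
      moreover have "(3/8 + e) * card V \<le> (3/8 + \<epsilon>) * card V" using e by (intro mult_right_mono) auto
      ultimately show "(3/8 + e) * card V \<le> card (nbrs E s v V)" using d A(5) by (simp add: mult_ac)
    qed
    then show "has_cycle_factor l dir V E" using l0 A(1,3,5) fin as by blast
  qed
qed

end
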